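(* Let $K$ be an algebraically closed field of characteristic $0$. Let $\mathfrak{V}^{gr}=\operatorname{var}^{\mathbb{Z}_2}(E)$ be the graded variety generated by the infinite dimensional Grassmann algebra $E$ with its natural $\mathbb{Z}_2$-grading. Let $A$ be a $\mathbb{Z}_2$-graded algebra, and let $P$ be a finite dimensional $\mathbb{Z}_2$-graded algebra such that $T_{\mathbb{Z}_2}(A)=T_{\mathbb{Z}_2}(E(P))$. Then the following three conditions are equivalent: (a) $A$ generates $\mathfrak{V}^{gr}$. (b) $P$ is a $\mathbb{Z}_2$-graded regular commutative algebra. (c) $P$ is a commutative $\mathbb{Z}_2$-graded algebra, and it contains at least one graded simple subalgebra graded isomorphic to $K\oplus cK$, with $c^2=1$. If one (and consequently all) of the conditions (a), (b), (c) is satisfied, then $A$ is an infinite dimensional $\mathbb{Z}_2$-graded regular algebra with minimal regular decomposition.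
   Context: All algebras are associative unital algebras over $K$. A $\mathbb{Z}_2$-grading on $A$ is a vector space decomposition $A=A_0\oplus A_1$ with $A_gA_h\subseteq A_{g+h}$. A graded algebra is graded simple if it has no nontrivial homogeneous ideals (and nonzero product). $K\oplus cK$, $c^2=1$, is graded with $K$ in degree $0$ and $cK$ in degree $1$. $T_{\mathbb{Z}_2}(R)$ is the ideal of $\mathbb{Z}_2$-graded polynomial identities of $R$: the set of polynomials in the free $\mathbb{Z}_2$-graded algebra $K\langle X_{\mathbb{Z}_2}\rangle$ (infinitely many noncommuting variables of each degree) that vanish when the variables are replaced by arbitrary homogeneous elements of $R$ of the corresponding degrees. The graded variety $\operatorname{var}^{\mathbb{Z}_2}(R)$ is the class of all $\mathbb{Z}_2$-graded algebras $B$ with $T_{\mathbb{Z}_2}(R)\subseteq T_{\mathbb{Z}_2}(B)$; a member $U$ generates it if $T_{\mathbb{Z}_2}(U)=T_{\mathbb{Z}_2}(R)$. $E$ is the unital algebra generated by $e_1,e_2,\dots$ with relations $e_ie_j=-e_je_i$ for all $i,j$; $E_0$ (resp. $E_1$) is the span of monomials of even length, including $1$ (resp. odd length). The Grassmann envelope of $P=P_0\oplus P_1$ is $E(P)=(P_0\otimes E_0)\oplus(P_1\otimes E_1)$, with degree $0$ and degree $1$ components these two summands. A $\mathbb{Z}_2$-graded algebra $A$ is regular if (i) for every $n\in\mathbb{N}$ and every $(g_1,\dots,g_n)\in\mathbb{Z}_2^n$ there exist $a_i\in A_{g_i}$ with $a_1\cdots a_n\neq0$; and (ii) for every $g,h\in\mathbb{Z}_2$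 there is $\beta(g,h)\in K^*$ (depending only on $g,h$) with $a_ga_h=\beta(g,h)a_ha_g$ for all $a_g\in A_g$, $a_h\in A_h$. Its regular decomposition is minimal if there are no $h\ne k$ in $\mathbb{Z}_2$ with $\beta(g,h)=\beta(g,k)$ for all $g\in\mathbb{Z}_2$. *)

theory Defs
  imports "HOL-Algebra.Algebraic_Closure_Type" "HOL-Algebra.QuotRing" "HOL-Algebra.Module"
    "HOL-Library.Poly_Mapping" "HOL-Library.Z2"
begin

text \<open>
  The scalars are a type \<open>'k\<close> of class \<open>field\<close>, seen as the record
  \<^const>\<open>ring_of_type_algebra\<close> whenever a library locale asks for a ring record. Algebras are
  carrier-based, so that the zero algebra is included. The group \<open>\<int>\<^sub>2\<close> is \<^typ>\<open>bit\<close>.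
\<close>

locale unital_algebra =
  module "ring_of_type_algebra :: 'k::field ring" A + ring A
  for A :: "('k::field, 'a, 'm) module_scheme" (structure) +
  assumes smult_mult_left:
      "\<lbrakk>x \<in> carrier A; y \<in> carrier A\<rbrakk> \<Longrightarrow> (c \<odot> x) \<otimes> y = c \<odot> (x \<otimes> y)"
    and smult_mult_right:
      "\<lbrakk>x \<in> carrier A; y \<in> carrier A\<rbrakk> \<Longrightarrow> x \<otimes> (c \<odot> y) = c \<odot> (x \<otimes> y)"

record ('k, 'a) graded_algebra = "('k, 'a) module" +
  homog :: "bit \<Rightarrow> 'a set"

locale z2_graded_algebra = unital_algebra A
  for A :: "('k::field, 'a, 'm) graded_algebra_scheme" (structure) +
  assumes homog_submodule: "submodule (homog A g) (ring_of_type_algebra :: 'k ring) A"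
    and homog_sum: "homog A 0 <+>\<^bsub>A\<^esub> homog A 1 = carrier A"
    and homog_direct: "homog A 0 \<inter> homog A 1 = {\<zero>}"
    and homog_mult: "\<lbrakk>x \<in> homog A g; y \<in> homog A h\<rbrakk> \<Longrightarrow> x \<otimes> y \<in> homog A (g + h)"

definition with_grading :: "('k, 'a) module \<Rightarrow> (bit \<Rightarrow> 'a set) \<Rightarrow> ('k, 'a) graded_algebra"
  where "with_grading A G = module.extend A (graded_algebra.fields G)"

definition lin_span :: "('k::field, 'a, 'm) module_scheme \<Rightarrow> 'a set \<Rightarrow> 'a set"
  where "lin_span A S = \<Inter>{H. submodule H (ring_of_type_algebra :: 'k ring) A \<and> S \<subseteq> H}"

definition finite_dimensional :: "('k::field, 'a, 'm) module_scheme \<Rightarrow> bool"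
  where "finite_dimensional A \<longleftrightarrow> (\<exists>S. finite S \<and> S \<subseteq> carrier A \<and> lin_span A S = carrier A)"

definition list_product :: "('a, 'm) monoid_scheme \<Rightarrow> 'a list \<Rightarrow> 'a"
  where "list_product M xs = foldr (\<otimes>\<^bsub>M\<^esub>) xs \<one>\<^bsub>M\<^esub>"

text \<open>
  A graded subalgebra is closed under the operations and is a graded algebra in its own right;
  it may have an identity element different from that of the ambient algebra.
\<close>

definition graded_subalgebra ::
    "('k::field, 'a) graded_algebra \<Rightarrow> ('k, 'a) graded_algebra \<Rightarrow> bool"
  where "graded_subalgebra B A \<longleftrightarrow>
    z2_graded_algebra B \<and> carrier B \<subseteq> carrier A \<and>
    (\<forall>g. homog B g = homog A g \<inter> carrier B) \<and>
    (\<forall>x\<in>carrier B. \<forall>y\<in>carrier B. x \<otimes>\<^bsub>B\<^esub> y = x \<otimes>\<^bsub>A\<^esub> y \<and> x \<oplus>\<^bsub>B\<^esub> y = x \<oplus>\<^bsub>A\<^esub> y) \<and>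
    (\<forall>c. \<forall>x\<in>carrier B. c \<odot>\<^bsub>B\<^esub> x = c \<odot>\<^bsub>A\<^esub> x)"

definition homogeneous_ideal :: "'a set \<Rightarrow> ('k, 'a) graded_algebra \<Rightarrow> bool"
  where "homogeneous_ideal I A \<longleftrightarrow>
    ideal I A \<and> I = (I \<inter> homog A 0) <+>\<^bsub>A\<^esub> (I \<inter> homog A 1)"

definition graded_simple :: "('k, 'a) graded_algebra \<Rightarrow> bool"
  where "graded_simple A \<longleftrightarrow>
    (\<exists>x\<in>carrier A. \<exists>y\<in>carrier A. x \<otimes>\<^bsub>A\<^esub> y \<noteq> \<zero>\<^bsub>A\<^esub>) \<and>
    (\<forall>I. homogeneous_ideal I A \<longrightarrow> I = {\<zero>\<^bsub>A\<^esub>} \<or> I = carrier A)"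

definition graded_isomorphic ::
    "('k, 'a) graded_algebra \<Rightarrow> ('k, 'b) graded_algebra \<Rightarrow> bool"
  where "graded_isomorphic A B \<longleftrightarrow>
    (\<exists>h\<in>ring_iso A B. (\<forall>c. \<forall>x\<in>carrier A. h (c \<odot>\<^bsub>A\<^esub> x) = c \<odot>\<^bsub>B\<^esub> h x) \<and>
      (\<forall>g. h ` homog A g = homog B g))"

text \<open>The algebra \<open>K \<oplus> cK\<close> with \<open>c\<^sup>2 = 1\<close>; the pair \<open>(a, b)\<close> stands for \<open>a + c b\<close>.\<close>

definition K_plus_cK :: "('k::field, 'k \<times> 'k) graded_algebra"
  where "K_plus_cK =
    \<lparr>carrier = UNIV,
     monoid.mult = (\<lambda>(a, b) (a', b'). (a * a' + b * b', a * b' + b * a')),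
     one = (1, 0), ring.zero = (0, 0),
     add = (\<lambda>(a, b) (a', b'). (a + a', b + b')),
     module.smult = (\<lambda>k (a, b). (k * a, k * b)),
     homog = (\<lambda>g. if g = 0 then {(a, 0) |a. True} else {(0, b) |b. True})\<rparr>"

definition monoid_algebra :: "('x, 'm) monoid_scheme \<Rightarrow> ('k::field, 'x \<Rightarrow>\<^sub>0 'k) module"
  where "monoid_algebra M =
    \<lparr>carrier = {f. Poly_Mapping.keys f \<subseteq> carrier M},
     monoid.mult = (\<lambda>f g. \<Sum>x\<in>Poly_Mapping.keys f. \<Sum>y\<in>Poly_Mapping.keys g.
       Poly_Mapping.single (x \<otimes>\<^bsub>M\<^esub> y) (Poly_Mapping.lookup f x * Poly_Mapping.lookup g y)),
     one = Poly_Mapping.single \<one>\<^bsub>M\<^esub> 1, ring.zero = 0, add = (+),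
     module.smult = (\<lambda>c. Poly_Mapping.map ((*) c))\<rparr>"

definition quotient_algebra ::
    "('k, 'a, 'm) module_scheme \<Rightarrow> 'a set \<Rightarrow> ('k, 'a set) module"
  where "quotient_algebra A I =
    ring.extend (A Quot I) (module.fields (\<lambda>c C. \<Union>x\<in>C. I +>\<^bsub>A\<^esub> (c \<odot>\<^bsub>A\<^esub> x)))"

definition free_monoid :: "'x list monoid"
  where "free_monoid = \<lparr>carrier = UNIV, monoid.mult = (@), one = []\<rparr>"

definition free_algebra :: "('k::field, 'x list \<Rightarrow>\<^sub>0 'k) module"
  where "free_algebra = monoid_algebra free_monoid"

definition eval_poly ::
    "('k::field, 'a, 'm) module_scheme \<Rightarrow> ('x \<Rightarrow> 'a) \<Rightarrow> ('x list \<Rightarrow>\<^sub>0 'k) \<Rightarrow> 'a"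
  where "eval_poly A \<phi> f =
    (\<Oplus>\<^bsub>A\<^esub>w\<in>Poly_Mapping.keys f. Poly_Mapping.lookup f w \<odot>\<^bsub>A\<^esub> list_product A (map \<phi> w))"

text \<open>
  A variable of the free graded algebra is a pair \<open>(g, i)\<close> of its degree \<open>g\<close> and an index \<open>i\<close>.
\<close>

definition graded_identities ::
    "('k::field, 'a) graded_algebra \<Rightarrow> ((bit \<times> nat) list \<Rightarrow>\<^sub>0 'k) set"
  where "graded_identities A =
    {f \<in> carrier free_algebra.
      \<forall>\<phi>. (\<forall>g i. \<phi> (g, i) \<in> homog A g) \<longrightarrow> eval_poly A \<phi> f = \<zero>\<^bsub>A\<^esub>}"

definition graded_variety :: "('k::field, 'a) graded_algebra \<Rightarrow> ('k, 'b) graded_algebra set"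
  where "graded_variety R =
    {B. z2_graded_algebra B \<and> graded_identities R \<subseteq> graded_identities B}"

definition generates_graded_variety ::
    "('k::field, 'b) graded_algebra \<Rightarrow> ('k, 'a) graded_algebra \<Rightarrow> bool"
  where "generates_graded_variety U R \<longleftrightarrow>
    U \<in> graded_variety R \<and> graded_identities U = graded_identities R"

abbreviation word :: "'x list \<Rightarrow> ('x list \<Rightarrow>\<^sub>0 'k::field)"
  where "word w \<equiv> Poly_Mapping.single w 1"

definition grassmann_ideal :: "(nat list \<Rightarrow>\<^sub>0 'k::field) set"
  where "grassmann_ideal =
    Idl\<^bsub>(free_algebra :: ('k, nat list \<Rightarrow>\<^sub>0 'k) module)\<^esub> {word [i, j] + word [j, i] |i j. True}"

definition grassmann_monomial :: "nat list \<Rightarrow> (nat list \<Rightarrow>\<^sub>0 'k::field) set"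
  where "grassmann_monomial w =
    grassmann_ideal +>\<^bsub>(free_algebra :: ('k, nat list \<Rightarrow>\<^sub>0 'k) module)\<^esub> word w"

definition grassmann :: "('k::field, (nat list \<Rightarrow>\<^sub>0 'k) set) graded_algebra"
  where "grassmann =
    (let E = quotient_algebra free_algebra grassmann_ideal
     in with_grading E (\<lambda>g. lin_span E {grassmann_monomial w |w. of_nat (length w) = g}))"

text \<open>
  The tensor product of algebras: the formal combinations of pairs \<open>(a, b)\<close>, multiplied
  componentwise, modulo the bilinearity relations.
\<close>

definition tensor_relations ::
    "('k::field, 'a, 'm) module_scheme \<Rightarrow> ('k, 'b, 'n) module_scheme \<Rightarrow> ('a \<times> 'b \<Rightarrow>\<^sub>0 'k) set"
  where "tensor_relations A B =
    {Poly_Mapping.single (a \<oplus>\<^bsub>A\<^esub> a', b) 1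
       - Poly_Mapping.single (a, b) 1 - Poly_Mapping.single (a', b) 1
      |a a' b. a \<in> carrier A \<and> a' \<in> carrier A \<and> b \<in> carrier B} \<union>
    {Poly_Mapping.single (a, b \<oplus>\<^bsub>B\<^esub> b') 1
       - Poly_Mapping.single (a, b) 1 - Poly_Mapping.single (a, b') 1
      |a b b'. a \<in> carrier A \<and> b \<in> carrier B \<and> b' \<in> carrier B} \<union>
    {Poly_Mapping.single (c \<odot>\<^bsub>A\<^esub> a, b) 1 - Poly_Mapping.single (a, b) c
      |c a b. a \<in> carrier A \<and> b \<in> carrier B} \<union>
    {Poly_Mapping.single (a, c \<odot>\<^bsub>B\<^esub> b) 1 - Poly_Mapping.single (a, b) c
      |c a b. a \<in> carrier A \<and> b \<in> carrier B}"

definition tensor_ideal ::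
    "('k::field, 'a, 'm) module_scheme \<Rightarrow> ('k, 'b, 'n) module_scheme \<Rightarrow> ('a \<times> 'b \<Rightarrow>\<^sub>0 'k) set"
  where "tensor_ideal A B =
    Idl\<^bsub>(monoid_algebra (A \<times>\<times> B) :: ('k, _) module)\<^esub> (tensor_relations A B)"

definition tensor_algebra ::
    "('k::field, 'a, 'm) module_scheme \<Rightarrow> ('k, 'b, 'n) module_scheme
      \<Rightarrow> ('k, ('a \<times> 'b \<Rightarrow>\<^sub>0 'k) set) module"
  where "tensor_algebra A B = quotient_algebra (monoid_algebra (A \<times>\<times> B)) (tensor_ideal A B)"

definition pure_tensor ::
    "('k::field, 'a, 'm) module_scheme \<Rightarrow> ('k, 'b, 'n) module_scheme
      \<Rightarrow> 'a \<Rightarrow> 'b \<Rightarrow> ('a \<times> 'b \<Rightarrow>\<^sub>0 'k) set"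
  where "pure_tensor A B a b =
    tensor_ideal A B +>\<^bsub>(monoid_algebra (A \<times>\<times> B) :: ('k, _) module)\<^esub> Poly_Mapping.single (a, b) 1"

definition grassmann_envelope ::
    "('k::field, 'a) graded_algebra
      \<Rightarrow> ('k, ('a \<times> (nat list \<Rightarrow>\<^sub>0 'k) set \<Rightarrow>\<^sub>0 'k) set) graded_algebra"
  where "grassmann_envelope P =
    (let T = tensor_algebra P grassmann;
         H = (\<lambda>g. lin_span T {pure_tensor P grassmann p e |p e. p \<in> homog P g \<and> e \<in> homog grassmann g})
     in with_grading (T\<lparr>carrier := H 0 <+>\<^bsub>T\<^esub> H 1\<rparr>) H)"

definition regular_wrt :: "(bit \<Rightarrow> bit \<Rightarrow> 'k::field) \<Rightarrow> ('k, 'a) graded_algebra \<Rightarrow> bool"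
  where "regular_wrt \<beta> A \<longleftrightarrow>
    (\<forall>gs. \<exists>as. list_all2 (\<lambda>a g. a \<in> homog A g) as gs \<and> list_product A as \<noteq> \<zero>\<^bsub>A\<^esub>) \<and>
    (\<forall>g h. \<beta> g h \<noteq> 0 \<and>
      (\<forall>a\<in>homog A g. \<forall>b\<in>homog A h. a \<otimes>\<^bsub>A\<^esub> b = \<beta> g h \<odot>\<^bsub>A\<^esub> (b \<otimes>\<^bsub>A\<^esub> a)))"

definition regular :: "('k::field, 'a) graded_algebra \<Rightarrow> bool"
  where "regular A \<longleftrightarrow> (\<exists>\<beta>. regular_wrt \<beta> A)"

text \<open>The first clause of regularity determines \<open>\<beta>\<close>, so the existential quantifier is harmless.\<close>

definition minimal_regular :: "('k::field, 'a) graded_algebra \<Rightarrow> bool"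
  where "minimal_regular A \<longleftrightarrow>
    (\<exists>\<beta>. regular_wrt \<beta> A \<and> \<not> (\<exists>h k. h \<noteq> k \<and> (\<forall>g. \<beta> g h = \<beta> g k)))"

end

theory Submission
  imports Defs "HOL-Computational_Algebra.Primes" "HOL-Library.Countable_Set"
begin

text \<open>
  Call a graded algebra supercommutative if even elements are central and odd elements anticommute.
  Modulo supercommutativity a graded polynomial has a normal form: even variables gathered, odd ones
  sorted with a sign. If moreover odd products of every length can be nonzero, then the identities
  are exactly the polynomials with zero normal form: substitute scalars for the even variables and
  a nonvanishing product for a minimal set of odd ones. So all regular supercommutative algebras,
  \<open>E\<close> among them, have the same identities, and conversely these identities force regularity
  with the same commutation factor. Hence (a) says that \<open>E(P)\<close> is regular and supercommutative,
  which amounts to \<open>P\<close> being regular and commutative.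

  For (b) to (c), finite dimension gives an odd \<open>q\<close> that is not nilpotent. Its minimal polynomial has a
  nonzero root, so interpolation and Newton's iteration for \<open>y\<^sup>3 = y\<close> produce an odd polynomial in \<open>q\<close>
  whose value \<open>c \<noteq> 0\<close> satisfies \<open>c\<^sup>3 = c\<close>; then \<open>c\<^sup>2\<close> and \<open>c\<close> span a copy of \<open>K \<oplus> cK\<close>.
\<close>

subsection \<open>Unital algebras, spans and products\<close>

text \<open>The Grassmann algebra and the envelope are presented by relations, so equations in them
  are cheap and nonvanishing is the obstacle. It is certified by linear maps that kill the relation
  ideal. The kernel of a single such map need not be an ideal, but the elements killed by a whole
  family stable under multiplication from both sides form one, and it then suffices to check the
  generators. Applied to signs of words, this shows that monomials with distinct letters are
  nonzero; applied to contractions from \<open>P\<close> tensor \<open>E\<close> to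
  \<open>P\<close>, it reduces questions about pure tensors to questions in \<open>P\<close>.

  The equation y^3 = y is used because a singular \<open>P\<close> may force zero roots:
  \<open>c^2 = 1\<close> cannot be solved in general, whereas a tripotent supplies its own
  idempotent \<open>c^2\<close>, and the equation is odd, so a solution can stay odd. At the roots
  0, 1, -1 the derivative 3 y^2 - 1 takes the values -1, 2, 2; the interpolated inverse is (3 y^2 -
  2) / 2, and y - (y^3 - y) (3 y^2 - 2) / 2 is the polynomial iterated below.\<close>

lemma ring_of_type_algebra_simps [simp]:
  "carrier (ring_of_type_algebra :: 'k::field ring) = UNIV"
  "monoid.mult (ring_of_type_algebra :: 'k ring) = (*)"
  "one (ring_of_type_algebra :: 'k ring) = 1"
  "ring.zero (ring_of_type_algebra :: 'k ring) = 0"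
  "add (ring_of_type_algebra :: 'k ring) = (+)"
  by (simp_all add: ring_of_type_algebra_def)

text \<open>Additive inverses come from the scalar -1, because (-1) x + x = (-1 + 1) x = 0.\<close>

lemma unital_algebraI:
  fixes A :: "('k::field, 'a, 'm) module_scheme" (structure)
  assumes zero: "\<zero> \<in> carrier A" and one: "\<one> \<in> carrier A"
    and add: "\<And>x y. x \<in> carrier A \<Longrightarrow> y \<in> carrier A \<Longrightarrow> x \<oplus> y \<in> carrier A"
    and mult: "\<And>x y. x \<in> carrier A \<Longrightarrow> y \<in> carrier A \<Longrightarrow> x \<otimes> y \<in> carrier A"
    and smult: "\<And>c x. x \<in> carrier A \<Longrightarrow> c \<odot> x \<in> carrier A"
    and add_assoc: "\<And>x y z. x \<in> carrier A \<Longrightarrow> y \<in> carrier A \<Longrightarrow> z \<in> carrier A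
      \<Longrightarrow> x \<oplus> y \<oplus> z = x \<oplus> (y \<oplus> z)"
    and add_comm: "\<And>x y. x \<in> carrier A \<Longrightarrow> y \<in> carrier A \<Longrightarrow> x \<oplus> y = y \<oplus> x"
    and add_zero: "\<And>x. x \<in> carrier A \<Longrightarrow> \<zero> \<oplus> x = x"
    and mult_assoc: "\<And>x y z. x \<in> carrier A \<Longrightarrow> y \<in> carrier A \<Longrightarrow> z \<in> carrier A
      \<Longrightarrow> x \<otimes> y \<otimes> z = x \<otimes> (y \<otimes> z)"
    and mult_one: "\<And>x. x \<in> carrier A \<Longrightarrow> \<one> \<otimes> x = x" "\<And>x. x \<in> carrier A \<Longrightarrow> x \<otimes> \<one> = x"
    and distr: "\<And>x y z. x \<in> carrier A \<Longrightarrow> y \<in> carrier A \<Longrightarrow> z \<in> carrier A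
      \<Longrightarrow> (x \<oplus> y) \<otimes> z = x \<otimes> z \<oplus> y \<otimes> z"
      "\<And>x y z. x \<in> carrier A \<Longrightarrow> y \<in> carrier A \<Longrightarrow> z \<in> carrier A
      \<Longrightarrow> z \<otimes> (x \<oplus> y) = z \<otimes> x \<oplus> z \<otimes> y"
    and smult_zero: "\<And>x. x \<in> carrier A \<Longrightarrow> 0 \<odot> x = \<zero>"
    and smult_one: "\<And>x. x \<in> carrier A \<Longrightarrow> 1 \<odot> x = x"
    and smult_add: "\<And>c d x. x \<in> carrier A \<Longrightarrow> (c + d) \<odot> x = c \<odot> x \<oplus> d \<odot> x"
      "\<And>c x y. x \<in> carrier A \<Longrightarrow> y \<in> carrier A \<Longrightarrow> c \<odot> (x \<oplus> y) = c \<odot> x \<oplus> c \<odot> y"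
    and smult_smult: "\<And>c d x. x \<in> carrier A \<Longrightarrow> (c * d) \<odot> x = c \<odot> (d \<odot> x)"
    and smult_mult: "\<And>c x y. x \<in> carrier A \<Longrightarrow> y \<in> carrier A \<Longrightarrow> (c \<odot> x) \<otimes> y = c \<odot> (x \<otimes> y)"
      "\<And>c x y. x \<in> carrier A \<Longrightarrow> y \<in> carrier A \<Longrightarrow> x \<otimes> (c \<odot> y) = c \<odot> (x \<otimes> y)"
  shows "unital_algebra A"
proof -
  have neg: "(-1) \<odot> x \<oplus> x = \<zero>" if "x \<in> carrier A" for x
    using smult_add(1)[OF that, of "-1" 1] that by (simp add: smult_one smult_zero)
  have ag: "abelian_group A"
  proof (rule abelian_groupI)
    show "\<exists>y\<in>carrier A. y \<oplus> x = \<zero>" if "x \<in> carrier A" for x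
      using neg[OF that] smult[OF that] by blast
  qed (use zero add add_assoc add_comm add_zero in auto)
  have "module (ring_of_type_algebra :: 'k ring) A"
    by (rule moduleI) (auto simp: ag cring_from_type_algebra smult smult_add smult_smult smult_one)
  moreover have "ring A"
    by (rule ringI) (auto simp: ag distr mult one mult_assoc mult_one intro!: monoidI)
  ultimately show ?thesis
    by (auto simp: unital_algebra_def unital_algebra_axioms_def smult_mult)
qed

context unital_algebra
begin

lemma smult_carrier [simp, intro]: "x \<in> carrier A \<Longrightarrow> c \<odot> x \<in> carrier A"
  using smult_closed[of c x] by simp

lemma smult_add_left: "x \<in> carrier A \<Longrightarrow> (c + d) \<odot> x = c \<odot> x \<oplus> d \<odot> x"
  using smult_l_distr[of c d x] by simp

lemma smult_add_right: "x \<in> carrier A \<Longrightarrow> y \<in> carrier A \<Longrightarrow> c \<odot> (x \<oplus> y) = c \<odot> x \<oplus> c \<odot> y"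
  using smult_r_distr[of c x y] by simp

lemma smult_smult [simp]: "x \<in> carrier A \<Longrightarrow> c \<odot> (d \<odot> x) = (c * d) \<odot> x"
  using smult_assoc1[of c d x] by simp

lemma one_smult [simp]: "x \<in> carrier A \<Longrightarrow> 1 \<odot> x = x"
  using smult_one[of x] by simp

lemma zero_smult [simp]: "x \<in> carrier A \<Longrightarrow> 0 \<odot> x = \<zero>"
  using smult_l_null[of x] by simp

lemma smult_zero [simp]: "c \<odot> \<zero> = \<zero>"
  using smult_r_null[of c] by simp

lemma a_inv_eq_smult:
  assumes "x \<in> carrier A" shows "\<ominus> x = (-1) \<odot> x"
proof -
  have "(-1) \<odot> x \<oplus> x = \<zero>" using smult_add_left[of x "-1" 1] assms by simp
  then show ?thesis using assms by (intro minus_equality) simp_all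
qed

lemma smult_eq_zero_iff:
  assumes "x \<in> carrier A" shows "c \<odot> x = \<zero> \<longleftrightarrow> c = 0 \<or> x = \<zero>"
proof (cases "c = 0")
  case False
  then have "x = inverse c \<odot> (c \<odot> x)" using assms by simp
  then show ?thesis using assms False by (metis smult_zero)
qed (use assms in simp)

lemma finsum_smult_left:
  assumes "finite I" "x \<in> carrier A"
  shows "(\<Oplus>i\<in>I. d i \<odot> x) = (\<Sum>i\<in>I. d i) \<odot> x"
  using assms(1) by induction (use assms in \<open>simp_all add: smult_add_left Pi_def\<close>)

lemma submodule_iff:
  "submodule H (ring_of_type_algebra :: 'k ring) A \<longleftrightarrow> H \<subseteq> carrier A \<and> \<zero> \<in> H \<and>
    (\<forall>x\<in>H. \<forall>y\<in>H. x \<oplus> y \<in> H) \<and> (\<forall>c. \<forall>x\<in>H. c \<odot> x \<in> H)"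
  (is "?L \<longleftrightarrow> ?R")
proof
  assume L: ?L
  note E = submoduleE(1,2,4,5)[OF L]
  have smult: "c \<odot> x \<in> H" if "x \<in> H" for c x using E(3)[of c x] that by simp
  obtain x where "x \<in> H" using E(2) by blast
  with smult[of x 0] E(1) have "\<zero> \<in> H" by auto
  with smult E(1,4) show ?R by simp
next
  assume ?R
  then show ?L by (intro submoduleI) (simp_all add: a_inv_eq_smult subset_iff)
qed

lemma lin_span_submodule:
  assumes "S \<subseteq> carrier A"
  shows "submodule (lin_span A S) (ring_of_type_algebra :: 'k ring) A"
proof -
  have "lin_span A S \<subseteq> carrier A"
    unfolding lin_span_def by (rule Inter_lower) (simp add: assms carrier_is_submodule)
  then show ?thesis
    by (simp add: submodule_iff) (simp add: lin_span_def submodule_iff)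
qed

lemma lin_span_superset: "S \<subseteq> lin_span A S"
  by (auto simp: lin_span_def)

lemma lin_span_minimal:
  "submodule H (ring_of_type_algebra :: 'k ring) A \<Longrightarrow> S \<subseteq> H \<Longrightarrow> lin_span A S \<subseteq> H"
  by (auto simp: lin_span_def)

lemma lin_span_carrier: "S \<subseteq> carrier A \<Longrightarrow> lin_span A S \<subseteq> carrier A"
  using lin_span_submodule submoduleE(1) by simp

lemma lin_span_induct [consumes 2, case_names base zero add smult]:
  assumes "x \<in> lin_span A S" "S \<subseteq> carrier A"
    and base: "\<And>x. x \<in> S \<Longrightarrow> Q x" and zero: "Q \<zero>"
    and add: "\<And>x y. x \<in> carrier A \<Longrightarrow> y \<in> carrier A \<Longrightarrow> Q x \<Longrightarrow> Q y \<Longrightarrow> Q (x \<oplus> y)"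
    and smult: "\<And>c x. x \<in> carrier A \<Longrightarrow> Q x \<Longrightarrow> Q (c \<odot> x)"
  shows "Q x"
proof -
  have "submodule {x \<in> carrier A. Q x} (ring_of_type_algebra :: 'k ring) A"
    unfolding submodule_iff using zero add smult by simp
  from lin_span_minimal[OF this, of S] base \<open>S \<subseteq> carrier A\<close> have "lin_span A S \<subseteq> {x \<in> carrier A. Q x}"
    by blast
  with assms(1) show ?thesis by blast
qed

lemma list_product_simps [simp]:
  "list_product A [] = \<one>" "list_product A (x # xs) = x \<otimes> list_product A xs"
  by (simp_all add: list_product_def)

lemma list_product_closed [simp, intro]:
  "set xs \<subseteq> carrier A \<Longrightarrow> list_product A xs \<in> carrier A"
  by (induction xs) auto

lemma list_product_append:
  "set xs \<subseteq> carrier A \<Longrightarrow> set ys \<subseteq> carrier A \<Longrightarrow>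
    list_product A (xs @ ys) = list_product A xs \<otimes> list_product A ys"
  by (induction xs) (auto simp: m_assoc)

text \<open>For fixed outer factors the map sending \<open>x\<close> to
  \<open>y \<otimes> x \<otimes> z\<close> is linear, so it cannot vanish on all of \<open>S\<close>
  without vanishing on the span. Keeping factors on both sides allows one entry in the middle of a
  product to be replaced.\<close>

lemma span_mult_nonzero:
  assumes x: "x \<in> lin_span A S" and S: "S \<subseteq> carrier A" and y: "y \<in> carrier A" and z: "z \<in> carrier A"
    and nz: "y \<otimes> x \<otimes> z \<noteq> \<zero>"
  obtains s where "s \<in> S" "y \<otimes> s \<otimes> z \<noteq> \<zero>"
proof (rule ccontr)
  assume "\<not> thesis"
  with that have *: "s \<in> S \<Longrightarrow> y \<otimes> s \<otimes> z = \<zero>" for s by blast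
  from x S have "y \<otimes> x \<otimes> z = \<zero>"
    by (induction rule: lin_span_induct)
      (simp_all add: y z * l_distr r_distr smult_mult_left smult_mult_right)
  with nz show False by simp
qed

lemma (in -) list_all2_member_subset:
  "list_all2 (\<lambda>a g. a \<in> S g) as gs \<Longrightarrow> (\<And>g. S g \<subseteq> C) \<Longrightarrow> set as \<subseteq> C"
  by (induction rule: list_all2_induct) auto

text \<open>Multilinearity of products: a nonvanishing product of combinations contains a
  nonvanishing product of spanning elements of the same degree pattern.\<close>

lemma list_product_span_nonzero:
  assumes "list_all2 (\<lambda>a g. a \<in> lin_span A (S g)) as gs" and S: "\<And>g. S g \<subseteq> carrier A"
    and "list_product A as \<noteq> \<zero>"
  shows "\<exists>bs. list_all2 (\<lambda>b g. b \<in> S g) bs gs \<and> list_product A bs \<noteq> \<zero>"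
proof -
  \<comment> \<open>Entries are replaced from left to right; the extra factor \<open>y\<close>
    accumulates those already replaced, and the claim itself is the case of the identity.\<close>
  have "\<exists>bs. list_all2 (\<lambda>b g. b \<in> S g) bs gs \<and> y \<otimes> list_product A bs \<noteq> \<zero>"
    if "list_all2 (\<lambda>a g. a \<in> lin_span A (S g)) as gs" "y \<in> carrier A" "y \<otimes> list_product A as \<noteq> \<zero>"
    for y
    using that
  proof (induction arbitrary: y rule: list_all2_induct)
    case Nil
    then show ?case by (intro exI[of _ "[]"]) auto
  next
    case (Cons x xs g gs)
    have xs: "set xs \<subseteq> carrier A"
      by (rule list_all2_member_subset[OF Cons.hyps(2) lin_span_carrier[OF S]])
    have x: "x \<in> carrier A" using Cons.hyps lin_span_carrier[OF S] by auto
    have "y \<otimes> x \<otimes> list_product A xs \<noteq> \<zero>" using Cons.prems x xs by (simp add: m_assoc)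
    with span_mult_nonzero[OF Cons.hyps(1) S Cons.prems(1)] xs obtain s
      where s: "s \<in> S g" "y \<otimes> s \<otimes> list_product A xs \<noteq> \<zero>" by blast
    with Cons.IH[of "y \<otimes> s"] Cons.prems S obtain bs where
      bs: "list_all2 (\<lambda>b g. b \<in> S g) bs gs" "y \<otimes> s \<otimes> list_product A bs \<noteq> \<zero>" by blast
    have "set bs \<subseteq> carrier A"
      by (rule list_all2_member_subset[OF bs(1) S])
    with bs s Cons.prems S show ?case
      by (intro exI[of _ "s # bs"]) (auto simp: m_assoc subset_eq)
  qed
  moreover have "set as \<subseteq> carrier A"
    by (rule list_all2_member_subset[OF assms(1) lin_span_carrier[OF S]])
  ultimately obtain bs where bs: "list_all2 (\<lambda>b g. b \<in> S g) bs gs" "\<one> \<otimes> list_product A bs \<noteq> \<zero>"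
    using assms(1,3) by (metis list_product_closed l_one one_closed)
  moreover have "set bs \<subseteq> carrier A"
    by (rule list_all2_member_subset[OF bs(1) S])
  ultimately show ?thesis by auto
qed

text \<open>Both sides are bilinear in \<open>x\<close> and \<open>y\<close>, so the rule passes
  from the generators to the spans, first in the second argument and then in the first.\<close>

lemma span_mult_commute:
  assumes "x \<in> lin_span A S" "y \<in> lin_span A S'" "S \<subseteq> carrier A" "S' \<subseteq> carrier A"
    and comm: "\<And>s t. s \<in> S \<Longrightarrow> t \<in> S' \<Longrightarrow> s \<otimes> t = b \<odot> (t \<otimes> s)"
  shows "x \<otimes> y = b \<odot> (y \<otimes> x)"
proof -
  have "s \<otimes> y = b \<odot> (y \<otimes> s)" if "s \<in> S" for s
    using assms(2,4) by (induction rule: lin_span_induct)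
      (use that assms(3) in \<open>simp_all add: subsetD comm l_distr r_distr smult_mult_left smult_mult_right
        smult_add_right mult.commute\<close>)
  note s_y = this
  have "y \<in> carrier A" using lin_span_carrier assms by blast
  with assms(1,3) show ?thesis by (induction rule: lin_span_induct)
      (simp_all add: s_y subsetD l_distr r_distr smult_mult_left smult_mult_right smult_add_right mult.commute)
qed

lemma span_mult_closed:
  assumes "x \<in> lin_span A S" "y \<in> lin_span A S'" "S \<subseteq> carrier A" "S' \<subseteq> carrier A"
    and H: "submodule H (ring_of_type_algebra :: 'k ring) A"
    and cl: "\<And>s t. s \<in> S \<Longrightarrow> t \<in> S' \<Longrightarrow> s \<otimes> t \<in> H"
  shows "x \<otimes> y \<in> H"
proof -
  note H = H[unfolded submodule_iff]
  have "s \<otimes> y \<in> H" if "s \<in> S" for s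
    using assms(2,4) by (induction rule: lin_span_induct)
      (use that assms(3) cl H in \<open>simp_all add: subsetD r_distr smult_mult_right\<close>)
  note s_y = this
  have "y \<in> carrier A" using lin_span_carrier assms by blast
  with assms(1,3) show ?thesis by (induction rule: lin_span_induct)
      (use H s_y in \<open>simp_all add: l_distr smult_mult_left\<close>)
qed

end

section \<open>Finitely supported functions as formal linear combinations\<close>

lemma poly_mapping_sum_single:
  "f = (\<Sum>x\<in>Poly_Mapping.keys f. Poly_Mapping.single x (Poly_Mapping.lookup f x))"
  by (rule poly_mapping_eqI)
    (auto simp: lookup_sum lookup_single when_def in_keys_iff sum.delta)

lemma poly_mapping_induct_keys [consumes 1, case_names zero single add]:
  fixes f :: "'x \<Rightarrow>\<^sub>0 'k::comm_monoid_add"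
  assumes "Poly_Mapping.keys f \<subseteq> C" and zero: "Q 0"
    and single: "\<And>x c. x \<in> C \<Longrightarrow> Q (Poly_Mapping.single x c)"
    and add: "\<And>f g. Poly_Mapping.keys f \<subseteq> C \<Longrightarrow> Poly_Mapping.keys g \<subseteq> C \<Longrightarrow> Q f \<Longrightarrow> Q g \<Longrightarrow> Q (f + g)"
  shows "Q f"
proof -
  have "Poly_Mapping.keys (\<Sum>x\<in>D. Poly_Mapping.single x (Poly_Mapping.lookup f x)) \<subseteq> C \<and>
    Q (\<Sum>x\<in>D. Poly_Mapping.single x (Poly_Mapping.lookup f x))"
    if "finite D" "D \<subseteq> C" for D
    using that
  proof induction
    case (insert y F)
    let ?r = "\<Sum>x\<in>F. Poly_Mapping.single x (Poly_Mapping.lookup f x)"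
    let ?s = "Poly_Mapping.single y (Poly_Mapping.lookup f y)"
    have IH: "Poly_Mapping.keys ?r \<subseteq> C" "Q ?r" and y: "y \<in> C" using insert by auto
    have ks: "Poly_Mapping.keys ?s \<subseteq> C" using y by simp
    have "Q (?s + ?r)" by (rule add[OF ks IH(1) single[OF y] IH(2)])
    moreover have "Poly_Mapping.keys (?s + ?r) \<subseteq> C"
      using keys_add[of ?s ?r] ks IH(1) by blast
    ultimately show ?case using insert.hyps by simp
  qed (simp add: zero)
  from this[OF finite_keys assms(1)] show ?thesis
    by (simp add: poly_mapping_sum_single[symmetric])
qed

lemma lookup_map_times [simp]:
  "Poly_Mapping.lookup (Poly_Mapping.map ((*) (c::'k::semiring_0)) f) x = c * Poly_Mapping.lookup f x"
  by (simp add: Poly_Mapping.map.rep_eq when_def)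

lemma keys_map_times: "Poly_Mapping.keys (Poly_Mapping.map ((*) (c::'k::semiring_0)) f) \<subseteq> Poly_Mapping.keys f"
  by (auto simp: in_keys_iff)

lemma map_times_single:
  "Poly_Mapping.map ((*) (c::'k::semiring_0)) (Poly_Mapping.single x d) = Poly_Mapping.single x (c * d)"
  by (rule poly_mapping_eqI) (simp add: lookup_single when_def)

lemma map_times_add:
  "Poly_Mapping.map ((*) (c::'k::semiring_0)) (f + g) = Poly_Mapping.map ((*) c) f + Poly_Mapping.map ((*) c) g"
  by (rule poly_mapping_eqI) (simp add: lookup_add distrib_left)

subsection \<open>Linear extension\<close>

definition lin_ext :: "('k::field, 'a, 'm) module_scheme \<Rightarrow> ('x \<Rightarrow> 'a) \<Rightarrow> ('x \<Rightarrow>\<^sub>0 'k) \<Rightarrow> 'a"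
  where "lin_ext A \<psi> f = (\<Oplus>\<^bsub>A\<^esub>x\<in>Poly_Mapping.keys f. Poly_Mapping.lookup f x \<odot>\<^bsub>A\<^esub> \<psi> x)"

lemma eval_poly_eq_lin_ext: "eval_poly A \<phi> = lin_ext A (\<lambda>w. list_product A (map \<phi> w))"
  by (simp add: fun_eq_iff eval_poly_def lin_ext_def)

context unital_algebra
begin

text \<open>Lets several combinations be summed over one common finite index set, although their
  supports differ.\<close>

lemma lin_ext_superset:
  assumes "range \<psi> \<subseteq> carrier A" "finite D" "Poly_Mapping.keys f \<subseteq> D"
  shows "lin_ext A \<psi> f = (\<Oplus>x\<in>D. Poly_Mapping.lookup f x \<odot> \<psi> x)"
  unfolding lin_ext_def
proof (rule add.finprod_mono_neutral_cong_left)
  have \<psi>: "\<psi> x \<in> carrier A" for x using assms(1) by blast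
  then show "Poly_Mapping.lookup f i \<odot> \<psi> i = \<zero>" if "i \<in> D - Poly_Mapping.keys f" for i
    using that by (simp add: in_keys_iff)
  show "(\<lambda>x. Poly_Mapping.lookup f x \<odot> \<psi> x) \<in> D \<rightarrow> carrier A" using \<psi> by auto
qed (use assms in auto)

lemma lin_ext_zero [simp]: "lin_ext A \<psi> 0 = \<zero>"
  by (simp add: lin_ext_def)

lemma lin_ext_single:
  assumes "range \<psi> \<subseteq> carrier A"
  shows "lin_ext A \<psi> (Poly_Mapping.single x c) = c \<odot> \<psi> x"
proof -
  have "\<psi> x \<in> carrier A" using assms by blast
  then show ?thesis
    using lin_ext_superset[OF assms, of "{x}" "Poly_Mapping.single x c"] by simp
qed

lemma lin_ext_closed [simp, intro]:
  assumes "range \<psi> \<subseteq> carrier A"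
  shows "lin_ext A \<psi> f \<in> carrier A"
  unfolding lin_ext_def by (rule finsum_closed) (use assms in auto)

lemma lin_ext_add:
  assumes "range \<psi> \<subseteq> carrier A"
  shows "lin_ext A \<psi> (f + g) = lin_ext A \<psi> f \<oplus> lin_ext A \<psi> g"
proof -
  let ?D = "Poly_Mapping.keys f \<union> Poly_Mapping.keys g"
  have \<psi>: "\<psi> x \<in> carrier A" for x using assms by blast
  have "lin_ext A \<psi> (f + g) = (\<Oplus>x\<in>?D. Poly_Mapping.lookup (f + g) x \<odot> \<psi> x)"
    by (rule lin_ext_superset[OF assms]) (simp_all add: keys_add)
  also have "\<dots> = (\<Oplus>x\<in>?D. Poly_Mapping.lookup f x \<odot> \<psi> x \<oplus> Poly_Mapping.lookup g x \<odot> \<psi> x)"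
    by (simp add: lookup_add smult_add_left \<psi>)
  also have "\<dots> = (\<Oplus>x\<in>?D. Poly_Mapping.lookup f x \<odot> \<psi> x) \<oplus> (\<Oplus>x\<in>?D. Poly_Mapping.lookup g x \<odot> \<psi> x)"
    by (rule finsum_addf) (auto simp: \<psi>)
  also have "\<dots> = lin_ext A \<psi> f \<oplus> lin_ext A \<psi> g"
    by (simp add: lin_ext_superset[OF assms, of ?D])
  finally show ?thesis .
qed

lemma lin_ext_sum:
  assumes "range \<psi> \<subseteq> carrier A" "finite I"
  shows "lin_ext A \<psi> (\<Sum>i\<in>I. h i) = (\<Oplus>i\<in>I. lin_ext A \<psi> (h i))"
  using assms(2) by induction (use assms(1) in \<open>simp_all add: lin_ext_add\<close>)

lemma lin_ext_smult:
  assumes "range \<psi> \<subseteq> carrier A"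
  shows "lin_ext A \<psi> (Poly_Mapping.map ((*) c) f) = c \<odot> lin_ext A \<psi> f"
proof -
  have \<psi>: "\<psi> x \<in> carrier A" for x using assms by blast
  have "lin_ext A \<psi> (Poly_Mapping.map ((*) c) f) =
      (\<Oplus>x\<in>Poly_Mapping.keys f. c \<odot> (Poly_Mapping.lookup f x \<odot> \<psi> x))"
    by (subst lin_ext_superset[OF assms finite_keys keys_map_times]) (simp add: \<psi>)
  also have "\<dots> = c \<odot> lin_ext A \<psi> f"
    unfolding lin_ext_def by (rule finsum_smult_ldistr[symmetric]) (auto simp: \<psi>)
  finally show ?thesis .
qed

lemma lin_ext_additive_hom:
  assumes "range \<psi> \<subseteq> carrier A" and h: "\<And>x. x \<in> carrier A \<Longrightarrow> h x \<in> carrier A" "h \<zero> = \<zero>"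
    "\<And>x y. x \<in> carrier A \<Longrightarrow> y \<in> carrier A \<Longrightarrow> h (x \<oplus> y) = h x \<oplus> h y"
    "\<And>c x. x \<in> carrier A \<Longrightarrow> h (c \<odot> x) = c \<odot> h x"
  shows "lin_ext A (\<lambda>x. h (\<psi> x)) f = h (lin_ext A \<psi> f)"
proof -
  have \<psi>: "\<psi> x \<in> carrier A" for x using assms by blast
  have r: "range (\<lambda>x. h (\<psi> x)) \<subseteq> carrier A" using h \<psi> by auto
  have "Poly_Mapping.keys f \<subseteq> UNIV" by simp
  then show ?thesis
    by (induction rule: poly_mapping_induct_keys)
      (simp_all add: h lin_ext_single lin_ext_add r assms(1) \<psi>)
qed

end

subsection \<open>Monoid algebras\<close>

lemma monoid_algebra_simps [simp]:
  "carrier (monoid_algebra M) = {f. Poly_Mapping.keys f \<subseteq> carrier M}"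
  "one (monoid_algebra M) = Poly_Mapping.single \<one>\<^bsub>M\<^esub> 1"
  "ring.zero (monoid_algebra M) = 0"
  "add (monoid_algebra M) = (+)"
  "module.smult (monoid_algebra M) = (\<lambda>c. Poly_Mapping.map ((*) c))"
  by (simp_all add: monoid_algebra_def)

lemma monoid_algebra_mult_superset:
  assumes "finite D" "finite Y" "Poly_Mapping.keys f \<subseteq> D" "Poly_Mapping.keys g \<subseteq> Y"
  shows "f \<otimes>\<^bsub>monoid_algebra M\<^esub> g = (\<Sum>x\<in>D. \<Sum>y\<in>Y.
    Poly_Mapping.single (x \<otimes>\<^bsub>M\<^esub> y) (Poly_Mapping.lookup f x * Poly_Mapping.lookup g y))"
proof -
  have "f \<otimes>\<^bsub>monoid_algebra M\<^esub> g = (\<Sum>x\<in>Poly_Mapping.keys f. \<Sum>y\<in>Poly_Mapping.keys g.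
    Poly_Mapping.single (x \<otimes>\<^bsub>M\<^esub> y) (Poly_Mapping.lookup f x * Poly_Mapping.lookup g y))"
    by (simp add: monoid_algebra_def)
  also have "\<dots> = (\<Sum>x\<in>Poly_Mapping.keys f. \<Sum>y\<in>Y.
    Poly_Mapping.single (x \<otimes>\<^bsub>M\<^esub> y) (Poly_Mapping.lookup f x * Poly_Mapping.lookup g y))"
    by (intro sum.cong sum.mono_neutral_left assms refl) (simp add: in_keys_iff)
  also have "\<dots> = (\<Sum>x\<in>D. \<Sum>y\<in>Y.
    Poly_Mapping.single (x \<otimes>\<^bsub>M\<^esub> y) (Poly_Mapping.lookup f x * Poly_Mapping.lookup g y))"
    by (intro sum.mono_neutral_left assms) (simp add: in_keys_iff)
  finally show ?thesis .
qed

lemma monoid_algebra_mult_single: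
  "Poly_Mapping.single x a \<otimes>\<^bsub>monoid_algebra M\<^esub> Poly_Mapping.single y b =
    Poly_Mapping.single (x \<otimes>\<^bsub>M\<^esub> y) (a * b)"
  by (subst monoid_algebra_mult_superset[of "{x}" "{y}"]) simp_all

lemma monoid_algebra_distr:
  "(f + f') \<otimes>\<^bsub>monoid_algebra M\<^esub> g = f \<otimes>\<^bsub>monoid_algebra M\<^esub> g + f' \<otimes>\<^bsub>monoid_algebra M\<^esub> g"
  "g \<otimes>\<^bsub>monoid_algebra M\<^esub> (f + f') = g \<otimes>\<^bsub>monoid_algebra M\<^esub> f + g \<otimes>\<^bsub>monoid_algebra M\<^esub> f'"
proof -
  let ?D = "Poly_Mapping.keys f \<union> Poly_Mapping.keys f'" and ?Y = "Poly_Mapping.keys g"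
  have k: "Poly_Mapping.keys (f + f') \<subseteq> ?D" by (rule keys_add)
  show "(f + f') \<otimes>\<^bsub>monoid_algebra M\<^esub> g = f \<otimes>\<^bsub>monoid_algebra M\<^esub> g + f' \<otimes>\<^bsub>monoid_algebra M\<^esub> g"
    by (simp add: monoid_algebra_mult_superset[of ?D ?Y] k lookup_add distrib_right single_add sum.distrib)
  show "g \<otimes>\<^bsub>monoid_algebra M\<^esub> (f + f') = g \<otimes>\<^bsub>monoid_algebra M\<^esub> f + g \<otimes>\<^bsub>monoid_algebra M\<^esub> f'"
    by (simp add: monoid_algebra_mult_superset[of ?Y ?D] k lookup_add distrib_left single_add sum.distrib)
qed

lemma monoid_algebra_mult_zero [simp]:
  "0 \<otimes>\<^bsub>monoid_algebra M\<^esub> g = 0" "g \<otimes>\<^bsub>monoid_algebra M\<^esub> 0 = 0"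
  by (simp_all add: monoid_algebra_def)

lemma monoid_algebra_smult_mult:
  "Poly_Mapping.map ((*) c) f \<otimes>\<^bsub>monoid_algebra M\<^esub> g = Poly_Mapping.map ((*) c) (f \<otimes>\<^bsub>monoid_algebra M\<^esub> g)"
  "f \<otimes>\<^bsub>monoid_algebra M\<^esub> Poly_Mapping.map ((*) c) g = Poly_Mapping.map ((*) c) (f \<otimes>\<^bsub>monoid_algebra M\<^esub> g)"
proof -
  have map_sum: "Poly_Mapping.map ((*) c) (\<Sum>i\<in>I. h i) = (\<Sum>i\<in>I. Poly_Mapping.map ((*) c) (h i))" for I and h :: "_ \<Rightarrow> (_ \<Rightarrow>\<^sub>0 'b)"
    by (rule poly_mapping_eqI) (simp add: lookup_sum sum_distrib_left)
  show "Poly_Mapping.map ((*) c) f \<otimes>\<^bsub>monoid_algebra M\<^esub> g = Poly_Mapping.map ((*) c) (f \<otimes>\<^bsub>monoid_algebra M\<^esub> g)"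
    "f \<otimes>\<^bsub>monoid_algebra M\<^esub> Poly_Mapping.map ((*) c) g = Poly_Mapping.map ((*) c) (f \<otimes>\<^bsub>monoid_algebra M\<^esub> g)"
    by (simp_all add: monoid_algebra_mult_superset[of "Poly_Mapping.keys f" "Poly_Mapping.keys g"]
        keys_map_times map_sum map_times_single ac_simps)
qed

lemma unital_algebra_monoid_algebra:
  assumes "monoid M"
  shows "unital_algebra (monoid_algebra M :: ('k::field, _) module)"
proof -
  interpret M: monoid M by fact
  let ?R = "monoid_algebra M :: ('k, _) module"
  have add: "Poly_Mapping.keys (f + g) \<subseteq> carrier M"
    if "Poly_Mapping.keys f \<subseteq> carrier M" "Poly_Mapping.keys g \<subseteq> carrier M" for f g :: "_ \<Rightarrow>\<^sub>0 'k"
    using keys_add[of f g] that by blast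
  have mult: "Poly_Mapping.keys (f \<otimes>\<^bsub>?R\<^esub> g) \<subseteq> carrier M"
    if "Poly_Mapping.keys f \<subseteq> carrier M" "Poly_Mapping.keys g \<subseteq> carrier M" for f g
    using that(1)
  proof (induction rule: poly_mapping_induct_keys)
    case (single x c)
    from that(2) show ?case
      by (induction rule: poly_mapping_induct_keys)
        (use single add in \<open>simp_all add: monoid_algebra_mult_single monoid_algebra_distr\<close>)
  qed (simp_all add: monoid_algebra_distr add)
  have one: "Poly_Mapping.single \<one>\<^bsub>M\<^esub> 1 \<otimes>\<^bsub>?R\<^esub> f = f" "f \<otimes>\<^bsub>?R\<^esub> Poly_Mapping.single \<one>\<^bsub>M\<^esub> 1 = f"
    if "Poly_Mapping.keys f \<subseteq> carrier M" for f
    using that by (induction rule: poly_mapping_induct_keys;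
        simp add: monoid_algebra_mult_single monoid_algebra_distr)+
  have assoc: "f \<otimes>\<^bsub>?R\<^esub> g \<otimes>\<^bsub>?R\<^esub> h = f \<otimes>\<^bsub>?R\<^esub> (g \<otimes>\<^bsub>?R\<^esub> h)"
    if f: "Poly_Mapping.keys f \<subseteq> carrier M" and g: "Poly_Mapping.keys g \<subseteq> carrier M"
      and h: "Poly_Mapping.keys h \<subseteq> carrier M" for f g h
    using f
  proof (induction rule: poly_mapping_induct_keys)
    case x: (single x c)
    from g show ?case
    proof (induction rule: poly_mapping_induct_keys)
      case y: (single y d)
      from h show ?case
        by (induction rule: poly_mapping_induct_keys)
          (simp_all add: x y M.m_assoc monoid_algebra_mult_single monoid_algebra_distr mult.assoc)
    qed (simp_all add: monoid_algebra_distr)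
  qed (simp_all add: monoid_algebra_distr)
  show ?thesis
  proof (rule unital_algebraI, goal_cases)
    case (5 c x)
    then show ?case using keys_map_times[of c x] by auto
  next
    case (14 x) show ?case by (rule poly_mapping_eqI) simp
  next
    case (15 x) show ?case by (rule poly_mapping_eqI) simp
  next
    case (16 c d x) show ?case by (rule poly_mapping_eqI) (simp add: lookup_add distrib_right)
  next
    case (18 c d x) show ?case by (rule poly_mapping_eqI) (simp add: mult.assoc)
  qed (simp_all add: add mult one assoc ac_simps monoid_algebra_distr monoid_algebra_smult_mult map_times_add)
qed

text \<open>The monoid elements span the algebra, so for a subspace absorption need only be tested
  against them.\<close>

lemma monoid_algebra_idealI:
  assumes M: "monoid M" and sub: "submodule H (ring_of_type_algebra :: 'k::field ring) (monoid_algebra M :: ('k, _) module)"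
    and l: "\<And>x f. x \<in> carrier M \<Longrightarrow> f \<in> H \<Longrightarrow> Poly_Mapping.single x 1 \<otimes>\<^bsub>(monoid_algebra M :: ('k, _) module)\<^esub> f \<in> H"
    and r: "\<And>x f. x \<in> carrier M \<Longrightarrow> f \<in> H \<Longrightarrow> f \<otimes>\<^bsub>(monoid_algebra M :: ('k, _) module)\<^esub> Poly_Mapping.single x 1 \<in> H"
  shows "ideal H (monoid_algebra M :: ('k, _) module)"
proof -
  let ?R = "monoid_algebra M :: ('k, _) module"
  interpret R: unital_algebra ?R by (rule unital_algebra_monoid_algebra[OF M])
  have H: "0 \<in> H" "f \<in> H \<Longrightarrow> g \<in> H \<Longrightarrow> f + g \<in> H" "f \<in> H \<Longrightarrow> Poly_Mapping.map ((*) c) f \<in> H" for f g c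
    using sub[unfolded R.submodule_iff] by simp_all
  have s: "Poly_Mapping.single x c = Poly_Mapping.map ((*) c) (Poly_Mapping.single x 1)" for x and c :: 'k
    by (simp add: map_times_single)
  show ?thesis
  proof (rule idealI)
    show "ring ?R" by (rule R.ring_axioms)
    show "subgroup H (add_monoid ?R)" using sub by (simp add: submodule_def)
    show "f \<otimes>\<^bsub>?R\<^esub> a \<in> H" if "a \<in> H" "f \<in> carrier ?R" for a f
    proof -
      from that(2) have "Poly_Mapping.keys f \<subseteq> carrier M" by simp
      then show ?thesis
      proof (induction rule: poly_mapping_induct_keys)
        case (single x c)
        then show ?case
          by (subst s) (simp add: monoid_algebra_smult_mult H l that(1) del: map_single)
      qed (simp_all add: H monoid_algebra_distr)
    qed
    show "a \<otimes>\<^bsub>?R\<^esub> f \<in> H" if "a \<in> H" "f \<in> carrier ?R" for a f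
    proof -
      from that(2) have "Poly_Mapping.keys f \<subseteq> carrier M" by simp
      then show ?thesis
      proof (induction rule: poly_mapping_induct_keys)
        case (single x c)
        then show ?case
          by (subst s) (simp add: monoid_algebra_smult_mult H r that(1) del: map_single)
      qed (simp_all add: H monoid_algebra_distr)
    qed
  qed
qed

subsection \<open>Quotient algebras\<close>

lemma quotient_algebra_simps:
  "carrier (quotient_algebra A I) = a_rcosets\<^bsub>A\<^esub> I"
  "monoid.mult (quotient_algebra A I) = rcoset_mult A I"
  "one (quotient_algebra A I) = I +>\<^bsub>A\<^esub> \<one>\<^bsub>A\<^esub>"
  "ring.zero (quotient_algebra A I) = I"
  "add (quotient_algebra A I) = set_add A"
  "module.smult (quotient_algebra A I) = (\<lambda>c C. \<Union>x\<in>C. I +>\<^bsub>A\<^esub> (c \<odot>\<^bsub>A\<^esub> x))"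
  by (simp_all add: quotient_algebra_def FactRing_def ring.extend_def module.fields_def)

locale algebra_ideal = unital_algebra A + ideal I A for A :: "('k::field, 'a, 'm) module_scheme" (structure) and I
begin

text \<open>Since c x = (c 1) x, an ideal of the underlying ring is automatically a
  subspace.\<close>

lemma ideal_smult: "x \<in> I \<Longrightarrow> c \<odot> x \<in> I"
  using I_l_closed[of x "c \<odot> \<one>"] smult_mult_left[of \<one> x c] a_subset by (simp add: subsetD)

lemma rcosI: "x \<in> carrier A \<Longrightarrow> I +> x \<in> carrier (quotient_algebra A I)"
  by (auto simp: quotient_algebra_simps A_RCOSETS_def')

lemma rcos_self: "x \<in> carrier A \<Longrightarrow> x \<in> I +> x"
  by (rule a_rcos_self)

lemma rcosE:
  assumes "C \<in> carrier (quotient_algebra A I)"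
  obtains x where "x \<in> carrier A" "C = I +> x"
  using assms by (auto simp: quotient_algebra_simps A_RCOSETS_def')

lemma quotient_mult: "x \<in> carrier A \<Longrightarrow> y \<in> carrier A \<Longrightarrow>
    (I +> x) \<otimes>\<^bsub>quotient_algebra A I\<^esub> (I +> y) = I +> x \<otimes> y"
  by (simp add: quotient_algebra_simps rcoset_mult_add)

lemma quotient_add: "x \<in> carrier A \<Longrightarrow> y \<in> carrier A \<Longrightarrow>
    (I +> x) \<oplus>\<^bsub>quotient_algebra A I\<^esub> (I +> y) = I +> (x \<oplus> y)"
  by (simp add: quotient_algebra_simps a_rcos_sum)

lemma rcos_eq_iff: "x \<in> carrier A \<Longrightarrow> y \<in> carrier A \<Longrightarrow> I +> x = I +> y \<longleftrightarrow> x \<ominus> y \<in> I"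
  using quotient_eq_iff_same_a_r_cos[OF is_ideal] by metis

text \<open>The union that defines the scalar multiple runs over cosets that all coincide, because
  \<open>I\<close> is a subspace; the index set is nonempty since it contains
  \<open>x\<close>.\<close>

lemma quotient_smult:
  assumes "x \<in> carrier A"
  shows "c \<odot>\<^bsub>quotient_algebra A I\<^esub> (I +> x) = I +> (c \<odot> x)"
proof -
  have "I +> (c \<odot> y) = I +> (c \<odot> x)" if "y \<in> I +> x" for y
  proof -
    from that obtain i where i: "i \<in> I" "y = i \<oplus> x" by (auto simp: a_r_coset_def')
    have ic: "i \<in> carrier A" using i(1) by (rule Icarr)
    have "c \<odot> y \<ominus> c \<odot> x = c \<odot> i \<oplus> c \<odot> x \<ominus> c \<odot> x"
      using i ic assms by (simp add: smult_add_right)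
    also have "\<dots> = c \<odot> i"
      using ic assms by (simp add: a_minus_def a_assoc r_neg)
    finally show ?thesis using i ic assms by (subst rcos_eq_iff) (auto simp: ideal_smult)
  qed
  moreover have "I +> x \<noteq> {}" using a_rcos_self[OF assms] by blast
  ultimately show ?thesis by (auto simp: quotient_algebra_simps)
qed

lemma unital_algebra_quotient: "unital_algebra (quotient_algebra A I)"
proof -
  let ?Q = "quotient_algebra A I"
  have z: "\<zero>\<^bsub>?Q\<^esub> = I +> \<zero>" by (simp add: quotient_algebra_simps a_rcos_zero[OF is_ideal])
  have o: "\<one>\<^bsub>?Q\<^esub> = I +> \<one>" by (simp add: quotient_algebra_simps)
  note simps = quotient_mult quotient_add quotient_smult rcosI
  show ?thesis
    apply (rule unital_algebraI; (elim rcosE)?)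
    apply (simp_all only: z o simps M.a_closed m_closed smult_carrier M.zero_closed one_closed)
    apply (simp_all add: l_distr r_distr M.a_assoc m_assoc smult_add_left smult_add_right
        smult_mult_left smult_mult_right)
    by (simp add: M.a_comm)
qed

end

section \<open>Gradings and scalar-valued functionals\<close>

lemma with_grading_simps [simp]:
  "carrier (with_grading A G) = carrier A"
  "monoid.mult (with_grading A G) = monoid.mult A"
  "one (with_grading A G) = one A"
  "ring.zero (with_grading A G) = ring.zero A"
  "add (with_grading A G) = add A"
  "module.smult (with_grading A G) = module.smult A"
  "homog (with_grading A G) = G"
  by (simp_all add: with_grading_def module.extend_def graded_algebra.fields_def)

lemma unital_algebra_with_grading:
  assumes "unital_algebra A"
  shows "unital_algebra (with_grading A G)"
proof -
  interpret unital_algebra A by fact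
  show ?thesis
    by (rule unital_algebraI)
      (simp_all add: M.a_ac m_assoc l_distr r_distr smult_add_left smult_add_right
        smult_mult_left smult_mult_right)
qed

lemma submodule_with_grading:
  fixes A :: "('k::field, 'a) module"
  assumes "unital_algebra A"
  shows "submodule H (ring_of_type_algebra :: 'k ring) (with_grading A G) \<longleftrightarrow>
    submodule H (ring_of_type_algebra :: 'k ring) A"
  by (simp add: unital_algebra.submodule_iff[OF assms]
      unital_algebra.submodule_iff[OF unital_algebra_with_grading[OF assms]])

lemma lin_span_with_grading:
  assumes "unital_algebra A"
  shows "lin_span (with_grading A G) S = lin_span A S"
  by (simp add: lin_span_def submodule_with_grading[OF assms])

text \<open>The common framework in which graded polynomials are evaluated, shared by
  \<open>A\<close>, the Grassmann algebra and the envelope. The identity in degree 0 makes scalars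
  admissible values of even variables.\<close>

locale unit_graded = unital_algebra A
  for A :: "('k::field, 'a, 'm) graded_algebra_scheme" (structure) +
  assumes homog_sub: "submodule (homog A g) (ring_of_type_algebra :: 'k ring) A"
    and one_homog: "\<one> \<in> homog A 0"
begin

lemma homog_carrier: "homog A g \<subseteq> carrier A"
  using submoduleE(1)[OF homog_sub] .

lemma homog_closed [simp, intro]:
  "x \<in> homog A g \<Longrightarrow> x \<in> carrier A" "\<zero> \<in> homog A g"
  "x \<in> homog A g \<Longrightarrow> c \<odot> x \<in> homog A g"
  "x \<in> homog A g \<Longrightarrow> y \<in> homog A g \<Longrightarrow> x \<oplus> y \<in> homog A g"
  using homog_sub[of g] homog_carrier[of g] by (auto simp: submodule_iff)

end

text \<open>The field as an algebra over itself, so that \<open>lin_ext\<close> also produces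
  scalar-valued functionals.\<close>

definition field_algebra :: "('k::field, 'k) module"
  where "field_algebra = \<lparr>carrier = UNIV, monoid.mult = (*), one = 1, ring.zero = 0, add = (+),
    module.smult = (*)\<rparr>"

lemma field_algebra_simps [simp]:
  "carrier field_algebra = UNIV" "monoid.mult field_algebra = (*)" "one field_algebra = 1"
  "ring.zero field_algebra = 0" "add field_algebra = (+)" "module.smult field_algebra = (*)"
  by (simp_all add: field_algebra_def)

interpretation F: unital_algebra field_algebra
  by (rule unital_algebraI) (simp_all add: algebra_simps)

text \<open>Multiplication by a basis element only shifts the argument of \<open>\<psi>\<close>.
  Closure of a common kernel under multiplication thus becomes closure of the family of functionals
  under shifts.\<close>

lemma (in unital_algebra) lin_ext_mult_single:
  assumes "range \<psi> \<subseteq> carrier A"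
  shows "lin_ext A \<psi> (Poly_Mapping.single x 1 \<otimes>\<^bsub>monoid_algebra M\<^esub> f) = lin_ext A (\<lambda>y. \<psi> (x \<otimes>\<^bsub>M\<^esub> y)) f"
    and "lin_ext A \<psi> (f \<otimes>\<^bsub>monoid_algebra M\<^esub> Poly_Mapping.single x 1) = lin_ext A (\<lambda>y. \<psi> (y \<otimes>\<^bsub>M\<^esub> x)) f"
proof -
  have r: "range (\<lambda>y. \<psi> (x \<otimes>\<^bsub>M\<^esub> y)) \<subseteq> carrier A" "range (\<lambda>y. \<psi> (y \<otimes>\<^bsub>M\<^esub> x)) \<subseteq> carrier A"
    using assms by auto
  have k: "Poly_Mapping.keys f \<subseteq> UNIV" by simp
  from k show "lin_ext A \<psi> (Poly_Mapping.single x 1 \<otimes>\<^bsub>monoid_algebra M\<^esub> f) = lin_ext A (\<lambda>y. \<psi> (x \<otimes>\<^bsub>M\<^esub> y)) f"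
    by (induction rule: poly_mapping_induct_keys)
      (simp_all add: monoid_algebra_distr monoid_algebra_mult_single lin_ext_add lin_ext_single r assms)
  from k show "lin_ext A \<psi> (f \<otimes>\<^bsub>monoid_algebra M\<^esub> Poly_Mapping.single x 1) = lin_ext A (\<lambda>y. \<psi> (y \<otimes>\<^bsub>M\<^esub> x)) f"
    by (induction rule: poly_mapping_induct_keys)
      (simp_all add: monoid_algebra_distr monoid_algebra_mult_single lin_ext_add lin_ext_single r assms)
qed

definition linear_functional :: "('k::field, 'a, 'm) module_scheme \<Rightarrow> ('a \<Rightarrow> 'k) \<Rightarrow> bool"
  where "linear_functional A \<mu> \<longleftrightarrow>
    (\<forall>x\<in>carrier A. \<forall>y\<in>carrier A. \<mu> (x \<oplus>\<^bsub>A\<^esub> y) = \<mu> x + \<mu> y) \<and>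
    (\<forall>c. \<forall>x\<in>carrier A. \<mu> (c \<odot>\<^bsub>A\<^esub> x) = c * \<mu> x)"

subsection \<open>Signs of words\<close>

text \<open>The number of inversions; its parity is the sign of the permutation that sorts a word
  with distinct letters.\<close>

fun inv_count :: "nat list \<Rightarrow> nat" where
  "inv_count [] = 0"
| "inv_count (x # xs) = length (filter (\<lambda>y. y < x) xs) + inv_count xs"

text \<open>The value 0 on words with a repeated letter reflects that such a product of odd elements
  vanishes.\<close>

definition word_sign :: "nat list \<Rightarrow> 'k::field"
  where "word_sign w = (if distinct w then (-1) ^ inv_count w else 0)"

text \<open>Interchanging neighbours leaves every comparison with the letters of \<open>u\<close>
  and \<open>v\<close> intact; exactly one of the two orders of \<open>i\<close> and
  \<open>j\<close> is an inversion.\<close>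

lemma odd_inv_count_swap:
  "i \<noteq> j \<Longrightarrow> odd (inv_count (u @ i # j # v) + inv_count (u @ j # i # v))"
  by (induction u) auto

lemma word_sign_swap: "word_sign (u @ i # j # v) = - word_sign (u @ j # i # v)"
proof (cases "i \<noteq> j \<and> distinct (u @ i # j # v)")
  case True
  then have d: "distinct (u @ i # j # v)" "distinct (u @ j # i # v)" by auto
  have "odd (inv_count (u @ i # j # v) + inv_count (u @ j # i # v))"
    using True odd_inv_count_swap by blast
  then show ?thesis
    unfolding word_sign_def using d by (simp add: minus_one_power_iff)
qed (auto simp: word_sign_def)

subsection \<open>The Grassmann algebra\<close>

lemma free_monoid_simps [simp]:
  "carrier free_monoid = UNIV" "monoid.mult free_monoid = (@)" "one free_monoid = []"
  by (simp_all add: free_monoid_def)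

lemma monoid_free_monoid: "monoid free_monoid"
  by (rule monoidI) simp_all

interpretation free: unital_algebra "free_algebra :: ('k::field, 'x list \<Rightarrow>\<^sub>0 'k) module"
  unfolding free_algebra_def by (rule unital_algebra_monoid_algebra[OF monoid_free_monoid])

lemma free_algebra_simps [simp]:
  "carrier free_algebra = UNIV" "one free_algebra = word []" "ring.zero free_algebra = 0"
  "add free_algebra = (+)" "module.smult free_algebra = (\<lambda>c. Poly_Mapping.map ((*) c))"
  by (simp_all add: free_algebra_def)

lemma word_mult [simp]: "word u \<otimes>\<^bsub>free_algebra\<^esub> word v = word (u @ v)"
  by (simp add: free_algebra_def monoid_algebra_mult_single)

lemma ideal_grassmann_ideal: "ideal grassmann_ideal (free_algebra :: ('k::field, _) module)"
  unfolding grassmann_ideal_def by (rule free.genideal_ideal) simp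

lemma algebra_ideal_grassmann_ideal: "algebra_ideal (free_algebra :: ('k::field, _) module) grassmann_ideal"
  by (intro algebra_ideal.intro free.unital_algebra_axioms ideal_grassmann_ideal)

lemmas grassmann_rcos =
  algebra_ideal.quotient_mult[OF algebra_ideal_grassmann_ideal]
  algebra_ideal.quotient_add[OF algebra_ideal_grassmann_ideal]
  algebra_ideal.quotient_smult[OF algebra_ideal_grassmann_ideal]
  algebra_ideal.rcosI[OF algebra_ideal_grassmann_ideal]
lemmas grassmann_rcosE = algebra_ideal.rcosE[OF algebra_ideal_grassmann_ideal]
lemmas grassmann_rcos_eq_iff = algebra_ideal.rcos_eq_iff[OF algebra_ideal_grassmann_ideal]

text \<open>The coordinate of the word \<open>w\<close> at the exterior basis monomial with letter
  set \<open>S\<close>. Both words of a defining relation have the same letter set, so restricting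
  to one \<open>S\<close> is compatible with the relations.\<close>

definition set_sign :: "nat set \<Rightarrow> nat list \<Rightarrow> 'k::field"
  where "set_sign S w = (if set w = S then word_sign w else 0)"

lemma set_sign_swap: "set_sign S (u @ i # j # v) + set_sign S (u @ j # i # v) = 0"
  by (simp add: set_sign_def insert_commute word_sign_swap[of u i j v])

definition grassmann_coeff :: "nat set \<Rightarrow> (nat list \<Rightarrow>\<^sub>0 'k::field) \<Rightarrow> 'k"
  where "grassmann_coeff S = lin_ext field_algebra (set_sign S)"

text \<open>\<open>H\<close> consists of the elements killed by the functional inside every context
  \<open>u\<close>, \<open>v\<close>. Multiplying by a word only enlarges a context, so
  \<open>H\<close> is an ideal, and on a generator the two signs cancel. The case of empty contexts
  is the claim.\<close>

lemma grassmann_ideal_coeff: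
  assumes "f \<in> grassmann_ideal" shows "grassmann_coeff S f = (0 :: 'k::field)"
proof -
  let ?F = "free_algebra :: ('k::field, nat list \<Rightarrow>\<^sub>0 'k) module"
  let ?L = "\<lambda>u v S f. lin_ext field_algebra (\<lambda>w. set_sign S (u @ w @ v) :: 'k) f"
  define H where "H = {f :: nat list \<Rightarrow>\<^sub>0 'k. \<forall>u v S. ?L u v S f = 0}"
  have "ideal H ?F"
    unfolding free_algebra_def
  proof (rule monoid_algebra_idealI[OF monoid_free_monoid], fold free_algebra_def)
    show "submodule H (ring_of_type_algebra :: 'k ring) ?F"
      unfolding free.submodule_iff unfolding H_def by (simp add: F.lin_ext_add F.lin_ext_smult)
    fix x :: "nat list" and f :: "nat list \<Rightarrow>\<^sub>0 'k"
    assume "f \<in> H"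
    then have f: "?L u v S f = 0" for u v S unfolding H_def by blast
    show "word x \<otimes>\<^bsub>?F\<^esub> f \<in> H"
      unfolding H_def free_algebra_def using f[where u = "_ @ x"] by (simp add: F.lin_ext_mult_single)
    show "f \<otimes>\<^bsub>?F\<^esub> word x \<in> H"
      unfolding H_def free_algebra_def using f[where v = "x @ _"] by (simp add: F.lin_ext_mult_single)
  qed
  moreover have "{word [i, j] + word [j, i] |i j. True} \<subseteq> H"
    unfolding H_def by (auto simp: set_sign_swap F.lin_ext_add F.lin_ext_single)
  ultimately have "grassmann_ideal \<subseteq> H"
    unfolding grassmann_ideal_def by (rule free.genideal_minimal)
  with assms have "f \<in> H" by blast
  then have "?L [] [] S f = 0" unfolding H_def by blast
  then show ?thesis by (simp add: grassmann_coeff_def)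
qed

text \<open>The chosen representative does not matter, since the coefficient vanishes on the
  ideal.\<close>

definition quotient_coeff :: "nat set \<Rightarrow> (nat list \<Rightarrow>\<^sub>0 'k::field) set \<Rightarrow> 'k"
  where "quotient_coeff S C = grassmann_coeff S (SOME f. f \<in> C)"

lemma quotient_coeff_rcos:
  "quotient_coeff S (grassmann_ideal +>\<^bsub>free_algebra\<^esub> f) = (grassmann_coeff S f :: 'k::field)"
proof -
  let ?C = "grassmann_ideal +>\<^bsub>(free_algebra :: ('k, _) module)\<^esub> f"
  have "f \<in> ?C" by (rule algebra_ideal.rcos_self[OF algebra_ideal_grassmann_ideal]) simp
  then have "(SOME f. f \<in> ?C) \<in> ?C" by (rule someI)
  then obtain i where "i \<in> grassmann_ideal" "(SOME f. f \<in> ?C) = i + f"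
    by (auto simp: a_r_coset_def')
  then show ?thesis
    unfolding quotient_coeff_def by (simp add: grassmann_ideal_coeff, simp add: grassmann_coeff_def F.lin_ext_add
        grassmann_ideal_coeff[unfolded grassmann_coeff_def])
qed

abbreviation grassmann_base :: "('k::field, (nat list \<Rightarrow>\<^sub>0 'k) set) module"
  where "grassmann_base \<equiv> quotient_algebra free_algebra grassmann_ideal"

lemma grassmann_eq: "grassmann = with_grading grassmann_base
    (\<lambda>g. lin_span grassmann_base {grassmann_monomial w |w. of_nat (length w) = g})"
  unfolding grassmann_def Let_def ..

interpretation base: unital_algebra "grassmann_base :: ('k::field, _) module"
  by (rule algebra_ideal.unital_algebra_quotient[OF algebra_ideal_grassmann_ideal])

interpretation gr: unital_algebra "grassmann :: ('k::field, _) graded_algebra"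
  unfolding grassmann_eq by (rule unital_algebra_with_grading[OF base.unital_algebra_axioms])

lemma grassmann_simps:
  "carrier grassmann = carrier grassmann_base" "monoid.mult grassmann = monoid.mult grassmann_base"
  "one grassmann = one grassmann_base" "ring.zero grassmann = ring.zero grassmann_base"
  "add grassmann = add grassmann_base" "module.smult grassmann = module.smult grassmann_base"
  by (simp_all only: grassmann_eq with_grading_simps)

lemma homog_grassmann:
  "homog grassmann g = lin_span grassmann {grassmann_monomial w |w. of_nat (length w) = g}"
  by (simp only: grassmann_eq with_grading_simps lin_span_with_grading[OF base.unital_algebra_axioms])

lemma linear_functional_quotient_coeff: "linear_functional grassmann (quotient_coeff S)"
  unfolding linear_functional_def grassmann_simps
  by (intro conjI ballI allI; elim grassmann_rcosE; simp only: grassmann_rcos)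
    (simp_all add: quotient_coeff_rcos grassmann_coeff_def F.lin_ext_add F.lin_ext_smult)

lemma quotient_coeff_monomial:
  "quotient_coeff S (grassmann_monomial w) = (if set w = S then word_sign w else 0)"
  by (simp add: grassmann_monomial_def quotient_coeff_rcos grassmann_coeff_def F.lin_ext_single set_sign_def)

lemma grassmann_monomial_closed: "grassmann_monomial w \<in> carrier grassmann"
  unfolding grassmann_monomial_def grassmann_simps by (rule grassmann_rcos) simp

lemma grassmann_monomial_mult:
  "grassmann_monomial u \<otimes>\<^bsub>grassmann\<^esub> grassmann_monomial v = grassmann_monomial (u @ v)"
  unfolding grassmann_monomial_def grassmann_simps by (subst grassmann_rcos) simp_all

lemma grassmann_one: "\<one>\<^bsub>grassmann\<^esub> = grassmann_monomial []"
  unfolding grassmann_monomial_def grassmann_simps by (simp add: quotient_algebra_simps)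

text \<open>The coordinate belonging to its own letter set equals 1 or -1.\<close>

lemma grassmann_monomial_nonzero:
  assumes "distinct w" shows "grassmann_monomial w \<noteq> (\<zero>\<^bsub>grassmann\<^esub> :: (_ \<Rightarrow>\<^sub>0 'k::field) set)"
proof
  assume *: "grassmann_monomial w = (\<zero>\<^bsub>grassmann\<^esub> :: (_ \<Rightarrow>\<^sub>0 'k) set)"
  have "0 \<odot>\<^bsub>grassmann\<^esub> grassmann_monomial w = (\<zero>\<^bsub>grassmann\<^esub> :: (_ \<Rightarrow>\<^sub>0 'k) set)"
    using grassmann_monomial_closed by (rule gr.zero_smult)
  then have "quotient_coeff (set w) (\<zero>\<^bsub>grassmann\<^esub> :: (_ \<Rightarrow>\<^sub>0 'k) set) = 0"
    using linear_functional_quotient_coeff grassmann_monomial_closed unfolding linear_functional_def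
    by (metis mult_zero_left)
  with * quotient_coeff_monomial[of "set w" w, where 'a = 'k] show False
    using assms by (simp add: word_sign_def)
qed

lemma grassmann_monomial_swap:
  "grassmann_monomial [i, j] = (-1) \<odot>\<^bsub>grassmann\<^esub> (grassmann_monomial [j, i] :: (_ \<Rightarrow>\<^sub>0 'k::field) set)"
proof -
  have "word [i, j] + word [j, i] \<in> (grassmann_ideal :: (_ \<Rightarrow>\<^sub>0 'k) set)"
    unfolding grassmann_ideal_def by (rule subsetD[OF free.genideal_self]) auto
  moreover have "word [i, j] \<ominus>\<^bsub>free_algebra\<^esub> ((-1) \<odot>\<^bsub>free_algebra\<^esub> word [j, i]) = (word [i, j] + word [j, i] :: _ \<Rightarrow>\<^sub>0 'k)"
    unfolding a_minus_def by (subst free.a_inv_eq_smult) (simp_all add: map_times_single)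
  ultimately have "grassmann_ideal +>\<^bsub>free_algebra\<^esub> word [i, j] =
      grassmann_ideal +>\<^bsub>free_algebra\<^esub> ((-1) \<odot>\<^bsub>free_algebra\<^esub> (word [j, i] :: _ \<Rightarrow>\<^sub>0 'k))"
    by (subst grassmann_rcos_eq_iff) simp_all
  then show ?thesis
    unfolding grassmann_monomial_def grassmann_simps by (subst grassmann_rcos) simp_all
qed

text \<open>Passing each letter of \<open>v\<close> costs one sign. Repeating this for all letters
  of \<open>u\<close> gives the exponent \<open>length u * length v\<close>, which is odd exactly
  when both degrees are odd.\<close>

lemma grassmann_monomial_letter_commute:
  "grassmann_monomial (i # v) = (-1) ^ length v \<odot>\<^bsub>grassmann\<^esub> (grassmann_monomial (v @ [i]) :: (_ \<Rightarrow>\<^sub>0 'k::field) set)"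
proof (induction v)
  case Nil
  show ?case by (simp add: grassmann_monomial_closed)
next
  case (Cons j v)
  note mult = grassmann_monomial_mult[symmetric, where 'a = 'k] and cl = grassmann_monomial_closed
  have "grassmann_monomial (i # j # v) = grassmann_monomial [i, j] \<otimes>\<^bsub>grassmann\<^esub> (grassmann_monomial v :: (_ \<Rightarrow>\<^sub>0 'k) set)"
    by (simp add: grassmann_monomial_mult)
  also have "\<dots> = (-1) \<odot>\<^bsub>grassmann\<^esub> (grassmann_monomial [j, i] \<otimes>\<^bsub>grassmann\<^esub> grassmann_monomial v)"
    by (subst grassmann_monomial_swap) (simp add: cl gr.smult_mult_left)
  also have "\<dots> = (-1) \<odot>\<^bsub>grassmann\<^esub> (grassmann_monomial [j] \<otimes>\<^bsub>grassmann\<^esub> grassmann_monomial (i # v))"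
    by (simp add: grassmann_monomial_mult)
  also have "\<dots> = (-1) ^ length (j # v) \<odot>\<^bsub>grassmann\<^esub> (grassmann_monomial [j] \<otimes>\<^bsub>grassmann\<^esub> grassmann_monomial (v @ [i]))"
    by (simp add: Cons.IH cl gr.smult_mult_right)
  finally show ?case by (simp add: grassmann_monomial_mult)
qed

lemma grassmann_monomial_commute:
  "grassmann_monomial (u @ v) =
    (-1) ^ (length u * length v) \<odot>\<^bsub>grassmann\<^esub> (grassmann_monomial (v @ u) :: (_ \<Rightarrow>\<^sub>0 'k::field) set)"
proof (induction u)
  case Nil
  show ?case by (simp add: grassmann_monomial_closed)
next
  case (Cons x u)
  note cl = grassmann_monomial_closed
  have "grassmann_monomial (x # u @ v) = grassmann_monomial [x] \<otimes>\<^bsub>grassmann\<^esub> (grassmann_monomial (u @ v) :: (_ \<Rightarrow>\<^sub>0 'k) set)"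
    by (simp add: grassmann_monomial_mult)
  also have "\<dots> = (-1) ^ (length u * length v) \<odot>\<^bsub>grassmann\<^esub>
      (grassmann_monomial (x # v) \<otimes>\<^bsub>grassmann\<^esub> grassmann_monomial u)"
    by (simp add: Cons.IH cl gr.smult_mult_right grassmann_monomial_mult)
  also have "\<dots> = ((-1) ^ (length u * length v) * (-1) ^ length v) \<odot>\<^bsub>grassmann\<^esub>
      (grassmann_monomial (v @ [x]) \<otimes>\<^bsub>grassmann\<^esub> grassmann_monomial u)"
    by (subst grassmann_monomial_letter_commute) (simp add: cl gr.smult_mult_left)
  finally show ?case by (simp add: grassmann_monomial_mult power_add mult.commute)
qed

definition grassmann_commutation :: "bit \<Rightarrow> bit \<Rightarrow> 'k::field"
  where "grassmann_commutation g h = (if g = 1 \<and> h = 1 then -1 else 1)"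

lemma of_nat_bit_eq_iff: "of_nat n = (1::bit) \<longleftrightarrow> odd n" "of_nat n = (0::bit) \<longleftrightarrow> even n"
  by (induction n) auto

lemma grassmann_monomials_subset: "{grassmann_monomial w |w. P w} \<subseteq> carrier grassmann"
  by (auto intro: grassmann_monomial_closed)

lemma grassmann_homog_commute:
  fixes a b :: "(nat list \<Rightarrow>\<^sub>0 'k::field) set"
  assumes "a \<in> homog grassmann g" "b \<in> homog grassmann h"
  shows "a \<otimes>\<^bsub>grassmann\<^esub> b = grassmann_commutation g h \<odot>\<^bsub>grassmann\<^esub> (b \<otimes>\<^bsub>grassmann\<^esub> a)"
  using assms unfolding homog_grassmann
proof (rule gr.span_mult_commute[OF _ _ grassmann_monomials_subset grassmann_monomials_subset])
  fix s t :: "(nat list \<Rightarrow>\<^sub>0 'k) set"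
  assume "s \<in> {grassmann_monomial w |w. of_nat (length w) = g}"
    "t \<in> {grassmann_monomial w |w. of_nat (length w) = h}"
  then obtain u v where uv: "s = grassmann_monomial u" "t = grassmann_monomial v"
    "g = of_nat (length u)" "h = of_nat (length v)" by blast
  have "grassmann_commutation g h = (-1 :: 'k) ^ (length u * length v)"
    by (simp add: grassmann_commutation_def uv of_nat_bit_eq_iff minus_one_power_iff)
  then show "s \<otimes>\<^bsub>grassmann\<^esub> t = grassmann_commutation g h \<odot>\<^bsub>grassmann\<^esub> (t \<otimes>\<^bsub>grassmann\<^esub> s)"
    using grassmann_monomial_commute[of u v] by (simp add: uv grassmann_monomial_mult)
qed

interpretation gr: unit_graded "grassmann :: ('k::field, _) graded_algebra"
proof (intro unit_graded.intro unit_graded_axioms.intro gr.unital_algebra_axioms)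
  show "submodule (homog grassmann g) ring_of_type_algebra (grassmann :: ('k, _) graded_algebra)" for g
    unfolding homog_grassmann by (rule gr.lin_span_submodule[OF grassmann_monomials_subset])
  have "grassmann_monomial [] \<in> lin_span grassmann {grassmann_monomial w :: (_ \<Rightarrow>\<^sub>0 'k) set |w. of_nat (length w) = (0::bit)}"
    by (rule subsetD[OF gr.lin_span_superset]) (auto intro!: exI[of _ "[]"])
  then show "\<one>\<^bsub>grassmann\<^esub> \<in> homog (grassmann :: ('k, _) graded_algebra) 0"
    unfolding homog_grassmann grassmann_one .
qed

lemma grassmann_monomial_homog: "grassmann_monomial w \<in> homog grassmann (of_nat (length w))"
  unfolding homog_grassmann by (rule subsetD[OF gr.lin_span_superset]) blast

lemma grassmann_homog_mult:
  fixes a b :: "(nat list \<Rightarrow>\<^sub>0 'k::field) set"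
  assumes "a \<in> homog grassmann g" "b \<in> homog grassmann h"
  shows "a \<otimes>\<^bsub>grassmann\<^esub> b \<in> homog grassmann (g + h)"
proof (rule gr.span_mult_closed[OF assms[unfolded homog_grassmann] grassmann_monomials_subset
      grassmann_monomials_subset gr.homog_sub])
  fix s t :: "(nat list \<Rightarrow>\<^sub>0 'k) set"
  assume "s \<in> {grassmann_monomial w |w. of_nat (length w) = g}"
    "t \<in> {grassmann_monomial w |w. of_nat (length w) = h}"
  then obtain u v where "s = grassmann_monomial u" "t = grassmann_monomial v"
    "g = of_nat (length u)" "h = of_nat (length v)" by blast
  then show "s \<otimes>\<^bsub>grassmann\<^esub> t \<in> homog grassmann (g + h)"
    using grassmann_monomial_homog[of "u @ v"] by (simp add: grassmann_monomial_mult)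
qed

text \<open>Distinct generators in the odd places give nonzero products of every degree pattern.\<close>

definition pattern_words :: "bit list \<Rightarrow> nat list list"
  where "pattern_words gs = map (\<lambda>i. if gs ! i = 1 then [i] else []) [0..<length gs]"

lemma list_product_monomials:
  "list_product grassmann (map grassmann_monomial ws) = grassmann_monomial (concat ws)"
  by (induction ws) (simp_all add: grassmann_one grassmann_monomial_mult)

lemma distinct_concat_pattern_words: "distinct (concat (pattern_words gs))"
proof -
  have "concat (map (\<lambda>i. if gs ! i = 1 then [i] else []) xs) = filter (\<lambda>i. gs ! i = 1) xs" for xs
    by (induction xs) auto
  then show ?thesis by (simp add: pattern_words_def)
qed

lemma pattern_words_homog:
  "list_all2 (\<lambda>a g. a \<in> homog grassmann g)
    (map grassmann_monomial (pattern_words gs) :: (_ \<Rightarrow>\<^sub>0 'k::field) set list) gs"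
proof -
  have "(grassmann_monomial [i] :: (_ \<Rightarrow>\<^sub>0 'k) set) \<in> homog grassmann 1"
    "(grassmann_monomial [] :: (_ \<Rightarrow>\<^sub>0 'k) set) \<in> homog grassmann 0" for i
    using grassmann_monomial_homog[of "[i]"] grassmann_monomial_homog[of "[]"] by simp_all
  then show ?thesis by (simp add: pattern_words_def list_all2_conv_all_nth)
qed

lemma regular_grassmann: "regular_wrt grassmann_commutation (grassmann :: ('k::field, _) graded_algebra)"
  unfolding regular_wrt_def
proof (intro conjI allI ballI)
  fix gs
  show "\<exists>as. list_all2 (\<lambda>a g. a \<in> homog (grassmann :: ('k, _) graded_algebra) g) as gs \<and>
      list_product grassmann as \<noteq> \<zero>\<^bsub>grassmann\<^esub>"
    using pattern_words_homog[of gs]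
      grassmann_monomial_nonzero[OF distinct_concat_pattern_words, of gs]
    by (intro exI[of _ "map grassmann_monomial (pattern_words gs)"]) (simp add: list_product_monomials)
next
  fix g h :: bit and a b :: "(nat list \<Rightarrow>\<^sub>0 'k) set"
  assume "a \<in> homog grassmann g" "b \<in> homog grassmann h"
  then show "a \<otimes>\<^bsub>grassmann\<^esub> b = grassmann_commutation g h \<odot>\<^bsub>grassmann\<^esub> (b \<otimes>\<^bsub>grassmann\<^esub> a)"
    by (rule grassmann_homog_commute)
qed (simp add: grassmann_commutation_def)

section \<open>Tensor products of algebras and detection of nonzero pure tensors\<close>

lemma keys_minus_subset:
  "Poly_Mapping.keys (f - g :: 'x \<Rightarrow>\<^sub>0 'k::ab_group_add) \<subseteq> Poly_Mapping.keys f \<union> Poly_Mapping.keys g"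
  by (auto simp: in_keys_iff lookup_minus)

lemma (in unital_algebra) lin_ext_cong:
  assumes "range \<psi>' \<subseteq> carrier A" "\<And>x. x \<in> Poly_Mapping.keys f \<Longrightarrow> \<psi> x = \<psi>' x"
  shows "lin_ext A \<psi> f = lin_ext A \<psi>' f"
  unfolding lin_ext_def by (rule M.add.finprod_cong') (use assms in auto)

lemma (in unital_algebra) lin_ext_diff_eq_zero:
  assumes "range \<psi> \<subseteq> carrier A" "lin_ext A \<psi> f = lin_ext A \<psi> g"
  shows "lin_ext A \<psi> (f - g) = \<zero>"
proof -
  have "lin_ext A \<psi> (f - g) \<oplus> lin_ext A \<psi> g = lin_ext A \<psi> g"
    using lin_ext_add[OF assms(1), of "f - g" g] assms(2) by simp
  then show ?thesis using assms(1) by (simp add: M.add.r_cancel_one)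
qed

lemma monoid_algebra_minus:
  assumes "monoid M" "Poly_Mapping.keys g \<subseteq> carrier M"
  shows "f \<ominus>\<^bsub>monoid_algebra M\<^esub> g = (f - g :: _ \<Rightarrow>\<^sub>0 'k::field)"
proof -
  interpret unital_algebra "monoid_algebra M :: ('k, _) module"
    by (rule unital_algebra_monoid_algebra[OF assms(1)])
  have "\<ominus>\<^bsub>monoid_algebra M\<^esub> g = Poly_Mapping.map ((*) (-1)) g"
    using a_inv_eq_smult[of g] assms(2) by simp
  moreover have "f + Poly_Mapping.map ((*) (-1)) g = f - g"
    by (rule poly_mapping_eqI) (simp add: lookup_add lookup_minus)
  ultimately show ?thesis by (simp add: a_minus_def)
qed

locale tensor = A: unital_algebra A + B: unital_algebra B
  for A :: "('k::field, 'a, 'm) module_scheme" and B :: "('k, 'b, 'n) module_scheme"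
begin

abbreviation "MA \<equiv> monoid_algebra (A \<times>\<times> B) :: ('k, 'a \<times> 'b \<Rightarrow>\<^sub>0 'k) module"
abbreviation "TI \<equiv> tensor_ideal A B"
abbreviation "TA \<equiv> tensor_algebra A B"
abbreviation "pure \<equiv> pure_tensor A B"

lemma monoid_prod: "monoid (A \<times>\<times> B)"
  by (rule DirProd_monoid) unfold_locales

lemma unital_algebra_MA: "unital_algebra MA"
  by (rule unital_algebra_monoid_algebra[OF monoid_prod])

lemma tensor_relations_subset: "tensor_relations A B \<subseteq> carrier MA"
proof -
  have 2: "f - g \<in> carrier MA" if "f \<in> carrier MA" "g \<in> carrier MA" for f g
    using that keys_minus_subset[of f g] by auto
  have 1: "Poly_Mapping.single (a, b) c \<in> carrier MA" if "a \<in> carrier A" "b \<in> carrier B" for a b c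
    using that by simp
  show ?thesis
    unfolding tensor_relations_def by (auto simp del: monoid_algebra_simps intro!: 1 2)
qed

lemma ideal_TI: "ideal TI MA"
proof -
  interpret unital_algebra MA by (rule unital_algebra_MA)
  show ?thesis unfolding tensor_ideal_def by (rule genideal_ideal[OF tensor_relations_subset])
qed

lemma tensor_relations_TI: "tensor_relations A B \<subseteq> TI"
proof -
  interpret unital_algebra MA by (rule unital_algebra_MA)
  show ?thesis unfolding tensor_ideal_def by (rule genideal_self[OF tensor_relations_subset])
qed

lemma algebra_ideal_TI: "algebra_ideal MA TI"
  by (intro algebra_ideal.intro unital_algebra_MA ideal_TI)

lemmas rcos = algebra_ideal.quotient_mult[OF algebra_ideal_TI, folded tensor_algebra_def]
  algebra_ideal.quotient_add[OF algebra_ideal_TI, folded tensor_algebra_def]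
  algebra_ideal.quotient_smult[OF algebra_ideal_TI, folded tensor_algebra_def]
  algebra_ideal.rcosI[OF algebra_ideal_TI, folded tensor_algebra_def]

lemma unital_algebra_TA: "unital_algebra TA"
  unfolding tensor_algebra_def by (rule algebra_ideal.unital_algebra_quotient[OF algebra_ideal_TI])

lemma rcos_eqI:
  assumes "f - g \<in> TI" "f \<in> carrier MA" "g \<in> carrier MA"
  shows "TI +>\<^bsub>MA\<^esub> f = TI +>\<^bsub>MA\<^esub> g"
  using assms algebra_ideal.rcos_eq_iff[OF algebra_ideal_TI assms(2,3)]
    monoid_algebra_minus[OF monoid_prod, of g f] by simp

lemma pure_closed [simp, intro]:
  "a \<in> carrier A \<Longrightarrow> b \<in> carrier B \<Longrightarrow> pure a b \<in> carrier TA"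
  unfolding pure_tensor_def by (rule rcos) simp

lemma pure_mult:
  assumes "a \<in> carrier A" "b \<in> carrier B" "a' \<in> carrier A" "b' \<in> carrier B"
  shows "pure a b \<otimes>\<^bsub>TA\<^esub> pure a' b' = pure (a \<otimes>\<^bsub>A\<^esub> a') (b \<otimes>\<^bsub>B\<^esub> b')"
  unfolding pure_tensor_def using assms by (subst rcos) (simp_all add: monoid_algebra_mult_single)

lemma one_TA: "\<one>\<^bsub>TA\<^esub> = pure \<one>\<^bsub>A\<^esub> \<one>\<^bsub>B\<^esub>"
  by (simp add: tensor_algebra_def quotient_algebra_simps pure_tensor_def)

lemma zero_TA: "\<zero>\<^bsub>TA\<^esub> = TI"
  by (simp add: tensor_algebra_def quotient_algebra_simps)

lemma smult_pure:
  assumes "a \<in> carrier A" "b \<in> carrier B"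
  shows "c \<odot>\<^bsub>TA\<^esub> pure a b = TI +>\<^bsub>MA\<^esub> Poly_Mapping.single (a, b) c"
  unfolding pure_tensor_def using assms by (subst rcos) (simp_all add: map_times_single)

lemma pure_smult_left:
  assumes "a \<in> carrier A" "b \<in> carrier B"
  shows "pure (c \<odot>\<^bsub>A\<^esub> a) b = c \<odot>\<^bsub>TA\<^esub> pure a b"
  unfolding smult_pure[OF assms] unfolding pure_tensor_def
  by (rule rcos_eqI, rule subsetD[OF tensor_relations_TI])
    (use assms in \<open>auto simp: tensor_relations_def\<close>)

lemma pure_smult_right:
  assumes "a \<in> carrier A" "b \<in> carrier B"
  shows "pure a (c \<odot>\<^bsub>B\<^esub> b) = c \<odot>\<^bsub>TA\<^esub> pure a b"
  unfolding smult_pure[OF assms] unfolding pure_tensor_def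
  by (rule rcos_eqI, rule subsetD[OF tensor_relations_TI])
    (use assms in \<open>auto simp: tensor_relations_def\<close>)

lemma pure_add_left:
  assumes "a \<in> carrier A" "a' \<in> carrier A" "b \<in> carrier B"
  shows "pure (a \<oplus>\<^bsub>A\<^esub> a') b = pure a b \<oplus>\<^bsub>TA\<^esub> pure a' b"
proof -
  let ?s = "\<lambda>x. Poly_Mapping.single x (1::'k)"
  have "?s (a \<oplus>\<^bsub>A\<^esub> a', b) - ?s (a, b) - ?s (a', b) \<in> TI"
    by (rule subsetD[OF tensor_relations_TI]) (use assms in \<open>auto simp: tensor_relations_def\<close>)
  moreover have "?s (a, b) + ?s (a', b) \<in> carrier MA"
    using assms keys_add[of "?s (a, b)" "?s (a', b)"] by auto
  ultimately have "TI +>\<^bsub>MA\<^esub> ?s (a \<oplus>\<^bsub>A\<^esub> a', b) = TI +>\<^bsub>MA\<^esub> (?s (a, b) + ?s (a', b))"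
    using assms by (intro rcos_eqI) (simp_all add: diff_diff_eq)
  then show ?thesis
    unfolding pure_tensor_def using assms by (subst rcos) simp_all
qed

lemma pure_zero_left: "b \<in> carrier B \<Longrightarrow> pure \<zero>\<^bsub>A\<^esub> b = \<zero>\<^bsub>TA\<^esub>"
proof -
  assume b: "b \<in> carrier B"
  interpret unital_algebra TA by (rule unital_algebra_TA)
  show ?thesis using pure_smult_left[OF A.M.zero_closed b, of 0] b by simp
qed

text \<open>A functional \<open>\<mu>\<close> on the second factor induces the map \<open>a \<otimes> b \<mapsto> \<mu>(b) a\<close>.\<close>

definition contract :: "('b \<Rightarrow> 'k) \<Rightarrow> 'a \<times> 'b \<Rightarrow> 'a"
  where "contract \<mu> = (\<lambda>(a, b). if a \<in> carrier A then \<mu> b \<odot>\<^bsub>A\<^esub> a else \<zero>\<^bsub>A\<^esub>)"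

lemma contract_closed: "range (contract \<mu>) \<subseteq> carrier A"
  by (auto simp: contract_def)

lemma contract_apply: "a \<in> carrier A \<Longrightarrow> contract \<mu> (a, b) = \<mu> b \<odot>\<^bsub>A\<^esub> a"
  by (simp add: contract_def)

text \<open>Multiplication by a pair \<open>(x, y)\<close> turns the contraction along
  \<open>\<mu>\<close> into multiplication by \<open>x\<close> after the contraction along
  \<open>\<mu>\<close> composed with multiplication by \<open>y\<close>. Hence the set
  \<open>H\<close> quantifies over all functionals: this makes it an ideal, and bilinearity places
  the tensor relations in it.\<close>

lemma tensor_ideal_contract:
  assumes "f \<in> TI" "linear_functional B \<mu>"
  shows "lin_ext A (contract \<mu>) f = \<zero>\<^bsub>A\<^esub>"
proof -
  interpret M: unital_algebra MA by (rule unital_algebra_MA)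
  define H where "H = {f \<in> carrier MA. \<forall>\<mu>. linear_functional B \<mu> \<longrightarrow> lin_ext A (contract \<mu>) f = \<zero>\<^bsub>A\<^esub>}"
  note lin = A.lin_ext_add[OF contract_closed] A.lin_ext_smult[OF contract_closed]
    A.lin_ext_single[OF contract_closed]
  have H: "f \<in> carrier MA" "linear_functional B \<mu> \<Longrightarrow> lin_ext A (contract \<mu>) f = \<zero>\<^bsub>A\<^esub>"
    if "f \<in> H" for f \<mu>
    using that unfolding H_def by simp_all
  have HI: "f \<in> H" if "f \<in> carrier MA" "\<And>\<mu>. linear_functional B \<mu> \<Longrightarrow> lin_ext A (contract \<mu>) f = \<zero>\<^bsub>A\<^esub>" for f
    using that unfolding H_def by simp
  have "ideal H MA"
  proof (rule monoid_algebra_idealI[OF monoid_prod])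
    show "submodule H (ring_of_type_algebra :: 'k ring) MA"
      unfolding M.submodule_iff
    proof (intro conjI ballI allI)
      show "H \<subseteq> carrier MA" using H(1) by blast
      show "\<zero>\<^bsub>MA\<^esub> \<in> H" by (rule HI) simp_all
      show "f \<oplus>\<^bsub>MA\<^esub> g \<in> H" if "f \<in> H" "g \<in> H" for f g
      proof (rule HI)
        show "f \<oplus>\<^bsub>MA\<^esub> g \<in> carrier MA" by (rule M.M.a_closed[OF H(1)[OF that(1)] H(1)[OF that(2)]])
      qed (simp add: lin H(2)[OF that(1)] H(2)[OF that(2)])
      show "c \<odot>\<^bsub>MA\<^esub> f \<in> H" if "f \<in> H" for c f
      proof (rule HI)
        show "c \<odot>\<^bsub>MA\<^esub> f \<in> carrier MA" by (rule M.smult_carrier[OF H(1)[OF that]])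
      qed (simp add: lin H(2)[OF that])
    qed
    fix z f
    assume "z \<in> carrier (A \<times>\<times> B)" and f: "f \<in> H"
    then obtain x y where z: "z = (x, y)" "x \<in> carrier A" "y \<in> carrier B" by auto
    have keys: "a \<in> carrier A \<and> b \<in> carrier B" if "(a, b) \<in> Poly_Mapping.keys f" for a b
      using that H(1)[OF f] by auto
    show "Poly_Mapping.single z 1 \<otimes>\<^bsub>MA\<^esub> f \<in> H"
    proof (rule HI)
      show "Poly_Mapping.single z 1 \<otimes>\<^bsub>MA\<^esub> f \<in> carrier MA" by (rule M.m_closed[OF _ H(1)[OF f]]) (use z in simp)
      fix \<mu> assume \<mu>: "linear_functional B \<mu>"
      then have \<mu>': "linear_functional B (\<lambda>b. \<mu> (y \<otimes>\<^bsub>B\<^esub> b))"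
        using z by (simp add: linear_functional_def B.r_distr B.smult_mult_right)
      have "lin_ext A (contract \<mu>) (Poly_Mapping.single z 1 \<otimes>\<^bsub>MA\<^esub> f) = lin_ext A (\<lambda>w. contract \<mu> (z \<otimes>\<^bsub>A \<times>\<times> B\<^esub> w)) f"
        by (rule A.lin_ext_mult_single[OF contract_closed])
      also have "\<dots> = lin_ext A (\<lambda>w. x \<otimes>\<^bsub>A\<^esub> contract (\<lambda>b. \<mu> (y \<otimes>\<^bsub>B\<^esub> b)) w) f"
        by (rule A.lin_ext_cong)
          (use z in \<open>auto simp: contract_def A.smult_mult_right dest!: keys\<close>)
      also have "\<dots> = x \<otimes>\<^bsub>A\<^esub> lin_ext A (contract (\<lambda>b. \<mu> (y \<otimes>\<^bsub>B\<^esub> b))) f"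
        by (rule A.lin_ext_additive_hom[OF contract_closed]) (simp_all add: z A.r_distr A.smult_mult_right)
      also have "\<dots> = \<zero>\<^bsub>A\<^esub>" using H(2)[OF f \<mu>'] z by simp
      finally show "lin_ext A (contract \<mu>) (Poly_Mapping.single z 1 \<otimes>\<^bsub>MA\<^esub> f) = \<zero>\<^bsub>A\<^esub>" .
    qed
    show "f \<otimes>\<^bsub>MA\<^esub> Poly_Mapping.single z 1 \<in> H"
    proof (rule HI)
      show "f \<otimes>\<^bsub>MA\<^esub> Poly_Mapping.single z 1 \<in> carrier MA" by (rule M.m_closed[OF H(1)[OF f]]) (use z in simp)
      fix \<mu> assume \<mu>: "linear_functional B \<mu>"
      then have \<mu>': "linear_functional B (\<lambda>b. \<mu> (b \<otimes>\<^bsub>B\<^esub> y))"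
        using z by (simp add: linear_functional_def B.l_distr B.smult_mult_left)
      have "lin_ext A (contract \<mu>) (f \<otimes>\<^bsub>MA\<^esub> Poly_Mapping.single z 1) = lin_ext A (\<lambda>w. contract \<mu> (w \<otimes>\<^bsub>A \<times>\<times> B\<^esub> z)) f"
        by (rule A.lin_ext_mult_single[OF contract_closed])
      also have "\<dots> = lin_ext A (\<lambda>w. contract (\<lambda>b. \<mu> (b \<otimes>\<^bsub>B\<^esub> y)) w \<otimes>\<^bsub>A\<^esub> x) f"
        by (rule A.lin_ext_cong)
          (use z in \<open>auto simp: contract_def A.smult_mult_left dest!: keys\<close>)
      also have "\<dots> = lin_ext A (contract (\<lambda>b. \<mu> (b \<otimes>\<^bsub>B\<^esub> y))) f \<otimes>\<^bsub>A\<^esub> x"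
        by (rule A.lin_ext_additive_hom[OF contract_closed]) (simp_all add: z A.l_distr A.smult_mult_left)
      also have "\<dots> = \<zero>\<^bsub>A\<^esub>" using H(2)[OF f \<mu>'] z by simp
      finally show "lin_ext A (contract \<mu>) (f \<otimes>\<^bsub>MA\<^esub> Poly_Mapping.single z 1) = \<zero>\<^bsub>A\<^esub>" .
    qed
  qed
  moreover have "tensor_relations A B \<subseteq> H"
  proof
    fix r assume r: "r \<in> tensor_relations A B"
    show "r \<in> H"
    proof (rule HI)
      show "r \<in> carrier MA" using r tensor_relations_subset by blast
      fix \<mu> assume \<mu>: "linear_functional B \<mu>"
      from \<mu> have \<mu>_simps: "\<mu> (c \<odot>\<^bsub>B\<^esub> b) = c * \<mu> b" "\<mu> (b \<oplus>\<^bsub>B\<^esub> b') = \<mu> b + \<mu> b'"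
        if "b \<in> carrier B" "b' \<in> carrier B" for b b' c
        using that unfolding linear_functional_def by blast+
      from r show "lin_ext A (contract \<mu>) r = \<zero>\<^bsub>A\<^esub>"
        unfolding tensor_relations_def diff_diff_eq
        by (elim UnE CollectE exE conjE; hypsubst; intro A.lin_ext_diff_eq_zero[OF contract_closed];
            simp add: lin contract_apply A.smult_add_left A.smult_add_right \<mu>_simps mult.commute)
    qed
  qed
  ultimately have "TI \<subseteq> H" unfolding tensor_ideal_def by (rule M.genideal_minimal)
  with assms show ?thesis using H(2) by blast
qed

text \<open>A single functional that sees \<open>b\<close> detects the tensor, which avoids choosing
  bases of the factors.\<close>

lemma pure_eq_zeroD:
  assumes "pure a b = \<zero>\<^bsub>TA\<^esub>" "a \<in> carrier A" "b \<in> carrier B" "linear_functional B \<mu>"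
  shows "\<mu> b = 0 \<or> a = \<zero>\<^bsub>A\<^esub>"
proof -
  have "Poly_Mapping.single (a, b) 1 \<in> pure a b"
    unfolding pure_tensor_def by (rule algebra_ideal.rcos_self[OF algebra_ideal_TI]) (use assms in simp)
  then have "lin_ext A (contract \<mu>) (Poly_Mapping.single (a, b) 1) = \<zero>\<^bsub>A\<^esub>"
    using tensor_ideal_contract[OF _ assms(4)] assms(1) zero_TA by simp
  then have "\<mu> b \<odot>\<^bsub>A\<^esub> a = \<zero>\<^bsub>A\<^esub>"
    using assms(2) unfolding A.lin_ext_single[OF contract_closed] by (simp add: contract_def)
  then show ?thesis using A.smult_eq_zero_iff[OF assms(2)] by blast
qed

lemma list_product_pure:
  assumes "set as \<subseteq> carrier A" "set bs \<subseteq> carrier B" "length as = length bs"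
  shows "list_product TA (map2 pure as bs) = pure (list_product A as) (list_product B bs)"
proof -
  interpret unital_algebra TA by (rule unital_algebra_TA)
  from assms(3,1,2) show ?thesis
    by (induction rule: list_induct2) (simp_all add: one_TA pure_mult)
qed

end

subsection \<open>Independence of monomial functions\<close>

text \<open>A Vandermonde argument in Lagrange form: the weighted sum vanishes for powers, hence for
  all polynomials, in particular for one vanishing at every node except that of
  \<open>x\<close>.\<close>

lemma distinct_powers_independent:
  fixes c m :: "'x \<Rightarrow> 'k::field"
  assumes D: "finite D" "inj_on m D" and z: "\<And>n. (\<Sum>x\<in>D. c x * m x ^ n) = 0" and x: "x \<in> D"
  shows "c x = 0"
proof -
  have poly: "(\<Sum>x\<in>D. c x * poly p (m x)) = 0" for p
  proof -
    have "(\<Sum>x\<in>D. c x * poly p (m x)) = (\<Sum>x\<in>D. \<Sum>n\<le>degree p. coeff p n * (c x * m x ^ n))"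
      by (simp add: poly_altdef sum_distrib_left ac_simps)
    also have "\<dots> = (\<Sum>n\<le>degree p. coeff p n * (\<Sum>x\<in>D. c x * m x ^ n))"
      by (subst sum.swap) (simp add: sum_distrib_left)
    finally show ?thesis by (simp add: z)
  qed
  define p where "p = (\<Prod>y\<in>D - {x}. [:- m y, 1:])"
  have "poly p (m y) = 0" if "y \<in> D - {x}" for y
    using that D(1) by (auto simp: p_def poly_prod)
  then have "(\<Sum>y\<in>D. c y * poly p (m y)) = c x * poly p (m x)"
    using x D(1) by (subst sum.remove[of _ x]) auto
  moreover have "poly p (m x) \<noteq> 0"
    using x D by (auto simp: p_def poly_prod dest: inj_onD)
  ultimately show ?thesis using poly[of p] by simp
qed

text \<open>Evaluating at powers of distinct primes separates all monomials, by unique factorization.\<close>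

lemma monomial_functions_independent:
  fixes c :: "nat multiset \<Rightarrow> 'k::field_char_0"
  assumes D: "finite D" and z: "\<And>t. (\<Sum>M\<in>D. c M * (\<Prod>i\<in>#M. t i)) = 0" and M: "M \<in> D"
  shows "c M = 0"
proof -
  obtain p :: "nat \<Rightarrow> nat" where p: "inj p" "range p \<subseteq> {p. prime p}"
    using infinite_countable_subset[OF primes_infinite] by blast
  define m :: "nat multiset \<Rightarrow> 'k" where "m M = of_nat (\<Prod>i\<in>#M. p i)" for M
  have "inj m"
  proof (rule injI)
    fix M N assume "m M = m N"
    then have "prime_factorization (\<Prod>i\<in>#M. p i) = prime_factorization (\<Prod>i\<in>#N. p i)"
      by (simp only: m_def of_nat_eq_iff)
    moreover have "prime_factorization (\<Prod>i\<in>#M. p i) = image_mset p M" for M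
      by (rule prime_factorization_prod_mset_primes) (use p(2) in auto)
    ultimately show "M = N" using multiset.inj_map[OF p(1)] by (simp add: inj_eq)
  qed
  moreover have "(\<Sum>M\<in>D. c M * m M ^ n) = 0" for n
  proof -
    have "m M ^ n = (\<Prod>i\<in>#M. of_nat (p i) ^ n)" for M
      by (induction M) (simp_all add: m_def power_mult_distrib)
    then show ?thesis using z[of "\<lambda>i. of_nat (p i) ^ n"] by simp
  qed
  ultimately show ?thesis
    using distinct_powers_independent[OF D _ _ M, of m c] by (simp add: inj_on_subset)
qed

subsection \<open>Graded identities of supercommutative algebras\<close>

context unital_algebra
begin

lemma list_product_zero: "\<zero> \<in> set xs \<Longrightarrow> set xs \<subseteq> carrier A \<Longrightarrow> list_product A xs = \<zero>"
  by (induction xs) auto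

lemma commute_list_product:
  assumes "x \<in> carrier A" "set ys \<subseteq> carrier A" "\<And>y. y \<in> set ys \<Longrightarrow> x \<otimes> y = y \<otimes> x"
  shows "x \<otimes> list_product A ys = list_product A ys \<otimes> x"
  using assms(2,3)
proof (induction ys)
  case (Cons y ys)
  have "x \<otimes> (y \<otimes> list_product A ys) = y \<otimes> (x \<otimes> list_product A ys)"
    using Cons.prems assms(1) by (simp add: m_assoc[symmetric])
  with Cons assms(1) show ?case by (simp add: m_assoc)
qed (use assms in simp)

text \<open>The head of \<open>xs\<close> is located in \<open>ys\<close> and moved to the front
  past \<open>us\<close>; commutation is required only among the entries themselves.\<close>

lemma list_product_mset_cong:
  assumes "mset xs = mset ys" "set xs \<subseteq> carrier A"
    and "\<And>x y. x \<in> set xs \<Longrightarrow> y \<in> set xs \<Longrightarrow> x \<otimes> y = y \<otimes> x"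
  shows "list_product A xs = list_product A ys"
  using assms
proof (induction xs arbitrary: ys)
  case (Cons x xs)
  have set: "set ys = insert x (set xs)" using Cons.prems(1) by (metis list.simps(15) mset_eq_setD)
  then obtain us vs where ys: "ys = us @ x # vs" by (metis insertI1 split_list)
  have uv: "set us \<subseteq> insert x (set xs)" "set vs \<subseteq> insert x (set xs)" using set ys by auto
  then have cl: "set us \<subseteq> carrier A" "set vs \<subseteq> carrier A" using Cons.prems(2) by auto
  have "mset xs = mset (us @ vs)" using Cons.prems(1) ys by simp
  then have "list_product A xs = list_product A (us @ vs)"
    using Cons.prems by (intro Cons.IH) auto
  moreover have "x \<otimes> list_product A us = list_product A us \<otimes> x"
    by (rule commute_list_product) (use Cons.prems uv cl in auto)
  ultimately show ?case
    using Cons.prems cl by (simp add: ys list_product_append m_assoc[symmetric])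
qed simp

end

lemma (in unit_graded) valuation_carrier:
  assumes "\<And>g i. \<phi> (g, i) \<in> homog A g"
  shows "\<phi> v \<in> carrier A"
  using homog_closed(1)[OF assms, of "fst v" "snd v"] by simp

locale supercommutative = unit_graded A
  for A :: "('k::field_char_0, 'a) graded_algebra" (structure) +
  assumes supercommute: "\<lbrakk>a \<in> homog A g; b \<in> homog A h\<rbrakk> \<Longrightarrow>
    a \<otimes> b = grassmann_commutation g h \<odot> (b \<otimes> a)"
begin

lemma even_commute: "a \<in> homog A 0 \<Longrightarrow> b \<in> homog A h \<Longrightarrow> a \<otimes> b = b \<otimes> a"
  using supercommute[of a 0 b h] by (simp add: grassmann_commutation_def)

lemma odd_anticommute: "a \<in> homog A 1 \<Longrightarrow> b \<in> homog A 1 \<Longrightarrow> a \<otimes> b = (-1) \<odot> (b \<otimes> a)"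
  using supercommute[of a 1 b 1] by (simp add: grassmann_commutation_def)

text \<open>Anticommuting with itself gives 2 a^2 = 0, and 2 is invertible in characteristic
  0.\<close>

lemma odd_square:
  assumes "a \<in> homog A 1" shows "a \<otimes> a = \<zero>"
proof -
  have "a \<otimes> a = (-1) \<odot> (a \<otimes> a)" using odd_anticommute[OF assms assms] .
  then have "a \<otimes> a \<oplus> a \<otimes> a = \<zero>"
    using assms smult_add_left[of "a \<otimes> a" 1 "-1"] by simp
  moreover have "2 \<odot> (a \<otimes> a) = a \<otimes> a \<oplus> a \<otimes> a"
    using assms smult_add_left[of "a \<otimes> a" 1 1] by simp
  ultimately show ?thesis using smult_eq_zero_iff[of "a \<otimes> a" 2] assms by simp
qed

context
  fixes \<psi> :: "nat \<Rightarrow> 'a"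
  assumes \<psi>: "\<And>i. \<psi> i \<in> homog A 1"
begin

lemma odd_carrier [simp]: "\<psi> i \<in> carrier A"
  by (rule homog_closed(1)[OF \<psi>])

lemma odd_product_closed [simp]: "list_product A (map \<psi> xs) \<in> carrier A"
  by (auto intro!: list_product_closed)

lemma odd_swap: "\<psi> x \<otimes> (\<psi> y \<otimes> list_product A (map \<psi> ys)) = (-1) \<odot> (\<psi> y \<otimes> (\<psi> x \<otimes> list_product A (map \<psi> ys)))"
  using odd_anticommute[OF \<psi> \<psi>, of x y]
  by (simp add: m_assoc[symmetric] smult_mult_left)

text \<open>The left factor is moved through the product, up to sign, until it meets its own copy
  and the square vanishes.\<close>

lemma odd_repeated: "x \<in> set ys \<Longrightarrow> \<psi> x \<otimes> list_product A (map \<psi> ys) = \<zero>"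
proof (induction ys)
  case (Cons y ys)
  show ?case
  proof (cases "x = y")
    case True
    then show ?thesis using odd_square[OF \<psi>] \<psi> by (simp add: m_assoc[symmetric])
  next
    case False
    with Cons \<psi> show ?thesis by (simp add: odd_swap)
  qed
qed simp

text \<open>Insertion moves \<open>x\<close> past exactly the smaller letters, one sign each. The
  exponent is the contribution of a head letter in \<open>inv_count\<close>.\<close>

lemma odd_insort:
  "sorted ys \<Longrightarrow> \<psi> x \<otimes> list_product A (map \<psi> ys) =
    (-1) ^ length (filter (\<lambda>y. y < x) ys) \<odot> list_product A (map \<psi> (insort x ys))"
proof (induction ys)
  case (Cons y ys)
  show ?case
  proof (cases "x \<le> y")
    case True
    then have "filter (\<lambda>z. z < x) (y # ys) = []"
      using Cons.prems by (auto simp: filter_empty_conv)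
    with True \<psi> show ?thesis by (simp del: filter.simps)
  next
    case False
    with Cons \<psi> show ?thesis by (simp add: odd_swap smult_mult_right)
  qed
qed (use \<psi> in simp)

text \<open>Insertion sort: the tail is sorted by induction and the head is inserted. A head already
  in the tail annihilates the product, in agreement with sign 0.\<close>

lemma odd_product_normal:
  "list_product A (map \<psi> xs) = word_sign xs \<odot> list_product A (map \<psi> (sorted_list_of_set (set xs)))"
proof (induction xs)
  case (Cons x xs)
  let ?L = "sorted_list_of_set (set xs)"
  have step: "list_product A (map \<psi> (x # xs)) = word_sign xs \<odot> (\<psi> x \<otimes> list_product A (map \<psi> ?L))"
    using \<psi> by (simp add: Cons.IH smult_mult_right)
  show ?case
  proof (cases "distinct (x # xs)")
    case True
    have "length (filter (\<lambda>y. y < x) ?L) = length (filter (\<lambda>y. y < x) xs)"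
      using True by (simp add: distinct_length_filter)
    moreover have "sorted_list_of_set (set (x # xs)) = insort x ?L"
      using True by (simp add: sorted_list_of_set_insert)
    ultimately show ?thesis
      unfolding step using True by (simp add: odd_insort word_sign_def power_add mult.commute)
  next
    case False
    then have "word_sign (x # xs) = (0 :: 'k)" by (simp add: word_sign_def)
    moreover have "word_sign xs \<odot> (\<psi> x \<otimes> list_product A (map \<psi> ?L)) = \<zero>"
    proof (cases "distinct xs")
      case True
      then show ?thesis using False by (simp add: odd_repeated)
    qed (use \<psi> in \<open>simp add: word_sign_def\<close>)
    ultimately show ?thesis unfolding step by simp
  qed
qed (simp add: word_sign_def)

end

end

definition even_part :: "(bit \<times> nat) list \<Rightarrow> nat list"
  where "even_part w = map snd (filter (\<lambda>v. fst v = 0) w)"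

definition odd_part :: "(bit \<times> nat) list \<Rightarrow> nat list"
  where "odd_part w = map snd (filter (\<lambda>v. fst v = 1) w)"

text \<open>Names the monomial of the free supercommutative algebra to which a word reduces up to
  sign: even variables keep their multiplicity, while an odd variable can survive at most
  once.\<close>

definition word_class :: "(bit \<times> nat) list \<Rightarrow> nat multiset \<times> nat set"
  where "word_class w = (mset (even_part w), set (odd_part w))"

definition class_value :: "('k::field, 'a, 'm) graded_algebra_scheme \<Rightarrow> (bit \<times> nat \<Rightarrow> 'a) \<Rightarrow> nat multiset \<times> nat set \<Rightarrow> 'a"
  where "class_value A \<phi> = (\<lambda>(M, S).
    list_product A (map (\<lambda>i. \<phi> (0, i)) (sorted_list_of_multiset M)) \<otimes>\<^bsub>A\<^esub>
    list_product A (map (\<lambda>i. \<phi> (1, i)) (sorted_list_of_set S)))"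

text \<open>The reduction of a polynomial modulo supercommutativity: even variables are gathered to the
  left and the odd ones are sorted.\<close>

definition normal_form :: "((bit \<times> nat) list \<Rightarrow>\<^sub>0 'k::field) \<Rightarrow> (nat multiset \<times> nat set \<Rightarrow>\<^sub>0 'k)"
  where "normal_form f = (\<Sum>w\<in>Poly_Mapping.keys f.
    Poly_Mapping.single (word_class w) (Poly_Mapping.lookup f w * word_sign (odd_part w)))"

text \<open>The index type also contains infinite sets, for which \<open>sorted_list_of_set\<close>
  carries no information. Only classes of actual words can have a nonzero coefficient.\<close>

lemma finite_odd_normal_form:
  assumes "(M, S) \<in> Poly_Mapping.keys (normal_form f)" shows "finite S"
proof -
  have "Poly_Mapping.lookup (normal_form f) (M, S) = 0" if "(M, S) \<notin> range word_class"
  proof -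
    have "word_class w \<noteq> (M, S)" for w using that by (metis rangeI)
    then show ?thesis unfolding normal_form_def lookup_sum by (simp add: lookup_single_not_eq)
  qed
  with assms show ?thesis by (auto simp: in_keys_iff word_class_def)
qed

context supercommutative
begin

lemma class_value_closed:
  assumes "\<And>g i. \<phi> (g, i) \<in> homog A g"
  shows "range (class_value A \<phi>) \<subseteq> carrier A"
  unfolding class_value_def using valuation_carrier[of \<phi>, OF assms]
  by (auto intro!: m_closed list_product_closed)

text \<open>An odd letter commutes with every even one, so even letters can be collected on the left
  without any sign.\<close>

lemma list_product_split:
  assumes \<phi>: "\<And>g i. \<phi> (g, i) \<in> homog A g"
  shows "list_product A (map \<phi> w) =
    list_product A (map (\<lambda>i. \<phi> (0, i)) (even_part w)) \<otimes> list_product A (map (\<lambda>i. \<phi> (1, i)) (odd_part w))"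
proof (induction w)
  case (Cons v w)
  obtain g i where v: "v = (g, i)" by (cases v)
  let ?E = "list_product A (map (\<lambda>i. \<phi> (0, i)) (even_part w))"
  let ?O = "list_product A (map (\<lambda>i. \<phi> (1, i)) (odd_part w))"
  have cl: "?E \<in> carrier A" "?O \<in> carrier A" "\<phi> v \<in> carrier A"
    using valuation_carrier[of \<phi>, OF \<phi>] by (auto intro!: list_product_closed)
  show ?case
  proof (cases "g = 0")
    case True
    with Cons cl show ?thesis by (simp add: v even_part_def odd_part_def m_assoc)
  next
    case False
    then have g: "g = 1" by (cases g) auto
    have "\<phi> v \<otimes> ?E = ?E \<otimes> \<phi> v"
    proof (rule commute_list_product)
      fix y assume "y \<in> set (map (\<lambda>i. \<phi> (0, i)) (even_part w))"
      then show "\<phi> v \<otimes> y = y \<otimes> \<phi> v" using even_commute[of y "\<phi> v" g] \<phi> v by auto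
    qed (use cl valuation_carrier[of \<phi>, OF \<phi>] in auto)
    then have "\<phi> v \<otimes> (?E \<otimes> ?O) = ?E \<otimes> (\<phi> v \<otimes> ?O)" using cl by (simp add: m_assoc[symmetric])
    with Cons g show ?thesis by (simp add: v even_part_def odd_part_def)
  qed
qed (simp add: even_part_def odd_part_def)

lemma list_product_class:
  assumes \<phi>: "\<And>g i. \<phi> (g, i) \<in> homog A g"
  shows "list_product A (map \<phi> w) = word_sign (odd_part w) \<odot> class_value A \<phi> (word_class w)"
proof -
  let ?e = "\<lambda>i. \<phi> (0, i)" and ?o = "\<lambda>i. \<phi> (1, i)"
  have "list_product A (map ?e (even_part w)) =
      list_product A (map ?e (sorted_list_of_multiset (mset (even_part w))))"
  proof (rule list_product_mset_cong)
    fix x y assume "x \<in> set (map ?e (even_part w))" "y \<in> set (map ?e (even_part w))"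
    then show "x \<otimes> y = y \<otimes> x" using even_commute[of x y 0] \<phi> by auto
  qed (use valuation_carrier[of \<phi>, OF \<phi>] in auto)
  moreover have "list_product A (map ?o (odd_part w)) =
      word_sign (odd_part w) \<odot> list_product A (map ?o (sorted_list_of_set (set (odd_part w))))"
    by (rule odd_product_normal) (rule \<phi>)
  moreover have "list_product A (map (\<lambda>i. \<phi> (g, i)) xs) \<in> carrier A" for g xs
    using valuation_carrier[of \<phi>, OF \<phi>] by (auto intro!: list_product_closed)
  ultimately show ?thesis
    unfolding list_product_split[OF \<phi>] word_class_def class_value_def
    by (simp add: smult_mult_right)
qed

lemma eval_poly_normal_form:
  assumes \<phi>: "\<And>g i. \<phi> (g, i) \<in> homog A g"
  shows "eval_poly A \<phi> f = lin_ext A (class_value A \<phi>) (normal_form f)"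
proof -
  note cv = class_value_closed[of \<phi>, OF \<phi>]
  have cl: "class_value A \<phi> \<kappa> \<in> carrier A" for \<kappa> using cv by blast
  show ?thesis
    unfolding eval_poly_eq_lin_ext normal_form_def lin_ext_sum[OF cv finite_keys] lin_ext_single[OF cv]
    by (simp add: lin_ext_def list_product_class[of \<phi>, OF \<phi>] cl)
qed

lemma class_value_scalars:
  assumes e: "\<And>i. \<phi> (0, i) = t i \<odot> \<one>" and o: "\<And>i. \<phi> (1, i) \<in> homog A 1"
  shows "class_value A \<phi> (M, S) =
    (\<Prod>i\<in>#M. t i) \<odot> list_product A (map (\<lambda>i. \<phi> (1, i)) (sorted_list_of_set S))"
proof -
  have "list_product A (map (\<lambda>i. \<phi> (0, i)) xs) = (\<Prod>i\<in>#mset xs. t i) \<odot> \<one>" for xs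
    by (induction xs) (simp_all add: e smult_mult_left)
  from this[of "sorted_list_of_multiset M"] show ?thesis
    unfolding class_value_def using odd_product_closed[OF o] by (simp add: smult_mult_left)
qed

text \<open>A suitable substitution isolates the part of the normal form with one fixed odd set and
  turns it into a commutative polynomial vanishing at all scalars.\<close>

lemma normal_form_eq_zero:
  assumes reg: "\<And>n. \<exists>as. list_all2 (\<lambda>a g. a \<in> homog A g) as (replicate n 1) \<and> list_product A as \<noteq> \<zero>"
    and f: "f \<in> graded_identities A"
  shows "normal_form f = 0"
proof (rule ccontr)
  let ?K = "Poly_Mapping.keys (normal_form f)"
  let ?c = "Poly_Mapping.lookup (normal_form f)"
  assume "normal_form f \<noteq> 0"
  then have "?K \<noteq> {}" by (metis all_not_in_conv in_keys_iff poly_mapping_eqI lookup_zero)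
  \<comment> \<open>Setting odd variables outside \<open>S0\<close> to zero kills each class whose
    odd set is not contained in \<open>S0\<close>. By minimality the only other possibility is the
    set \<open>S0\<close> itself, so a single odd set survives.\<close>
  then obtain S0 where S0: "S0 \<in> snd ` ?K" "\<And>S. S \<in> snd ` ?K \<Longrightarrow> S \<subseteq> S0 \<Longrightarrow> S = S0"
    using finite_has_minimal[of "snd ` ?K"] by auto
  then have fin: "finite S0" using finite_odd_normal_form by force
  obtain as where as: "list_all2 (\<lambda>a g. a \<in> homog A g) as (replicate (card S0) 1)"
    and nz: "list_product A as \<noteq> \<zero>" using reg by blast
  have as1: "length as = card S0" "set as \<subseteq> homog A 1"
    using as by (auto simp: list_all2_conv_all_nth set_conv_nth)
  let ?l = "sorted_list_of_set S0"
  have l: "length ?l = length as" "distinct ?l" "set ?l = S0" using fin as1 by simp_all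
  \<comment> \<open>The sorted elements of \<open>S0\<close> receive the factors of the nonvanishing
    product in order; the default for all other odd variables is zero.\<close>
  define \<psi> where "\<psi> i = (case map_of (zip ?l as) i of Some a \<Rightarrow> a | None \<Rightarrow> \<zero>)" for i
  have \<psi>: "\<psi> i \<in> homog A 1" for i
    using as1(2) by (auto simp: \<psi>_def split: option.split dest!: map_of_SomeD set_zip_rightD)
  have \<psi>_l: "map \<psi> ?l = as"
  proof (rule nth_equalityI)
    show "map \<psi> ?l ! i = as ! i" if "i < length (map \<psi> ?l)" for i
      using map_of_zip_nth[OF l(1,2), of i] that l(1) by (simp add: \<psi>_def)
  qed (simp add: as1)
  have \<psi>_0: "\<psi> i = \<zero>" if "i \<notin> S0" for i
  proof -
    have "map_of (zip ?l as) i = None" using that l by simp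
    then show ?thesis by (simp add: \<psi>_def)
  qed
  have sum0: "(\<Sum>\<kappa>\<in>?K. if snd \<kappa> = S0 then ?c \<kappa> * (\<Prod>i\<in>#fst \<kappa>. t i) else 0) = 0" for t
  proof -
    define \<phi> where "\<phi> = (\<lambda>(g :: bit, i). if g = 0 then t i \<odot> \<one> else \<psi> i)"
    have \<phi>: "\<phi> (g, i) \<in> homog A g" for g i
      using \<psi> one_homog by (cases g) (auto simp: \<phi>_def)
    have "?c \<kappa> \<odot> class_value A \<phi> \<kappa> =
        (if snd \<kappa> = S0 then ?c \<kappa> * (\<Prod>i\<in>#fst \<kappa>. t i) else 0) \<odot> list_product A as"
      if \<kappa>: "\<kappa> \<in> ?K" for \<kappa>
    proof -
      obtain M S where MS: "\<kappa> = (M, S)" by (cases \<kappa>)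
      have asc: "list_product A as \<in> carrier A" using as1(2) homog_carrier[of 1] by (intro list_product_closed) simp
      have cv: "class_value A \<phi> (M, S) = (\<Prod>i\<in>#M. t i) \<odot> list_product A (map \<psi> (sorted_list_of_set S))"
        using class_value_scalars[of \<phi> t M S] \<psi> by (simp add: \<phi>_def)
      show ?thesis
      proof (cases "S = S0")
        case True
        then show ?thesis using cv \<psi>_l asc by (simp add: MS)
      next
        case False
        have "S \<in> snd ` ?K" using \<kappa> MS by force
        with False S0(2) obtain i where i: "i \<in> S" "i \<notin> S0" by blast
        moreover have "finite S" using \<kappa> MS finite_odd_normal_form by simp
        ultimately have "\<zero> \<in> set (map \<psi> (sorted_list_of_set S))" using \<psi>_0[of i] by force
        then have "list_product A (map \<psi> (sorted_list_of_set S)) = \<zero>"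
          using \<psi> by (intro list_product_zero) auto
        then show ?thesis using False asc cv by (simp add: MS)
      qed
    qed
    note terms = this
    have asc: "list_product A as \<in> carrier A" using as1(2) homog_carrier[of 1] by (intro list_product_closed) simp
    have "\<zero> = eval_poly A \<phi> f" using f \<phi> by (simp add: graded_identities_def)
    also have "\<dots> = lin_ext A (class_value A \<phi>) (normal_form f)"
      by (rule eval_poly_normal_form) (rule \<phi>)
    also have "\<dots> = (\<Oplus>\<kappa>\<in>?K. (if snd \<kappa> = S0 then ?c \<kappa> * (\<Prod>i\<in>#fst \<kappa>. t i) else 0) \<odot> list_product A as)"
      unfolding lin_ext_def by (rule M.add.finprod_cong') (use terms asc in auto)
    also have "\<dots> = (\<Sum>\<kappa>\<in>?K. if snd \<kappa> = S0 then ?c \<kappa> * (\<Prod>i\<in>#fst \<kappa>. t i) else 0) \<odot> list_product A as"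
      by (rule finsum_smult_left) (simp_all add: asc)
    finally have "(\<Sum>\<kappa>\<in>?K. if snd \<kappa> = S0 then ?c \<kappa> * (\<Prod>i\<in>#fst \<kappa>. t i) else 0) \<odot> list_product A as = \<zero>"
      by (rule sym)
    then show ?thesis unfolding smult_eq_zero_iff[OF asc] using nz by blast
  qed
  \<comment> \<open>The even monomials that accompany \<open>S0\<close>. Their combination vanishes
    for all scalar values \<open>t\<close>, so all their coefficients vanish, against the choice of
    \<open>S0\<close>.\<close>
  let ?D = "{M. (M, S0) \<in> ?K}"
  have img: "{\<kappa> \<in> ?K. snd \<kappa> = S0} = (\<lambda>M. (M, S0)) ` ?D" by force
  have "finite ((\<lambda>M. (M, S0)) ` ?D)" unfolding img[symmetric] by simp
  then have finD: "finite ?D" by (rule finite_imageD) (auto simp: inj_on_def)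
  have "(\<Sum>M\<in>?D. ?c (M, S0) * (\<Prod>i\<in>#M. t i)) = 0" for t
  proof -
    have "(\<Sum>M\<in>?D. ?c (M, S0) * (\<Prod>i\<in>#M. t i)) =
        (\<Sum>\<kappa>\<in>{\<kappa> \<in> ?K. snd \<kappa> = S0}. ?c \<kappa> * (\<Prod>i\<in>#fst \<kappa>. t i))"
      unfolding img by (subst sum.reindex) (auto simp: inj_on_def)
    also have "\<dots> = 0" using sum0[of t] by (simp add: sum.inter_filter)
    finally show ?thesis .
  qed
  note indep = monomial_functions_independent[OF finD this]
  obtain M0 where "(M0, S0) \<in> ?K" using S0(1) by force
  with indep[of M0] show False by (simp add: in_keys_iff)
qed

text \<open>The right-hand side does not involve the algebra, so any two algebras of this kind over
  the same field have equal identities.\<close>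

lemma graded_identities_normal_form:
  assumes "\<And>n. \<exists>as. list_all2 (\<lambda>a g. a \<in> homog A g) as (replicate n 1) \<and> list_product A as \<noteq> \<zero>"
  shows "graded_identities A = {f. normal_form f = 0}"
proof
  show "graded_identities A \<subseteq> {f. normal_form f = 0}"
    using normal_form_eq_zero[OF assms] by (intro subsetI CollectI)
  show "{f. normal_form f = 0} \<subseteq> graded_identities A"
  proof
    fix f :: "_ \<Rightarrow>\<^sub>0 'k" assume "f \<in> {f. normal_form f = 0}"
    then have "eval_poly A \<phi> f = \<zero>" if "\<And>g i. \<phi> (g, i) \<in> homog A g" for \<phi>
      using eval_poly_normal_form[of \<phi> f, OF that] by simp
    then show "f \<in> graded_identities A" by (simp add: graded_identities_def)
  qed
qed

end

section \<open>Regularity read off from graded identities\<close>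

lemma graded_identities_regular:
  fixes A :: "('k::field_char_0, 'a) graded_algebra"
  assumes "unit_graded A" "regular_wrt grassmann_commutation A"
  shows "graded_identities A = {f. normal_form f = 0}"
proof (rule supercommutative.graded_identities_normal_form)
  show "supercommutative A"
    by (intro supercommutative.intro supercommutative_axioms.intro assms(1))
      (use assms(2) in \<open>unfold regular_wrt_def, blast\<close>)
qed (use assms(2) in \<open>unfold regular_wrt_def, blast\<close>)

text \<open>Both clauses of regularity concern particular multilinear polynomials: a degree pattern
  has a nonvanishing product exactly when a word in distinct variables of these degrees is not an
  identity, and the commutation rule says that a combination of two words of length 2 is
  one.\<close>

lemma regular_wrt_of_identities:
  fixes A :: "('k::field, 'a) graded_algebra" and B :: "('k, 'b) graded_algebra"
  assumes A: "unit_graded A" and B: "unit_graded B"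
    and eq: "graded_identities A = graded_identities B" and reg: "regular_wrt \<beta> A"
  shows "regular_wrt \<beta> B"
proof -
  interpret A: unit_graded A by fact
  interpret B: unit_graded B by fact
  have rA: "range (\<lambda>w. list_product A (map \<phi> w)) \<subseteq> carrier A" if "\<And>g i. \<phi> (g, i) \<in> homog A g" for \<phi> :: "bit \<times> nat \<Rightarrow> 'a"
    using A.valuation_carrier[of \<phi>, OF that] by (auto intro!: A.list_product_closed)
  have rB: "range (\<lambda>w. list_product B (map \<phi> w)) \<subseteq> carrier B" if "\<And>g i. \<phi> (g, i) \<in> homog B g" for \<phi> :: "bit \<times> nat \<Rightarrow> 'b"
    using B.valuation_carrier[of \<phi>, OF that] by (auto intro!: B.list_product_closed)
  show ?thesis
    unfolding regular_wrt_def
  proof (intro conjI allI ballI)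
    fix gs :: "bit list"
    obtain as where as: "list_all2 (\<lambda>a g. a \<in> homog A g) as gs" "list_product A as \<noteq> \<zero>\<^bsub>A\<^esub>"
      using reg unfolding regular_wrt_def by blast
    \<comment> \<open>Using the position as index makes the letters pairwise distinct variables, so
      the factors can be assigned independently even when degrees repeat.\<close>
    define w where "w = zip gs [0..<length gs]"
    have as': "length as = length gs" "\<And>i. i < length gs \<Longrightarrow> as ! i \<in> homog A (gs ! i)"
      using as(1) by (auto simp: list_all2_conv_all_nth)
    define \<phi> where "\<phi> = (\<lambda>(g, i). if i < length gs \<and> g = gs ! i then as ! i else \<zero>\<^bsub>A\<^esub>)"
    have \<phi>: "\<phi> (g, i) \<in> homog A g" for g i using as' by (auto simp: \<phi>_def)
    have "map \<phi> w = as" by (rule nth_equalityI) (simp_all add: w_def as' \<phi>_def)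
    moreover have "list_product A (map \<phi> w) \<in> carrier A" using rA[of \<phi>, OF \<phi>] by blast
    ultimately have "eval_poly A \<phi> (word w) \<noteq> \<zero>\<^bsub>A\<^esub>"
      unfolding eval_poly_eq_lin_ext A.lin_ext_single[OF rA[of \<phi>, OF \<phi>]] using as(2) by simp
    then have "word w \<notin> graded_identities A" using \<phi> by (auto simp: graded_identities_def)
    then obtain \<phi>' where \<phi>': "\<And>g i. \<phi>' (g, i) \<in> homog B g" "eval_poly B \<phi>' (word w) \<noteq> \<zero>\<^bsub>B\<^esub>"
      unfolding eq by (auto simp: graded_identities_def)
    have "list_product B (map \<phi>' w) \<noteq> \<zero>\<^bsub>B\<^esub>"
    proof -
      have "list_product B (map \<phi>' w) \<in> carrier B" using rB[of \<phi>', OF \<phi>'(1)] by blast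
      then show ?thesis
        using \<phi>'(2) unfolding eval_poly_eq_lin_ext B.lin_ext_single[OF rB[of \<phi>', OF \<phi>'(1)]] by simp
    qed
    moreover have "list_all2 (\<lambda>a g. a \<in> homog B g) (map \<phi>' w) gs"
      using \<phi>'(1) by (simp add: w_def list_all2_conv_all_nth)
    ultimately show "\<exists>as. list_all2 (\<lambda>a g. a \<in> homog B g) as gs \<and> list_product B as \<noteq> \<zero>\<^bsub>B\<^esub>" by blast
  next
    fix g h
    show "\<beta> g h \<noteq> 0" using reg by (simp add: regular_wrt_def)
    fix a b assume ab: "a \<in> homog B g" "b \<in> homog B h"
    \<comment> \<open>The different indices keep the two variables apart also when
      \<open>g = h\<close>.\<close>
    let ?u = "[(g, 0), (h, 1)] :: (bit \<times> nat) list" and ?v = "[(h, 1), (g, 0)] :: (bit \<times> nat) list"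
    let ?f = "Poly_Mapping.single ?u 1 - Poly_Mapping.single ?v (\<beta> g h) :: _ \<Rightarrow>\<^sub>0 'k"
    have "?f \<in> graded_identities A"
    proof -
      have "eval_poly A \<phi> ?f = \<zero>\<^bsub>A\<^esub>" if \<phi>: "\<And>g i. \<phi> (g, i) \<in> homog A g" for \<phi>
        unfolding eval_poly_eq_lin_ext
      proof (rule A.lin_ext_diff_eq_zero[OF rA[of \<phi>, OF \<phi>]])
        have "\<phi> (g, 0) \<otimes>\<^bsub>A\<^esub> \<phi> (h, 1) = \<beta> g h \<odot>\<^bsub>A\<^esub> (\<phi> (h, 1) \<otimes>\<^bsub>A\<^esub> \<phi> (g, 0))"
          using reg \<phi> unfolding regular_wrt_def by blast
        then show "lin_ext A (\<lambda>w. list_product A (map \<phi> w)) (Poly_Mapping.single ?u 1) =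
            lin_ext A (\<lambda>w. list_product A (map \<phi> w)) (Poly_Mapping.single ?v (\<beta> g h))"
          unfolding A.lin_ext_single[OF rA[of \<phi>, OF \<phi>]] using A.homog_closed(1)[OF \<phi>] by simp
      qed
      then show ?thesis by (simp add: graded_identities_def)
    qed
    then have f: "?f \<in> graded_identities B" unfolding eq .
    define \<phi> where "\<phi> = (\<lambda>v. if v = (g, 0::nat) then a else if v = (h, 1) then b else \<zero>\<^bsub>B\<^esub>)"
    have \<phi>: "\<phi> (g, i) \<in> homog B g" for g i using ab by (auto simp: \<phi>_def)
    note r = rB[of \<phi>, OF \<phi>]
    have "lin_ext B (\<lambda>w. list_product B (map \<phi> w)) ?f = \<zero>\<^bsub>B\<^esub>"
      using f \<phi> by (simp add: graded_identities_def eval_poly_eq_lin_ext)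
    then have "lin_ext B (\<lambda>w. list_product B (map \<phi> w)) (?f + Poly_Mapping.single ?v (\<beta> g h)) =
        lin_ext B (\<lambda>w. list_product B (map \<phi> w)) (Poly_Mapping.single ?v (\<beta> g h))"
      using B.lin_ext_closed[OF r] by (simp only: B.lin_ext_add[OF r] B.M.l_zero)
    then show "a \<otimes>\<^bsub>B\<^esub> b = \<beta> g h \<odot>\<^bsub>B\<^esub> (b \<otimes>\<^bsub>B\<^esub> a)"
      using B.homog_closed(1)[OF ab(1)] B.homog_closed(1)[OF ab(2)]
      by (simp add: B.lin_ext_single[OF r]) (simp add: \<phi>_def)
  qed
qed

section \<open>Homogeneous components and the degree of the identity\<close>

context unital_algebra
begin

lemma add_neg_smult: "x \<in> carrier A \<Longrightarrow> x \<oplus> (-1) \<odot> x = \<zero>"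
  by (simp add: a_inv_eq_smult[symmetric] M.r_neg)

lemma add_neg_smult_eq_zeroD:
  assumes "x \<oplus> (-1) \<odot> y = \<zero>" "x \<in> carrier A" "y \<in> carrier A" shows "x = y"
  using M.minus_equality[of x "\<ominus> y"] assms by (simp add: a_inv_eq_smult[symmetric])

end

context z2_graded_algebra
begin

lemma homog_decompose:
  assumes "x \<in> carrier A"
  obtains a b where "a \<in> homog A 0" "b \<in> homog A 1" "x = a \<oplus> b"
  using assms homog_sum unfolding set_add_def' by blast

lemma homog_in_carrier: "x \<in> homog A g \<Longrightarrow> x \<in> carrier A"
  using submoduleE(1)[OF homog_submodule] by blast

lemma homog_ops:
  "\<zero> \<in> homog A g" "x \<in> homog A g \<Longrightarrow> y \<in> homog A g \<Longrightarrow> x \<oplus> y \<in> homog A g"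
  "x \<in> homog A g \<Longrightarrow> c \<odot> x \<in> homog A g"
  using homog_submodule[of g] by (simp_all add: submodule_iff)

lemma homog_disjoint: "x \<in> homog A g \<Longrightarrow> x \<in> homog A (g + 1) \<Longrightarrow> x = \<zero>"
  using homog_direct by (cases g) auto

text \<open>Write 1 = a + b. For homogeneous x of degree g, the element x b = x - x a has degree g +
  1 and also degree g, so it is zero. Hence b = 1 b = a b + b b = 0.\<close>

lemma one_homog_zero: "\<one> \<in> homog A 0"
proof -
  obtain a b where ab: "a \<in> homog A 0" "b \<in> homog A 1" "\<one> = a \<oplus> b"
    using homog_decompose[OF one_closed] by blast
  have c: "a \<in> carrier A" "b \<in> carrier A" using ab homog_in_carrier by blast+
  have b: "x \<otimes> b = \<zero>" if x: "x \<in> homog A g" for x g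
  proof (rule homog_disjoint[of _ g])
    have xc: "x \<in> carrier A" using x by (rule homog_in_carrier)
    show "x \<otimes> b \<in> homog A (g + 1)" by (rule homog_mult[OF x ab(2)])
    have xa: "x \<otimes> a \<in> homog A g" using homog_mult[OF x ab(1)] by (simp only: add_0_right)
    have "x \<oplus> (-1) \<odot> (x \<otimes> a) = x \<otimes> (a \<oplus> b) \<oplus> (-1) \<odot> (x \<otimes> a)"
      using xc ab(3) by (metis r_one)
    also have "\<dots> = x \<otimes> b \<oplus> (x \<otimes> a \<oplus> (-1) \<odot> (x \<otimes> a))"
      using xc c by (simp add: r_distr M.a_ac)
    finally have "x \<otimes> b = x \<oplus> (-1) \<odot> (x \<otimes> a)" using xc c by (simp add: add_neg_smult)
    then show "x \<otimes> b \<in> homog A g" using x xa by (simp add: homog_ops)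
  qed
  have "b = \<one> \<otimes> b" using c by simp
  also have "\<dots> = a \<otimes> b \<oplus> b \<otimes> b" unfolding ab(3) using c by (simp add: l_distr)
  also have "\<dots> = \<zero>" using b[OF ab(1)] b[OF ab(2)] by simp
  finally show ?thesis using ab c by simp
qed

lemma unit_graded: "unit_graded A"
  by (intro unit_graded.intro unit_graded_axioms.intro unital_algebra_axioms homog_submodule one_homog_zero)

lemma cringI_homog:
  assumes "\<And>g h x y. x \<in> homog A g \<Longrightarrow> y \<in> homog A h \<Longrightarrow> x \<otimes> y = y \<otimes> x"
  shows "cring A"
proof -
  have hom: "x \<otimes> y = y \<otimes> x" if x: "x \<in> homog A g" and y: "y \<in> carrier A" for x y g
  proof -
    obtain a b where ab: "a \<in> homog A 0" "b \<in> homog A 1" "y = a \<oplus> b"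
      using homog_decompose[OF y] .
    with x show ?thesis
      using assms[OF x ab(1)] assms[OF x ab(2)] by (simp add: l_distr r_distr homog_in_carrier)
  qed
  have "x \<otimes> y = y \<otimes> x" if x: "x \<in> carrier A" and y: "y \<in> carrier A" for x y
  proof -
    obtain a b where ab: "a \<in> homog A 0" "b \<in> homog A 1" "x = a \<oplus> b"
      using homog_decompose[OF x] .
    with y show ?thesis
      using hom[OF ab(1) y] hom[OF ab(2) y] by (simp add: l_distr r_distr homog_in_carrier)
  qed
  then have "comm_monoid A" by (intro monoid_comm_monoidI)
  then show ?thesis by (intro cring.intro ring_axioms)
qed

end

subsection \<open>The Grassmann envelope\<close>

context
  fixes P :: "('k::field, 'p) graded_algebra"
  assumes P: "z2_graded_algebra P"
begin

interpretation P: z2_graded_algebra P by (rule P)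

interpretation t: tensor P "grassmann :: ('k, _) graded_algebra"
  by (intro tensor.intro P.unital_algebra_axioms gr.unital_algebra_axioms)

interpretation T: unital_algebra t.TA by (rule t.unital_algebra_TA)

definition "pure_tensors g = {t.pure p e |p e. p \<in> homog P g \<and> e \<in> homog grassmann g}"

abbreviation "env_homog g \<equiv> lin_span t.TA (pure_tensors g)"

lemma envelope_simps:
  "carrier (grassmann_envelope P) = env_homog 0 <+>\<^bsub>t.TA\<^esub> env_homog 1"
  "monoid.mult (grassmann_envelope P) = monoid.mult t.TA"
  "one (grassmann_envelope P) = one t.TA"
  "ring.zero (grassmann_envelope P) = ring.zero t.TA"
  "add (grassmann_envelope P) = add t.TA"
  "module.smult (grassmann_envelope P) = module.smult t.TA"
  "homog (grassmann_envelope P) = env_homog"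
  unfolding grassmann_envelope_def Let_def with_grading_simps pure_tensors_def by simp_all

lemma list_product_envelope: "list_product (grassmann_envelope P) = list_product t.TA"
  by (simp add: fun_eq_iff list_product_def envelope_simps)

lemma pure_tensors_subset: "pure_tensors g \<subseteq> carrier t.TA"
  unfolding pure_tensors_def using P.homog_in_carrier gr.homog_closed(1) by blast

lemma env_homog_sub: "submodule (env_homog g) (ring_of_type_algebra :: 'k ring) t.TA"
  by (rule T.lin_span_submodule[OF pure_tensors_subset])

lemma env_homog_ops:
  "x \<in> env_homog g \<Longrightarrow> x \<in> carrier t.TA" "\<zero>\<^bsub>t.TA\<^esub> \<in> env_homog g"
  "x \<in> env_homog g \<Longrightarrow> y \<in> env_homog g \<Longrightarrow> x \<oplus>\<^bsub>t.TA\<^esub> y \<in> env_homog g"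
  "x \<in> env_homog g \<Longrightarrow> c \<odot>\<^bsub>t.TA\<^esub> x \<in> env_homog g"
  using env_homog_sub[of g] unfolding T.submodule_iff by (blast, simp_all)

lemma pure_env_homog: "p \<in> homog P g \<Longrightarrow> e \<in> homog grassmann g \<Longrightarrow> t.pure p e \<in> env_homog g"
  by (rule subsetD[OF T.lin_span_superset]) (auto simp: pure_tensors_def)

lemma env_homog_mult:
  assumes "x \<in> env_homog g" "y \<in> env_homog h"
  shows "x \<otimes>\<^bsub>t.TA\<^esub> y \<in> env_homog (g + h)"
proof (rule T.span_mult_closed[OF assms pure_tensors_subset pure_tensors_subset env_homog_sub])
  fix s s' assume "s \<in> pure_tensors g" "s' \<in> pure_tensors h"
  then obtain p e p' e' where *: "s = t.pure p e" "p \<in> homog P g" "e \<in> homog grassmann g"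
    "s' = t.pure p' e'" "p' \<in> homog P h" "e' \<in> homog grassmann h"
    unfolding pure_tensors_def by blast
  have "t.pure (p \<otimes>\<^bsub>P\<^esub> p') (e \<otimes>\<^bsub>grassmann\<^esub> e') \<in> env_homog (g + h)"
    by (rule pure_env_homog[OF P.homog_mult[OF *(2,5)] grassmann_homog_mult[OF *(3,6)]])
  moreover have "s \<otimes>\<^bsub>t.TA\<^esub> s' = t.pure (p \<otimes>\<^bsub>P\<^esub> p') (e \<otimes>\<^bsub>grassmann\<^esub> e')"
    unfolding *(1,4) by (rule t.pure_mult) (use * in \<open>auto intro: P.homog_in_carrier\<close>)
  ultimately show "s \<otimes>\<^bsub>t.TA\<^esub> s' \<in> env_homog (g + h)" by (simp only:)
qed

lemma env_carrierE:
  assumes "x \<in> carrier (grassmann_envelope P)"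
  obtains a b where "a \<in> env_homog 0" "b \<in> env_homog 1" "x = a \<oplus>\<^bsub>t.TA\<^esub> b"
  using assms unfolding envelope_simps set_add_def' by blast

lemma env_carrierI:
  "a \<in> env_homog 0 \<Longrightarrow> b \<in> env_homog 1 \<Longrightarrow> a \<oplus>\<^bsub>t.TA\<^esub> b \<in> carrier (grassmann_envelope P)"
  unfolding envelope_simps set_add_def' by blast

lemma env_homog_carrier: "env_homog g \<subseteq> carrier (grassmann_envelope P)"
proof
  fix x assume x: "x \<in> env_homog g"
  then have xc: "x \<in> carrier t.TA" by (rule env_homog_ops)
  show "x \<in> carrier (grassmann_envelope P)"
  proof (cases g)
    case zero
    then show ?thesis using env_carrierI[of x "\<zero>\<^bsub>t.TA\<^esub>"] x xc env_homog_ops(2) by simp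
  next
    case one
    then show ?thesis using env_carrierI[of "\<zero>\<^bsub>t.TA\<^esub>" x] x xc env_homog_ops(2) by simp
  qed
qed

lemma env_carrier_TA: "x \<in> carrier (grassmann_envelope P) \<Longrightarrow> x \<in> carrier t.TA"
  by (elim env_carrierE) (simp add: env_homog_ops(1))

lemma env_one: "\<one>\<^bsub>t.TA\<^esub> \<in> env_homog 0"
  unfolding t.one_TA by (rule pure_env_homog[OF P.one_homog_zero gr.one_homog])

lemma env_add_closed:
  assumes "x \<in> carrier (grassmann_envelope P)" "y \<in> carrier (grassmann_envelope P)"
  shows "x \<oplus>\<^bsub>t.TA\<^esub> y \<in> carrier (grassmann_envelope P)"
proof -
  obtain a b where ab: "a \<in> env_homog 0" "b \<in> env_homog 1" "x = a \<oplus>\<^bsub>t.TA\<^esub> b"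
    using assms(1) by (rule env_carrierE)
  obtain a' b' where ab': "a' \<in> env_homog 0" "b' \<in> env_homog 1" "y = a' \<oplus>\<^bsub>t.TA\<^esub> b'"
    using assms(2) by (rule env_carrierE)
  have "x \<oplus>\<^bsub>t.TA\<^esub> y = (a \<oplus>\<^bsub>t.TA\<^esub> a') \<oplus>\<^bsub>t.TA\<^esub> (b \<oplus>\<^bsub>t.TA\<^esub> b')"
    using ab ab' env_homog_ops(1) by (simp add: T.M.a_ac)
  then show ?thesis using env_carrierI ab ab' env_homog_ops(3) by simp
qed

lemma unital_algebra_envelope: "unital_algebra (grassmann_envelope P)"
proof -
  have mult: "x \<otimes>\<^bsub>t.TA\<^esub> y \<in> carrier (grassmann_envelope P)"
    if xy: "x \<in> carrier (grassmann_envelope P)" "y \<in> carrier (grassmann_envelope P)" for x y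
  proof -
    obtain a b where ab: "a \<in> env_homog 0" "b \<in> env_homog 1" "x = a \<oplus>\<^bsub>t.TA\<^esub> b"
      using xy(1) by (rule env_carrierE)
    obtain a' b' where ab': "a' \<in> env_homog 0" "b' \<in> env_homog 1" "y = a' \<oplus>\<^bsub>t.TA\<^esub> b'"
      using xy(2) by (rule env_carrierE)
    have p: "u \<otimes>\<^bsub>t.TA\<^esub> v \<in> carrier (grassmann_envelope P)" if "u \<in> env_homog g" "v \<in> env_homog h" for u v g h
      using env_homog_mult[OF that] env_homog_carrier by blast
    have "x \<otimes>\<^bsub>t.TA\<^esub> y = (a \<otimes>\<^bsub>t.TA\<^esub> a' \<oplus>\<^bsub>t.TA\<^esub> b \<otimes>\<^bsub>t.TA\<^esub> a') \<oplus>\<^bsub>t.TA\<^esub>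
        (a \<otimes>\<^bsub>t.TA\<^esub> b' \<oplus>\<^bsub>t.TA\<^esub> b \<otimes>\<^bsub>t.TA\<^esub> b')"
      using ab ab' env_homog_ops(1) by (simp add: T.l_distr T.r_distr)
    then show ?thesis
      using env_add_closed p[OF ab(1) ab'(1)] p[OF ab(1) ab'(2)] p[OF ab(2) ab'(1)] p[OF ab(2) ab'(2)] by simp
  qed
  have smult: "c \<odot>\<^bsub>t.TA\<^esub> x \<in> carrier (grassmann_envelope P)"
    if xy: "x \<in> carrier (grassmann_envelope P)" for x c
  proof -
    obtain a b where ab: "a \<in> env_homog 0" "b \<in> env_homog 1" "x = a \<oplus>\<^bsub>t.TA\<^esub> b"
      using xy(1) by (rule env_carrierE)
    then show ?thesis
      using env_carrierI env_homog_ops(1,4) by (simp add: T.smult_add_right)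
  qed
  show ?thesis
  proof (rule unital_algebraI, unfold envelope_simps(2-6), goal_cases)
    case 1 show ?case using env_homog_ops(2)[of 0] env_homog_carrier by blast
  next
    case 2 show ?case using env_one env_homog_carrier by blast
  qed (simp_all add: env_add_closed mult smult env_carrier_TA T.M.a_ac T.m_assoc T.l_distr T.r_distr
      T.smult_add_left T.smult_add_right T.smult_mult_left T.smult_mult_right)
qed

lemma unit_graded_envelope: "unit_graded (grassmann_envelope P)"
proof (intro unit_graded.intro unit_graded_axioms.intro unital_algebra_envelope)
  show "\<one>\<^bsub>grassmann_envelope P\<^esub> \<in> homog (grassmann_envelope P) 0"
    unfolding envelope_simps by (rule env_one)
  show "submodule (homog (grassmann_envelope P) g) ring_of_type_algebra (grassmann_envelope P)" for g
    unfolding unital_algebra.submodule_iff[OF unital_algebra_envelope] envelope_simps(2-7)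
    using env_homog_carrier env_homog_ops(2-4) by (intro conjI ballI allI)
qed

lemma pure_tensors_list:
  "list_all2 (\<lambda>b g. b \<in> pure_tensors g) bs gs \<Longrightarrow> \<exists>ps es. list_all2 (\<lambda>p g. p \<in> homog P g) ps gs \<and>
    list_all2 (\<lambda>e g. e \<in> homog grassmann g) es gs \<and> bs = map2 t.pure ps es"
proof (induction rule: list_all2_induct)
  case (Cons b bs g gs)
  then obtain ps es where "list_all2 (\<lambda>p g. p \<in> homog P g) ps gs"
    "list_all2 (\<lambda>e g. e \<in> homog grassmann g) es gs" "bs = map2 t.pure ps es" by blast
  moreover obtain p e where "b = t.pure p e" "p \<in> homog P g" "e \<in> homog grassmann g"
    using Cons.hyps(1) unfolding pure_tensors_def by blast
  ultimately show ?case by (intro exI[of _ "p # ps"] exI[of _ "e # es"]) simp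
qed simp

lemma homog_lists_carrier:
  "list_all2 (\<lambda>p g. p \<in> homog P g) ps gs \<Longrightarrow> set ps \<subseteq> carrier P"
  "list_all2 (\<lambda>e g. e \<in> homog (grassmann :: ('k, _) graded_algebra) g) es gs \<Longrightarrow> set es \<subseteq> carrier grassmann"
  by (erule list_all2_member_subset, rule subsetI, erule P.homog_in_carrier)
    (erule list_all2_member_subset, rule gr.homog_carrier)

text \<open>The coordinate at \<open>set w\<close> is nonzero on the monomial, so contraction along
  it recovers a nonzero multiple of \<open>p\<close>.\<close>

lemma pure_monomial_nonzero:
  assumes "p \<in> carrier P" "p \<noteq> \<zero>\<^bsub>P\<^esub>" "distinct w"
  shows "t.pure p (grassmann_monomial w) \<noteq> \<zero>\<^bsub>t.TA\<^esub>"
proof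
  assume "t.pure p (grassmann_monomial w) = \<zero>\<^bsub>t.TA\<^esub>"
  from t.pure_eq_zeroD[OF this assms(1) grassmann_monomial_closed linear_functional_quotient_coeff, of "set w"]
  show False using assms by (simp add: quotient_coeff_monomial word_sign_def)
qed

text \<open>Commutativity of \<open>P\<close> is recovered by attaching independent Grassmann
  generators and cancelling the sign they contribute; nonvanishing is recovered from the left
  factors of pure tensors.\<close>

lemma regular_envelope_imp:
  assumes reg: "regular_wrt grassmann_commutation (grassmann_envelope P)"
  shows "cring P \<and> regular P"
proof
  have comm: "p \<otimes>\<^bsub>P\<^esub> q = q \<otimes>\<^bsub>P\<^esub> p" if p: "p \<in> homog P g" and q: "q \<in> homog P h" for p q g h
  proof -
    \<comment> \<open>Two different generators are used for odd degrees, so the concatenated word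
      stays free of repetitions when both degrees are odd.\<close>
    define u :: "nat list" where "u = (if g = 1 then [0] else [])"
    define v :: "nat list" where "v = (if h = 1 then [1] else [])"
    let ?e = "grassmann_monomial u :: (_ \<Rightarrow>\<^sub>0 'k) set" and ?f = "grassmann_monomial v :: (_ \<Rightarrow>\<^sub>0 'k) set"
    let ?s = "grassmann_commutation g h :: 'k"
    have gh: "of_nat (length u) = g" "of_nat (length v) = h"
      unfolding u_def v_def by (cases g; simp)+ 
    have e: "?e \<in> homog grassmann g" "?f \<in> homog grassmann h"
      using grassmann_monomial_homog[of u] grassmann_monomial_homog[of v] unfolding gh .
    have c: "?e \<in> carrier grassmann" "?f \<in> carrier grassmann" "p \<in> carrier P" "q \<in> carrier P"
      using p q by (auto intro: grassmann_monomial_closed P.homog_in_carrier)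
    let ?fe = "?f \<otimes>\<^bsub>grassmann\<^esub> ?e"
    have fe: "?fe = grassmann_monomial (v @ u)" by (rule grassmann_monomial_mult)
    have fec: "?fe \<in> carrier grassmann" by (rule gr.m_closed[OF c(2,1)])
    have pq: "p \<otimes>\<^bsub>P\<^esub> q \<in> carrier P" "q \<otimes>\<^bsub>P\<^esub> p \<in> carrier P" using c by simp_all
    have "t.pure p ?e \<otimes>\<^bsub>t.TA\<^esub> t.pure q ?f = ?s \<odot>\<^bsub>t.TA\<^esub> (t.pure q ?f \<otimes>\<^bsub>t.TA\<^esub> t.pure p ?e)"
      using reg pure_env_homog[OF p e(1)] pure_env_homog[OF q e(2)]
      unfolding regular_wrt_def envelope_simps by blast
    then have "?s \<odot>\<^bsub>t.TA\<^esub> t.pure (p \<otimes>\<^bsub>P\<^esub> q) ?fe = ?s \<odot>\<^bsub>t.TA\<^esub> t.pure (q \<otimes>\<^bsub>P\<^esub> p) ?fe"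
      using c grassmann_homog_commute[OF e] fec pq by (simp add: t.pure_mult t.pure_smult_right)
    \<comment> \<open>The sign enters once through the envelope and once through the Grassmann
      factor. Multiplying by it again removes it, since it is 1 or -1.\<close>
    then have "(?s * ?s) \<odot>\<^bsub>t.TA\<^esub> t.pure (p \<otimes>\<^bsub>P\<^esub> q) ?fe = (?s * ?s) \<odot>\<^bsub>t.TA\<^esub> t.pure (q \<otimes>\<^bsub>P\<^esub> p) ?fe"
      using pq fec by (metis T.smult_smult t.pure_closed)
    moreover have "?s * ?s = 1" by (simp add: grassmann_commutation_def)
    ultimately have eq: "t.pure (p \<otimes>\<^bsub>P\<^esub> q) ?fe = t.pure (q \<otimes>\<^bsub>P\<^esub> p) ?fe"
      using pq fec by simp
    \<comment> \<open>Equality of two tensors with the same right factor becomes the vanishing of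
      one tensor, to which the nonvanishing criterion applies.\<close>
    let ?d = "p \<otimes>\<^bsub>P\<^esub> q \<oplus>\<^bsub>P\<^esub> (-1) \<odot>\<^bsub>P\<^esub> (q \<otimes>\<^bsub>P\<^esub> p)"
    have "t.pure ?d ?fe = t.pure (q \<otimes>\<^bsub>P\<^esub> p) ?fe \<oplus>\<^bsub>t.TA\<^esub> (-1) \<odot>\<^bsub>t.TA\<^esub> t.pure (q \<otimes>\<^bsub>P\<^esub> p) ?fe"
      using pq fec by (simp add: t.pure_add_left t.pure_smult_left eq)
    also have "\<dots> = \<zero>\<^bsub>t.TA\<^esub>"
      by (rule T.add_neg_smult) (use pq fec in simp)
    finally have "t.pure ?d (grassmann_monomial (v @ u)) = \<zero>\<^bsub>t.TA\<^esub>" unfolding fe .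
    moreover have "distinct (v @ u)" by (simp add: u_def v_def)
    ultimately have "?d = \<zero>\<^bsub>P\<^esub>" using pure_monomial_nonzero[of ?d "v @ u"] pq by auto
    then show ?thesis using P.add_neg_smult_eq_zeroD pq by blast
  qed
  show "cring P" by (rule P.cringI_homog) (rule comm)
  have "\<exists>as. list_all2 (\<lambda>a g. a \<in> homog P g) as gs \<and> list_product P as \<noteq> \<zero>\<^bsub>P\<^esub>" for gs
  proof -
    obtain as where as: "list_all2 (\<lambda>a g. a \<in> env_homog g) as gs" "list_product t.TA as \<noteq> \<zero>\<^bsub>t.TA\<^esub>"
      using reg unfolding regular_wrt_def envelope_simps list_product_envelope by blast
    \<comment> \<open>By multilinearity the product may be taken over pure tensors; then it is a
      single pure tensor whose left factor is a product in \<open>P\<close>.\<close>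
    obtain bs where bs: "list_all2 (\<lambda>b g. b \<in> pure_tensors g) bs gs" "list_product t.TA bs \<noteq> \<zero>\<^bsub>t.TA\<^esub>"
      using T.list_product_span_nonzero[where as = as and S = pure_tensors and gs = gs, OF as(1) pure_tensors_subset as(2)] by blast
    obtain ps es where pe: "list_all2 (\<lambda>p g. p \<in> homog P g) ps gs"
      "list_all2 (\<lambda>e g. e \<in> homog grassmann g) es gs" "bs = map2 t.pure ps es"
      using pure_tensors_list[OF bs(1)] by blast
    have c: "set ps \<subseteq> carrier P" "set es \<subseteq> carrier grassmann"
      by (rule homog_lists_carrier(1)[OF pe(1)], rule homog_lists_carrier(2)[OF pe(2)])
    have "length ps = length es" using pe(1,2) by (simp add: list_all2_lengthD)
    then have nz: "t.pure (list_product P ps) (list_product grassmann es) \<noteq> \<zero>\<^bsub>t.TA\<^esub>"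
      using bs(2) t.list_product_pure[OF c] unfolding pe(3) by simp
    have es_closed: "list_product grassmann es \<in> carrier grassmann" using c(2) by (rule gr.list_product_closed)
    have "list_product P ps \<noteq> \<zero>\<^bsub>P\<^esub>"
    proof
      assume "list_product P ps = \<zero>\<^bsub>P\<^esub>"
      with nz t.pure_zero_left[OF es_closed] show False by (simp only:)
    qed
    with pe(1) show ?thesis by blast
  qed
  then have "regular_wrt (\<lambda>g h. 1) P"
    unfolding regular_wrt_def
  proof (intro conjI allI ballI)
    fix g h p q assume "p \<in> homog P g" "q \<in> homog P h"
    with comm[of p g q h] show "p \<otimes>\<^bsub>P\<^esub> q = 1 \<odot>\<^bsub>P\<^esub> (q \<otimes>\<^bsub>P\<^esub> p)"
      by (simp add: P.homog_in_carrier)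
  qed simp_all
  then show "regular P" unfolding regular_def by blast
qed

text \<open>Since \<open>P\<close> commutes, the commutation factor comes from the Grassmann side
  alone. Nonvanishing products of \<open>P\<close> are paired with monomials whose generators are
  all different.\<close>

lemma regular_envelope:
  assumes "cring P" "regular P"
  shows "regular_wrt grassmann_commutation (grassmann_envelope P)"
  unfolding regular_wrt_def envelope_simps list_product_envelope
proof (intro conjI allI ballI)
  fix gs
  obtain ps where ps: "list_all2 (\<lambda>p g. p \<in> homog P g) ps gs" "list_product P ps \<noteq> \<zero>\<^bsub>P\<^esub>"
    using assms(2) unfolding regular_def regular_wrt_def by blast
  let ?es = "map grassmann_monomial (pattern_words gs) :: (_ \<Rightarrow>\<^sub>0 'k) set list"
  note es = pattern_words_homog[of gs, where 'k = 'k]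
  have c: "set ps \<subseteq> carrier P" "set ?es \<subseteq> carrier grassmann"
    by (rule homog_lists_carrier(1)[OF ps(1)], rule homog_lists_carrier(2)[OF es])
  have len: "length ps = length gs" "length ?es = length gs"
    using ps(1) es by (auto dest: list_all2_lengthD)
  have "t.pure (list_product P ps) (list_product grassmann ?es) \<noteq> \<zero>\<^bsub>t.TA\<^esub>"
    unfolding list_product_monomials
    by (rule pure_monomial_nonzero[OF P.list_product_closed[OF c(1)] ps(2) distinct_concat_pattern_words])
  then have "list_product t.TA (map2 t.pure ps ?es) \<noteq> \<zero>\<^bsub>t.TA\<^esub>"
    using t.list_product_pure[OF c] len by simp
  moreover have "list_all2 (\<lambda>a g. a \<in> env_homog g) (map2 t.pure ps ?es) gs"
    using ps(1) es len unfolding list_all2_conv_all_nth by (simp add: pure_env_homog)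
  ultimately show "\<exists>as. list_all2 (\<lambda>a g. a \<in> env_homog g) as gs \<and> list_product t.TA as \<noteq> \<zero>\<^bsub>t.TA\<^esub>"
    by blast
next
  fix g h a b
  show "grassmann_commutation g h \<noteq> (0::'k)" by (simp add: grassmann_commutation_def)
  assume "a \<in> env_homog g" "b \<in> env_homog h"
  then show "a \<otimes>\<^bsub>t.TA\<^esub> b = grassmann_commutation g h \<odot>\<^bsub>t.TA\<^esub> (b \<otimes>\<^bsub>t.TA\<^esub> a)"
  proof (rule T.span_mult_commute[OF _ _ pure_tensors_subset pure_tensors_subset])
    fix s s' assume "s \<in> pure_tensors g" "s' \<in> pure_tensors h"
    then obtain p e p' e' where *: "s = t.pure p e" "p \<in> homog P g" "e \<in> homog grassmann g"
      "s' = t.pure p' e'" "p' \<in> homog P h" "e' \<in> homog grassmann h"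
      unfolding pure_tensors_def by blast
    then have c: "p \<in> carrier P" "p' \<in> carrier P" "e \<in> carrier grassmann" "e' \<in> carrier grassmann"
      by (auto intro: P.homog_in_carrier)
    have "p \<otimes>\<^bsub>P\<^esub> p' = p' \<otimes>\<^bsub>P\<^esub> p"
      using comm_monoid.m_comm[of P] assms(1) c by (simp add: cring_def)
    with c show "s \<otimes>\<^bsub>t.TA\<^esub> s' = grassmann_commutation g h \<odot>\<^bsub>t.TA\<^esub> (s' \<otimes>\<^bsub>t.TA\<^esub> s)"
      using grassmann_homog_commute[OF *(3,6)] by (simp add: * t.pure_mult t.pure_smult_right)
  qed
qed

end

subsection \<open>Finite-dimensional graded algebras with nonvanishing odd products\<close>

context z2_graded_algebra
begin

text \<open>The odd components of a finite spanning set suffice. Every x is a + b with a even and b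
  in their span; if x is odd, then a = x - b is both even and odd, hence zero.\<close>

lemma finite_odd_span:
  assumes "finite_dimensional A"
  obtains S where "finite S" "S \<subseteq> homog A 1" "homog A 1 \<subseteq> lin_span A S"
proof -
  obtain S where S: "finite S" "S \<subseteq> carrier A" "lin_span A S = carrier A"
    using assms unfolding finite_dimensional_def by blast
  have "\<forall>s\<in>S. \<exists>b. b \<in> homog A 1 \<and> (\<exists>a\<in>homog A 0. s = a \<oplus> b)"
    using S(2) homog_decompose by (metis subsetD)
  then obtain od where od: "\<And>s. s \<in> S \<Longrightarrow> od s \<in> homog A 1"
    "\<And>s. s \<in> S \<Longrightarrow> \<exists>a\<in>homog A 0. s = a \<oplus> od s"
    using bchoice[of S "\<lambda>s b. b \<in> homog A 1 \<and> (\<exists>a\<in>homog A 0. s = a \<oplus> b)"] by blast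
  let ?S = "od ` S"
  have S1: "?S \<subseteq> homog A 1" using od(1) by blast
  have S1c: "?S \<subseteq> carrier A" using od(1) homog_in_carrier by blast
  have sp: "lin_span A ?S \<subseteq> homog A 1" by (rule lin_span_minimal[OF homog_submodule S1])
  have spc: "x \<in> carrier A" if "x \<in> lin_span A ?S" for x
    using sp that homog_in_carrier by blast
  note sub = lin_span_submodule[OF S1c, unfolded submodule_iff]
  have dec: "\<exists>a\<in>homog A 0. \<exists>b\<in>lin_span A ?S. x = a \<oplus> b" if "x \<in> carrier A" for x
  proof -
    have "x \<in> lin_span A S" using that S(3) by simp
    then show ?thesis using S(2)
    proof (induction rule: lin_span_induct)
      case (base x)
      then show ?case using od(2)[OF base] subsetD[OF lin_span_superset, of "od x" ?S] by blast
    next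
      case zero
      have "\<zero> \<in> lin_span A ?S" using sub by simp
      then show ?case using homog_ops(1)[of 0] by (intro bexI[of _ \<zero>]) simp_all
    next
      case (add x y)
      then obtain a b a' b' where *: "a \<in> homog A 0" "b \<in> lin_span A ?S" "x = a \<oplus> b"
        "a' \<in> homog A 0" "b' \<in> lin_span A ?S" "y = a' \<oplus> b'" by blast
      have "b \<oplus> b' \<in> lin_span A ?S" using sub * by blast
      moreover have "x \<oplus> y = (a \<oplus> a') \<oplus> (b \<oplus> b')"
        using * spc homog_in_carrier by (simp add: M.a_ac)
      ultimately show ?case using homog_ops(2)[OF *(1,4)] by blast
    next
      case (smult c x)
      then obtain a b where *: "a \<in> homog A 0" "b \<in> lin_span A ?S" "x = a \<oplus> b" by blast
      have "c \<odot> b \<in> lin_span A ?S" using sub * by blast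
      moreover have "c \<odot> x = c \<odot> a \<oplus> c \<odot> b"
        using * spc homog_in_carrier by (simp add: smult_add_right)
      ultimately show ?case using homog_ops(3)[OF *(1)] by blast
    qed
  qed
  have "homog A 1 \<subseteq> lin_span A ?S"
  proof
    fix x assume x: "x \<in> homog A 1"
    obtain a b where ab: "a \<in> homog A 0" "b \<in> lin_span A ?S" "x = a \<oplus> b"
      using dec[OF homog_in_carrier[OF x]] by blast
    have c: "a \<in> carrier A" "b \<in> carrier A" "b \<in> homog A 1" using ab sp spc homog_in_carrier by blast+
    have "a = x \<oplus> (-1) \<odot> b"
      using c by (simp add: ab(3) M.a_assoc add_neg_smult)
    then have "a \<in> homog A 1" using x c(3) by (simp add: homog_ops)
    then have "a = \<zero>" using homog_disjoint[of a 0] ab(1) by simp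
    then show "x \<in> lin_span A ?S" using ab c by simp
  qed
  with S(1) S1 show ?thesis using that[of ?S] by blast
qed

text \<open>Prepares pigeonhole arguments: arbitrarily long nonvanishing products can be formed from
  one finite set of odd elements.\<close>

lemma odd_generator_words:
  assumes "finite_dimensional A"
    and odd: "\<And>n. \<exists>as. list_all2 (\<lambda>a g. a \<in> homog A g) as (replicate n 1) \<and> list_product A as \<noteq> \<zero>"
  obtains S where "finite S" "S \<subseteq> homog A 1"
    "\<And>n. \<exists>bs. length bs = n \<and> set bs \<subseteq> S \<and> list_product A bs \<noteq> \<zero>"
proof -
  obtain S where S: "finite S" "S \<subseteq> homog A 1" "homog A 1 \<subseteq> lin_span A S"
    using finite_odd_span[OF assms(1)] .
  have Sc: "S \<subseteq> carrier A" using S(2) homog_in_carrier by blast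
  have "\<exists>bs. length bs = n \<and> set bs \<subseteq> S \<and> list_product A bs \<noteq> \<zero>" for n
  proof -
    obtain as where as: "list_all2 (\<lambda>a g. a \<in> homog A g) as (replicate n 1)" "list_product A as \<noteq> \<zero>"
      using odd by blast
    have "list_all2 (\<lambda>a g. a \<in> lin_span A S) as (replicate n (1 :: bit))"
      using as(1) S(3) unfolding list_all2_conv_all_nth by auto
    from list_product_span_nonzero[where S = "\<lambda>_. S", OF this Sc as(2)] obtain bs where
      bs: "list_all2 (\<lambda>b g. b \<in> S) bs (replicate n (1 :: bit))" "list_product A bs \<noteq> \<zero>" by blast
    then have "length bs = n" "set bs \<subseteq> S"
      unfolding list_all2_conv_all_nth by (auto simp: set_conv_nth)
    with bs(2) show ?thesis by blast
  qed
  with S(1,2) show ?thesis by (rule that)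
qed

end

text \<open>In finite dimension a word longer than the number of odd generators repeats a letter,
  and in a supercommutative algebra it then vanishes.\<close>

lemma infinite_dimensional_supercommutative:
  fixes A :: "('k::field_char_0, 'a) graded_algebra"
  assumes A: "z2_graded_algebra A" and reg: "regular_wrt grassmann_commutation A"
  shows "\<not> finite_dimensional A"
proof
  assume fd: "finite_dimensional A"
  interpret z2_graded_algebra A by fact
  have sc: "supercommutative A"
    by (intro supercommutative.intro supercommutative_axioms.intro unit_graded)
      (use reg in \<open>unfold regular_wrt_def, blast\<close>)
  have "\<exists>as. list_all2 (\<lambda>a g. a \<in> homog A g) as (replicate n 1) \<and> list_product A as \<noteq> \<zero>\<^bsub>A\<^esub>" for n
    using reg unfolding regular_wrt_def by blast
  from odd_generator_words[OF fd this] obtain S where S: "finite S" "S \<subseteq> homog A 1"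
    "\<And>n. \<exists>bs. length bs = n \<and> set bs \<subseteq> S \<and> list_product A bs \<noteq> \<zero>\<^bsub>A\<^esub>" by blast
  obtain bs where bs: "length bs = Suc (card S)" "set bs \<subseteq> S" "list_product A bs \<noteq> \<zero>\<^bsub>A\<^esub>"
    using S(3) by blast
  have ne: "S \<noteq> {}" using bs(1,2) by (cases bs) auto
  have \<psi>: "from_nat_into S i \<in> homog A 1" for i using from_nat_into[OF ne] S(2) by blast
  \<comment> \<open>The normal form is stated for words of natural numbers, so the generators are
    enumerated; \<open>from_nat_into S\<close> stays inside \<open>S\<close> for every
    index.\<close>
  let ?w = "map (to_nat_on S) bs"
  have "\<not> distinct bs"
    using card_mono[OF S(1) bs(2)] bs(1) distinct_card[of bs] by auto
  moreover have "inj_on (to_nat_on S) (set bs)"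
    using inj_on_to_nat_on[OF countable_finite[OF S(1)]] bs(2) by (rule inj_on_subset)
  ultimately have "word_sign ?w = (0 :: 'k)" by (simp add: word_sign_def distinct_map)
  moreover have "map (from_nat_into S) ?w = bs"
    using bs(2) from_nat_into_to_nat_on[OF countable_finite[OF S(1)]]
    by (simp add: map_idI subset_eq)
  moreover have "list_product A (map (from_nat_into S) ?w) =
      word_sign ?w \<odot>\<^bsub>A\<^esub> list_product A (map (from_nat_into S) (sorted_list_of_set (set ?w)))"
    by (rule supercommutative.odd_product_normal[OF sc]) (rule \<psi>)
  moreover have "list_product A (map (from_nat_into S) (sorted_list_of_set (set ?w))) \<in> carrier A"
    by (rule supercommutative.odd_product_closed[OF sc]) (rule \<psi>)
  ultimately show False using bs(3) by simp
qed

text \<open>If every generator \<open>s\<close> satisfied s^(k s) = 0, a word of length 1 + sum of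
  all k s would contain some \<open>s\<close> more than k s times. In a commutative algebra these
  copies can be collected, which annihilates the word.\<close>

lemma exists_nonnilpotent_odd:
  fixes P :: "('k::field, 'p) graded_algebra" (structure)
  assumes P: "z2_graded_algebra P" and cring: "cring P" and fd: "finite_dimensional P"
    and odd: "\<And>n. \<exists>as. list_all2 (\<lambda>a g. a \<in> homog P g) as (replicate n 1) \<and> list_product P as \<noteq> \<zero>"
  obtains q where "q \<in> homog P 1" "\<And>n. list_product P (replicate n q) \<noteq> \<zero>"
proof (rule ccontr)
  assume contra: "\<not> thesis"
  interpret z2_graded_algebra P by (rule P)
  obtain S where S: "finite S" "S \<subseteq> homog P 1"
    "\<And>n. \<exists>bs. length bs = n \<and> set bs \<subseteq> S \<and> list_product P bs \<noteq> \<zero>"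
    using odd_generator_words[OF fd odd] by blast
  have "\<forall>s\<in>S. \<exists>n. list_product P (replicate n s) = \<zero>"
    using contra that S(2) by blast
  then obtain k where k: "\<And>s. s \<in> S \<Longrightarrow> list_product P (replicate (k s) s) = \<zero>"
    using bchoice[of S "\<lambda>s n. list_product P (replicate n s) = \<zero>"] by blast
  obtain bs where bs: "length bs = Suc (sum k S)" "set bs \<subseteq> S" "list_product P bs \<noteq> \<zero>"
    using S(3) by blast
  have bsc: "set bs \<subseteq> carrier P" using bs(2) S(2) homog_in_carrier by blast
  have "length bs = (\<Sum>s\<in>set bs. count_list bs s)" by (simp add: sum_count_set)
  also have "\<dots> = (\<Sum>s\<in>S. count_list bs s)"
    using bs(2) S(1) by (intro sum.mono_neutral_left) (auto simp: count_list_0_iff)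
  finally have "\<not> (\<forall>s\<in>S. count_list bs s \<le> k s)"
    using sum_mono[of S "count_list bs" k] bs(1) by force
  then obtain s where s: "s \<in> S" "k s \<le> count_list bs s" by force
  \<comment> \<open>What remains of \<open>bs\<close> after \<open>k s\<close> copies of
    \<open>s\<close> have been moved to the front.\<close>
  define us where "us = replicate (count_list bs s - k s) s @ filter (\<lambda>x. x \<noteq> s) bs"
  have sc: "s \<in> carrier P" using s(1) S(2) homog_in_carrier by blast
  have "mset bs = mset (replicate (k s) s @ us)"
  proof (rule multiset_eqI)
    fix x
    show "count (mset bs) x = count (mset (replicate (k s) s @ us)) x"
      using s(2) by (simp add: us_def count_mset count_list_eq_length_filter[symmetric])
  qed
  then have "list_product P bs = list_product P (replicate (k s) s @ us)"
  proof (rule list_product_mset_cong[OF _ bsc])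
    fix x y assume "x \<in> set bs" "y \<in> set bs"
    then show "x \<otimes> y = y \<otimes> x"
      using comm_monoid.m_comm[of P x y] cring bsc by (simp add: cring_def subsetD)
  qed
  also have "\<dots> = list_product P (replicate (k s) s) \<otimes> list_product P us"
    by (rule list_product_append) (use sc bsc in \<open>auto simp: us_def\<close>)
  also have "\<dots> = \<zero>"
  proof -
    have "list_product P us \<in> carrier P" by (rule list_product_closed) (use sc bsc in \<open>auto simp: us_def\<close>)
    then show ?thesis using k[OF s(1)] by simp
  qed
  finally show False using bs(3) by simp
qed

subsection \<open>Evaluation of univariate polynomials\<close>

context unital_algebra
begin

definition poly_value :: "'a \<Rightarrow> 'k poly \<Rightarrow> 'a"
  where "poly_value q p = fold_coeffs (\<lambda>a r. a \<odot> \<one> \<oplus> q \<otimes> r) p \<zero>"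

context
  fixes q assumes q: "q \<in> carrier A"
begin

lemma poly_value_0 [simp]: "poly_value q 0 = \<zero>"
  by (simp add: poly_value_def)

lemma poly_value_pCons: "poly_value q (pCons a p) = a \<odot> \<one> \<oplus> q \<otimes> poly_value q p"
proof (cases "p = 0 \<and> a = 0")
  case True
  then show ?thesis using q by simp
next
  case False
  then show ?thesis by (auto simp: poly_value_def fold_coeffs_pCons_coeff_not_0_eq fold_coeffs_pCons_not_0_0_eq)
qed

lemma poly_value_closed [simp]: "poly_value q p \<in> carrier A"
  by (induction p) (simp_all add: poly_value_pCons q)

lemma poly_value_add: "poly_value q (p + r) = poly_value q p \<oplus> poly_value q r"
proof (induction p r rule: poly_induct2)
  case (pCons a p b r)
  then show ?case by (simp add: poly_value_pCons q r_distr smult_add_left M.a_ac)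
qed simp

lemma poly_value_smult: "poly_value q (Polynomial.smult c p) = c \<odot> poly_value q p"
  by (induction p) (simp_all add: poly_value_pCons q smult_add_right smult_mult_right)

lemma poly_value_mult: "poly_value q (p * r) = poly_value q p \<otimes> poly_value q r"
proof (induction p)
  case (pCons a p)
  have "poly_value q (pCons a p * r) = a \<odot> poly_value q r \<oplus> q \<otimes> (poly_value q p \<otimes> poly_value q r)"
    by (simp add: mult_pCons_left poly_value_add poly_value_smult poly_value_pCons q pCons.IH)
  then show ?case by (simp add: poly_value_pCons q l_distr smult_mult_left m_assoc)
qed simp

lemma poly_value_monom: "poly_value q (Polynomial.monom c n) = c \<odot> list_product A (replicate n q)"
proof (induction n)
  case (Suc n)
  have "list_product A (replicate n q) \<in> carrier A" using q by (intro list_product_closed) auto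
  with Suc q show ?case by (simp add: monom_Suc poly_value_pCons smult_mult_right)
qed (simp add: monom_0 poly_value_pCons q)

lemma poly_value_dvd: "poly_value q m = \<zero> \<Longrightarrow> m dvd p \<Longrightarrow> poly_value q p = \<zero>"
  by (auto simp: poly_value_mult elim!: dvdE)

end

lemma lin_span_insert:
  assumes "x \<in> lin_span A (insert s S)" and S: "insert s S \<subseteq> carrier A"
  shows "\<exists>a. \<exists>y\<in>lin_span A S. x = a \<odot> s \<oplus> y"
proof -
  have Sc: "S \<subseteq> carrier A" and sc: "s \<in> carrier A" using S by auto
  note sub = lin_span_submodule[OF Sc, unfolded submodule_iff]
  have spc: "y \<in> carrier A" if "y \<in> lin_span A S" for y using that sub by blast
  have z: "\<zero> \<in> lin_span A S" using sub by simp
  from assms(1) S show ?thesis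
  proof (induction rule: lin_span_induct)
    case (base x)
    show ?case
    proof (cases "x = s")
      case True
      then show ?thesis using z sc by (intro exI[of _ 1] bexI[of _ \<zero>]) simp_all
    next
      case False
      with base have "x \<in> lin_span A S" using subsetD[OF lin_span_superset, of x S] by simp
      then show ?thesis using sc spc by (intro exI[of _ 0] bexI[of _ x]) simp_all
    qed
  next
    case zero
    then show ?case using z sc by (intro exI[of _ 0] bexI[of _ \<zero>]) simp_all
  next
    case (add x y)
    then obtain a u b v where *: "u \<in> lin_span A S" "x = a \<odot> s \<oplus> u" "v \<in> lin_span A S" "y = b \<odot> s \<oplus> v"
      by blast
    have "u \<oplus> v \<in> lin_span A S" using sub * by blast
    moreover have "x \<oplus> y = (a + b) \<odot> s \<oplus> (u \<oplus> v)"
      using * spc sc by (simp add: smult_add_left M.a_ac)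
    ultimately show ?case by blast
  next
    case (smult c x)
    then obtain a u where *: "u \<in> lin_span A S" "x = a \<odot> s \<oplus> u" by blast
    have "c \<odot> u \<in> lin_span A S" using sub * by blast
    moreover have "c \<odot> x = (c * a) \<odot> s \<oplus> c \<odot> u"
      using * spc sc by (simp add: smult_add_right)
    ultimately show ?case by blast
  qed
qed

text \<open>Eliminating one spanning vector at a time keeps the space of polynomials of unbounded
  degree.\<close>

lemma poly_value_dependent:
  assumes q: "q \<in> carrier A" and "finite S" "S \<subseteq> carrier A"
    and "\<And>p r. p \<in> W \<Longrightarrow> r \<in> W \<Longrightarrow> p + r \<in> W" "\<And>c p. p \<in> W \<Longrightarrow> Polynomial.smult c p \<in> W"
    and "\<And>n. \<exists>p\<in>W. Polynomial.degree p > n" and "\<And>p. p \<in> W \<Longrightarrow> poly_value q p \<in> lin_span A S"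
  shows "\<exists>p\<in>W. p \<noteq> 0 \<and> poly_value q p = \<zero>"
  using assms(2-)
proof (induction S arbitrary: W)
  case empty
  have "submodule {\<zero>} (ring_of_type_algebra :: 'k ring) A" by (simp add: submodule_iff)
  then have "lin_span A {} \<subseteq> {\<zero>}" by (rule lin_span_minimal) simp
  moreover obtain p where "p \<in> W" "Polynomial.degree p > 0" using empty.prems(4) by blast
  ultimately show ?case using empty.prems(5) by (intro bexI[of _ p]) auto
next
  case (insert s S)
  have Sc: "S \<subseteq> carrier A" and sc: "s \<in> carrier A" using insert.prems(1) by auto
  note sub = lin_span_submodule[OF Sc, unfolded submodule_iff]
  have spc: "y \<in> carrier A" if "y \<in> lin_span A S" for y using that sub by blast
  let ?W = "{p \<in> W. poly_value q p \<in> lin_span A S}"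
  have unb: "\<exists>p\<in>?W. Polynomial.degree p > n" for n
  proof (cases "W \<subseteq> ?W")
    case True
    then show ?thesis using insert.prems(4)[of n] by blast
  next
    case False
    then obtain p1 where p1: "p1 \<in> W" "poly_value q p1 \<notin> lin_span A S" by blast
    obtain a y where ay: "y \<in> lin_span A S" "poly_value q p1 = a \<odot> s \<oplus> y"
      using lin_span_insert[OF insert.prems(5)[OF p1(1)] insert.prems(1)] by blast
    have a: "a \<noteq> 0" using p1(2) ay spc sc by auto
    \<comment> \<open>A degree above that of \<open>p1\<close> ensures that subtracting a multiple
      of \<open>p1\<close> does not lower the degree of \<open>p\<close>.\<close>
    obtain p where p: "p \<in> W" "Polynomial.degree p > max n (Polynomial.degree p1)" using insert.prems(4) by blast
    obtain b z where bz: "z \<in> lin_span A S" "poly_value q p = b \<odot> s \<oplus> z"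
      using lin_span_insert[OF insert.prems(5)[OF p(1)] insert.prems(1)] by blast
    \<comment> \<open>This factor cancels the coefficient of \<open>s\<close>, so the value falls
      into the smaller span.\<close>
    define c where "c = - b / a"
    have ca: "c * a = - b" using a by (simp add: c_def)
    let ?p = "p + Polynomial.smult c p1"
    have "poly_value q ?p = (b \<odot> s \<oplus> (-b) \<odot> s) \<oplus> (z \<oplus> c \<odot> y)"
      using q sc spc[OF ay(1)] spc[OF bz(1)]
      by (simp add: poly_value_add poly_value_smult ay(2) bz(2) smult_add_right ca M.a_ac)
    also have "b \<odot> s \<oplus> (-b) \<odot> s = \<zero>" using smult_add_left[OF sc, of b "-b"] sc by simp
    finally have "poly_value q ?p = z \<oplus> c \<odot> y" using spc[OF ay(1)] spc[OF bz(1)] by simp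
    moreover have "z \<oplus> c \<odot> y \<in> lin_span A S" using sub ay(1) bz(1) by blast
    moreover have "?p \<in> W" using insert.prems(2,3) p(1) p1(1) by blast
    moreover have "Polynomial.degree (Polynomial.smult c p1) < Polynomial.degree p"
      using p(2) degree_smult_le[of c p1] by linarith
    then have "Polynomial.degree ?p = Polynomial.degree p" by (rule degree_add_eq_left)
    ultimately show ?thesis using p(2) by (intro bexI[of _ ?p]) auto
  qed
  have "\<exists>p\<in>?W. p \<noteq> 0 \<and> poly_value q p = \<zero>"
  proof (rule insert.IH[OF Sc])
    show "p + r \<in> ?W" if "p \<in> ?W" "r \<in> ?W" for p r
      using that insert.prems(2) sub by (auto simp: poly_value_add[OF q])
    show "Polynomial.smult c p \<in> ?W" if "p \<in> ?W" for c p
      using that insert.prems(3) sub by (auto simp: poly_value_smult[OF q])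
  qed (use unb in auto)
  then show ?case by blast
qed

text \<open>Finite dimension forces a nonzero annihilating polynomial. One of least degree divides
  all others, because the remainder of a division annihilates \<open>q\<close> too and has smaller
  degree.\<close>

lemma exists_minimal_annihilator:
  assumes q: "q \<in> carrier A" and "finite_dimensional A"
  obtains m where "m \<noteq> 0" "poly_value q m = \<zero>" "\<And>p. poly_value q p = \<zero> \<Longrightarrow> m dvd p"
proof -
  obtain S where S: "finite S" "S \<subseteq> carrier A" "lin_span A S = carrier A"
    using assms(2) unfolding finite_dimensional_def by blast
  have "\<exists>p\<in>UNIV. p \<noteq> 0 \<and> poly_value q p = \<zero>"
  proof (rule poly_value_dependent[OF q S(1,2)])
    show "\<exists>p\<in>UNIV. n < Polynomial.degree (p :: 'k poly)" for n
      by (intro bexI[of _ "Polynomial.monom 1 (Suc n)"]) (simp_all add: degree_monom_eq)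
    show "poly_value q p \<in> lin_span A S" for p using S(3) q by simp
  qed simp_all
  then obtain m where m: "m \<noteq> 0" "poly_value q m = \<zero>"
    "\<And>p. p \<noteq> 0 \<and> poly_value q p = \<zero> \<Longrightarrow> Polynomial.degree m \<le> Polynomial.degree p"
    using ex_has_least_nat[of "\<lambda>p. p \<noteq> 0 \<and> poly_value q p = \<zero>" _ Polynomial.degree] by blast
  have "m dvd p" if "poly_value q p = \<zero>" for p
  proof -
    have "poly_value q p = poly_value q (p div m * m) \<oplus> poly_value q (p mod m)"
      using poly_value_add[OF q, of "p div m * m" "p mod m"] by simp
    moreover have "poly_value q (p div m * m) = \<zero>" using m(2) q by (simp add: poly_value_mult)
    ultimately have "poly_value q (p mod m) = \<zero>" using that q by simp
    then have "p mod m = 0"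
      using m(3)[of "p mod m"] degree_mod_less'[OF m(1), of p] by linarith
    then show ?thesis by (simp add: mod_eq_0_iff_dvd)
  qed
  with m(1,2) show ?thesis by (rule that)
qed

end

text \<open>Splitting off the constant coefficient shifts all exponents by one, so the induction
  alternates the degree \<open>g\<close>.\<close>

lemma (in z2_graded_algebra) poly_value_parity:
  assumes q: "q \<in> homog A 1" and p: "\<And>i. Polynomial.coeff p i \<noteq> 0 \<Longrightarrow> of_nat i = g"
  shows "poly_value q p \<in> homog A g"
  using p
proof (induction p arbitrary: g)
  case 0
  then show ?case by (simp add: homog_ops homog_in_carrier[OF q])
next
  case (pCons a p)
  have qc: "q \<in> carrier A" using q by (rule homog_in_carrier)
  have "of_nat i = g + 1" if "Polynomial.coeff p i \<noteq> 0" for i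
    using pCons.prems[of "Suc i"] that by (cases g) auto
  then have "q \<otimes> poly_value q p \<in> homog A (1 + (g + 1))"
    by (intro homog_mult q pCons.IH)
  moreover have "1 + (g + 1) = g" by (cases g) auto
  ultimately have "q \<otimes> poly_value q p \<in> homog A g" by simp
  moreover have "a \<odot> \<one> \<in> homog A g"
  proof (cases "a = 0")
    case False
    then have "g = 0" using pCons.prems[of 0] by simp
    then show ?thesis by (simp add: homog_ops one_homog_zero)
  qed (simp add: homog_ops)
  ultimately show ?case by (simp add: poly_value_pCons[OF qc] homog_ops)
qed

subsection \<open>An odd polynomial congruent to a nontrivial solution of \<open>y\<^sup>3 = y\<close>\<close>

text \<open>Newton's iteration for \<open>y\<^sup>3 - y\<close>, with the inverse of the derivative replaced by its
  interpolation at the roots, maps \<open>y\<close> to \<open>(5 y\<^sup>3 - 3 y\<^sup>5) / 2\<close>. This keeps odd polynomials odd.\<close>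

lemma newton_step:
  fixes y :: "'k::field_char_0 poly"
  defines "z \<equiv> Polynomial.smult (1/2) (5 * y ^ 3 - 3 * y ^ 5)"
  shows "(y ^ 3 - y) ^ 2 dvd z ^ 3 - z"
proof -
  have two: "2 * z = 5 * y ^ 3 - 3 * y ^ 5"
  proof -
    have "2 * z = Polynomial.smult 2 z" by (simp add: numeral_poly)
    then show ?thesis by (simp add: z_def)
  qed
  let ?t = "5 * y ^ 3 - 3 * y ^ 5"
  \<comment> \<open>With t = 2 z the right-hand side is t (t - 2) (t + 2). Here t is divisible by
    y^3, and t - 2 and t + 2 have double roots at 1 and -1; the displayed cubics are the remaining
    factors.\<close>
  have "(y ^ 3 - y) ^ 2 * (y * (5 - 3 * y ^ 2) * (3 * y ^ 3 + 6 * y ^ 2 + 4 * y + 2) * (3 * y ^ 3 - 6 * y ^ 2 + 4 * y - 2))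
      = ?t ^ 3 - 4 * ?t"
    by (simp add: algebra_simps power2_eq_square power3_eq_cube power_numeral_reduce)
  also have "\<dots> = (2 * z) ^ 3 - 4 * (2 * z)" unfolding two ..
  also have "\<dots> = Polynomial.smult 8 (z ^ 3 - z)"
    by (simp add: power3_eq_cube numeral_poly smult_diff_right)
  finally have "(y ^ 3 - y) ^ 2 dvd Polynomial.smult 8 (z ^ 3 - z)" by (metis dvd_triv_left)
  then show ?thesis by (simp add: dvd_smult_iff)
qed

text \<open>A polynomial is first constructed that solves y^3 = y at each root of \<open>m\<close>,
  and is then lifted to the multiplicities of the roots. Oddness is expressed by composition with
  -X.\<close>

lemma exists_odd_tripotent_poly:
  fixes m :: "'k::{alg_closed_field, field_char_0} poly"
  assumes m: "m \<noteq> 0" and nil: "\<And>n. \<not> m dvd Polynomial.monom 1 n"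
  obtains g where "pcompose g [:0, -1:] = - g" "\<not> m dvd g" "m dvd g ^ 3 - g"
proof -
  obtain R where R: "m = Polynomial.smult (lead_coeff m) (\<Prod>x\<in>#R. [:- x, 1:])"
    using alg_closed_imp_factorization[OF m] by blast
  have m_dvd: "m dvd p \<longleftrightarrow> (\<Prod>x\<in>#R. [:- x, 1:]) dvd p" for p
    using m by (subst R) (simp add: smult_dvd_iff)
  \<comment> \<open>If all roots were zero, \<open>m\<close> would be a constant times a power of X,
    which \<open>nil\<close> excludes.\<close>
  obtain \<theta> where \<theta>: "\<theta> \<in># R" "\<theta> \<noteq> 0"
  proof (rule ccontr)
    assume "\<not> thesis"
    with that have "\<And>x. x \<in># R \<Longrightarrow> x = 0" by blast
    then have "(\<Prod>x\<in>#R. [:- x, 1:]) = Polynomial.monom 1 (size R)"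
      by (induction R) (auto simp: monom_Suc monom_0 one_pCons mult_pCons_left)
    with nil[of "size R"] show False by (simp add: m_dvd)
  qed
  let ?o = "[:0, -1 :: 'k:]"
  \<comment> \<open>Leaving out both \<theta> and -\<theta> keeps \<theta>^2 - \<rho>^2 nonzero for
    the remaining roots. The factors X^2 - \<rho>^2 are even and the extra factor X makes
    \<open>h\<close> odd.\<close>
  define D where "D = set_mset R - {\<theta>, - \<theta>}"
  define h where "h = [:0, 1:] * (\<Prod>\<rho>\<in>D. [:- (\<rho> ^ 2), 0, 1:])"
  have "poly h \<theta> = \<theta> * (\<Prod>\<rho>\<in>D. \<theta> ^ 2 - \<rho> ^ 2)"
    by (simp add: h_def poly_prod power2_eq_square algebra_simps)
  moreover have "\<theta> ^ 2 - \<rho> ^ 2 \<noteq> 0" if "\<rho> \<in> D" for \<rho>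
    using that by (auto simp: D_def power2_eq_iff)
  ultimately have h\<theta>: "poly h \<theta> \<noteq> 0" using \<theta>(2) by (simp add: D_def)
  have "pcompose (\<Prod>\<rho>\<in>D. [:- (\<rho> ^ 2), 0, 1:]) ?o = (\<Prod>\<rho>\<in>D. [:- (\<rho> ^ 2), 0, 1:])"
    unfolding pcompose_prod by (rule prod.cong) (simp_all add: pcompose_pCons)
  then have h_odd: "pcompose h ?o = - h"
    unfolding h_def pcompose_mult by (simp add: pcompose_pCons)
  \<comment> \<open>Normalized to 1 at \<theta>, it is -1 at -\<theta> by oddness and 0 at all other
    roots, so g0^3 - g0 vanishes at every root of \<open>m\<close>.\<close>
  define g0 where "g0 = Polynomial.smult (1 / poly h \<theta>) h"
  have g0_odd: "pcompose g0 ?o = - g0" by (simp add: g0_def pcompose_smult h_odd)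
  have neg: "poly g (- x) = - poly g x" if "pcompose g ?o = - g" for g x
    using arg_cong[OF that, of "\<lambda>p. poly p x"] by (simp add: poly_pcompose)
  have g0\<theta>: "poly g0 \<theta> = 1" using h\<theta> by (simp add: g0_def)
  have "poly (g0 ^ 3 - g0) x = 0" if "x \<in># R" for x
  proof (cases "x \<in> D")
    case True
    then have "poly h x = 0"
      using prod_zero[of D "\<lambda>\<rho>. x ^ 2 - \<rho> ^ 2"]
      by (auto simp: h_def poly_prod power2_eq_square algebra_simps D_def intro!: prod_zero)
    then show ?thesis by (simp add: g0_def)
  next
    case False
    then have "x = \<theta> \<or> x = - \<theta>" using that by (auto simp: D_def)
    then show ?thesis using g0\<theta> neg[OF g0_odd, of \<theta>] by auto
  qed
  \<comment> \<open>One factor g0^3 - g0 is spent per root counted with multiplicity, so repeated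
    roots are covered.\<close>
  then have "(\<Prod>x\<in>#R. [:- x, 1:]) dvd (g0 ^ 3 - g0) ^ size R"
  proof (induction R)
    case (add x R)
    have "poly (g0 ^ 3 - g0) x = 0" by (rule add.prems) simp
    then have "[:- x, 1:] dvd g0 ^ 3 - g0" by (rule iffD1[OF poly_eq_0_iff_dvd])
    moreover have "(\<Prod>x\<in>#R. [:- x, 1:]) dvd (g0 ^ 3 - g0) ^ size R"
      by (rule add.IH) (rule add.prems, simp)
    ultimately have "[:- x, 1:] * (\<Prod>x\<in>#R. [:- x, 1:]) dvd (g0 ^ 3 - g0) * (g0 ^ 3 - g0) ^ size R"
      by (rule mult_dvd_mono)
    then show ?case by simp
  qed simp
  then have m_g0: "m dvd (g0 ^ 3 - g0) ^ size R" by (simp add: m_dvd)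
  \<comment> \<open>Each Newton step doubles the exponent and preserves oddness and the value 1 at
    \<theta>, as (5 - 3) / 2 = 1. That value later shows that \<open>m\<close>, which vanishes at
    \<theta>, does not divide \<open>g\<close>.\<close>
  have "\<exists>g. pcompose g ?o = - g \<and> poly g \<theta> = 1 \<and> (g0 ^ 3 - g0) ^ (2 ^ n) dvd g ^ 3 - g" for n
  proof (induction n)
    case 0
    show ?case using g0_odd g0\<theta> by (intro exI[of _ g0]) simp
  next
    case (Suc n)
    then obtain g where g: "pcompose g ?o = - g" "poly g \<theta> = 1"
      "(g0 ^ 3 - g0) ^ (2 ^ n) dvd g ^ 3 - g" by blast
    define z where "z = Polynomial.smult (1/2) (5 * g ^ 3 - 3 * g ^ 5)"
    have pow: "pcompose (g ^ k) ?o = (- g) ^ k" for k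
      by (induction k) (simp_all add: pcompose_mult pcompose_1 g(1))
    have num: "pcompose (numeral v * p) ?o = numeral v * pcompose p ?o" for v p
      by (simp add: pcompose_smult numeral_poly)
    have "pcompose z ?o = - z"
      by (simp add: z_def pcompose_smult pcompose_diff num pow smult_diff_right)
    moreover have "poly z \<theta> = 1" by (simp add: z_def g(2))
    moreover have "(g0 ^ 3 - g0) ^ (2 ^ Suc n) dvd z ^ 3 - z"
    proof -
      have "((g0 ^ 3 - g0) ^ (2 ^ n)) ^ 2 dvd (g ^ 3 - g) ^ 2" by (rule dvd_power_same[OF g(3)])
      also have "\<dots> dvd z ^ 3 - z" unfolding z_def by (rule newton_step)
      finally show ?thesis by (simp add: power_mult[symmetric] mult.commute)
    qed
    ultimately show ?case by blast
  qed
  then obtain g where g: "pcompose g ?o = - g" "poly g \<theta> = 1" "(g0 ^ 3 - g0) ^ (2 ^ size R) dvd g ^ 3 - g"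
    by blast
  have "size R \<le> 2 ^ size R" by (simp add: less_imp_le)
  then have "m dvd g ^ 3 - g"
    by (rule dvd_trans[OF dvd_trans[OF m_g0 le_imp_power_dvd] g(3)])
  moreover have "\<not> m dvd g"
  proof
    assume "m dvd g"
    moreover have "poly m \<theta> = 0"
      using \<theta>(1) by (subst R) (auto simp: poly_prod_mset prod_mset_zero_iff)
    ultimately have "poly g \<theta> = 0" by (auto elim!: dvdE)
    with g(2) show False by simp
  qed
  ultimately show ?thesis using g(1) that by blast
qed

text \<open>Evaluation at \<open>q\<close> translates divisibility by the minimal polynomial: g^3 -
  g being divisible gives c^3 = c, and \<open>g\<close> not being divisible gives that c is nonzero.
  Since \<open>q\<close> is not nilpotent, that polynomial divides no power of X.\<close>

lemma exists_odd_tripotent: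
  fixes P :: "('k::{alg_closed_field, field_char_0}, 'p) graded_algebra" (structure)
  assumes P: "z2_graded_algebra P" and fd: "finite_dimensional P"
    and q: "q \<in> homog P 1" "\<And>n. list_product P (replicate n q) \<noteq> \<zero>"
  obtains c where "c \<in> homog P 1" "c \<noteq> \<zero>" "c \<otimes> c \<otimes> c = c"
proof -
  interpret z2_graded_algebra P by (rule P)
  have qc: "q \<in> carrier P" using q(1) by (rule homog_in_carrier)
  obtain m where m: "m \<noteq> 0" "poly_value q m = \<zero>" "\<And>p. poly_value q p = \<zero> \<Longrightarrow> m dvd p"
    using exists_minimal_annihilator[OF qc fd] by blast
  have "\<not> m dvd Polynomial.monom 1 n" for n
  proof
    assume "m dvd Polynomial.monom 1 n"
    then have "poly_value q (Polynomial.monom 1 n) = \<zero>" by (rule poly_value_dvd[OF qc m(2)])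
    moreover have "list_product P (replicate n q) \<in> carrier P" using qc by (intro list_product_closed) auto
    ultimately show False using q(2)[of n] by (simp add: poly_value_monom[OF qc])
  qed
  from exists_odd_tripotent_poly[OF m(1) this] obtain g where
    g: "pcompose g [:0, -1:] = - g" "\<not> m dvd g" "m dvd g ^ 3 - g" by blast
  let ?c = "poly_value q g"
  have "of_nat i = (1 :: bit)" if "Polynomial.coeff g i \<noteq> 0" for i
  proof (rule ccontr)
    assume "of_nat i \<noteq> (1 :: bit)"
    then have "even i" by (simp add: of_nat_bit_eq_iff)
    \<comment> \<open>Composition with -X fixes coefficients of even index, while oddness negates
      them, so they vanish in characteristic 0.\<close>
    then have "Polynomial.coeff g i = - Polynomial.coeff g i"
      using arg_cong[OF g(1), of "\<lambda>p. Polynomial.coeff p i"] by (simp add: coeff_pcompose_linear)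
    then have "2 * Polynomial.coeff g i = 0" by (simp only: mult_2 eq_neg_iff_add_eq_0)
    with that show False by simp
  qed
  then have "?c \<in> homog P 1" by (rule poly_value_parity[OF q(1)])
  moreover have "?c \<noteq> \<zero>" using g(2) m(3) by blast
  moreover have "?c \<otimes> ?c \<otimes> ?c = ?c"
  proof -
    have "poly_value q (g ^ 3) = poly_value q (g ^ 3 - g) \<oplus> ?c"
      using poly_value_add[OF qc, of "g ^ 3 - g" g] by simp
    also have "\<dots> = ?c" using poly_value_dvd[OF qc m(2) g(3)] by (simp add: qc)
    finally show ?thesis by (simp add: power3_eq_cube poly_value_mult qc)
  qed
  ultimately show ?thesis by (rule that)
qed

subsection \<open>The subalgebra spanned by an odd tripotent\<close>

lemma K_plus_cK_simps [simp]:
  "carrier K_plus_cK = UNIV" "one K_plus_cK = (1, 0)" "ring.zero K_plus_cK = (0, 0)"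
  "(a, b) \<otimes>\<^bsub>K_plus_cK\<^esub> (a', b') = (a * a' + b * b', a * b' + b * a')"
  "(a, b) \<oplus>\<^bsub>K_plus_cK\<^esub> (a', b') = (a + a', b + b')"
  "k \<odot>\<^bsub>K_plus_cK\<^esub> (a, b) = (k * a, k * b)"
  "homog K_plus_cK g = (if g = 0 then {(a, 0) |a. True} else {(0, b) |b. True})"
  by (simp_all add: K_plus_cK_def)

context
  fixes P :: "('k::field, 'p) graded_algebra" (structure) and c
  assumes P: "z2_graded_algebra P" and c: "c \<in> homog P 1" "c \<noteq> \<zero>" "c \<otimes> c \<otimes> c = c"
begin

interpretation P: z2_graded_algebra P by (rule P)

abbreviation "e \<equiv> c \<otimes> c"

text \<open>The prospective inverse of the isomorphism onto \<open>K_plus_cK\<close>.\<close>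

definition "emb = (\<lambda>(a, b). a \<odot> e \<oplus> b \<odot> c)"

text \<open>Its identity is the idempotent \<open>e\<close>, which may differ from the identity of
  \<open>P\<close>.\<close>

definition "tripotent_algebra = \<lparr>carrier = range emb, monoid.mult = monoid.mult P, one = e,
  ring.zero = \<zero>, add = add P, module.smult = module.smult P, homog = \<lambda>g. homog P g \<inter> range emb\<rparr>"

lemma tripotent_simps:
  "carrier tripotent_algebra = range emb" "monoid.mult tripotent_algebra = monoid.mult P"
  "one tripotent_algebra = e" "ring.zero tripotent_algebra = \<zero>" "add tripotent_algebra = add P"
  "module.smult tripotent_algebra = module.smult P" "homog tripotent_algebra g = homog P g \<inter> range emb"
  by (simp_all add: tripotent_algebra_def)

lemma ce: "c \<in> carrier P" "e \<in> carrier P" "e \<in> homog P 0" "e \<otimes> c = c" "c \<otimes> e = c" "e \<otimes> e = e" "e \<noteq> \<zero>"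
proof -
  show cc: "c \<in> carrier P" using c(1) by (rule P.homog_in_carrier)
  then show "e \<in> carrier P" by simp
  show "e \<in> homog P 0" using P.homog_mult[OF c(1) c(1)] by simp
  show "e \<otimes> c = c" by (rule c(3))
  show 1: "c \<otimes> e = c" using c(3) cc by (simp add: P.m_assoc)
  show "e \<otimes> e = e" using 1 cc by (simp add: P.m_assoc)
  show "e \<noteq> \<zero>" using c(2,3) cc by auto
qed

lemma emb_closed: "emb x \<in> carrier P"
  using ce by (cases x) (simp add: emb_def)

lemma emb_hom:
  "emb (a, b) \<oplus> emb (a', b') = emb (a + a', b + b')"
  "k \<odot> emb (a, b) = emb (k * a, k * b)"
  "emb (a, b) \<otimes> emb (a', b') = emb (a * a' + b * b', a * b' + b * a')"
  "emb (0, 0) = \<zero>" "emb (1, 0) = e" "emb (0, 1) = c"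
  using ce by (simp_all add: emb_def P.smult_add_left P.smult_add_right P.l_distr P.r_distr
      P.smult_mult_left P.smult_mult_right P.M.a_ac mult.commute)

lemma emb_homog: "emb (a, 0) \<in> homog P 0" "emb (0, b) \<in> homog P 1"
  using ce c(1) by (simp_all add: emb_def P.homog_ops)

text \<open>If a e + b c = 0, then a e = -b c lies in both degrees and is zero; \<open>e\<close> and
  \<open>c\<close> themselves are nonzero.\<close>

lemma emb_eq_zero: "emb (a, b) = \<zero> \<longleftrightarrow> a = 0 \<and> b = 0"
proof
  assume z: "emb (a, b) = \<zero>"
  have "emb (a, 0) = emb (a, b) \<oplus> emb (0, - b)" by (simp add: emb_hom(1))
  also have "\<dots> = emb (0, - b)" using emb_closed by (simp add: z)
  finally have eq: "emb (a, 0) = emb (0, - b)" .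
  then have "emb (a, 0) = \<zero>"
    using P.homog_disjoint[of "emb (a, 0)" 0] emb_homog(1)[of a] emb_homog(2)[of "- b"] by simp
  moreover from this eq have "emb (0, - b) = \<zero>" by simp
  ultimately show "a = 0 \<and> b = 0"
    using ce c(2) by (simp add: emb_def P.smult_eq_zero_iff)
qed (simp add: emb_hom)

lemma inj_emb: "inj emb"
proof (rule injI)
  fix x y assume eq: "emb x = emb y"
  obtain a b a' b' where xy: "x = (a, b)" "y = (a', b')" by (cases x, cases y)
  have "emb (a + (-1) * a', b + (-1) * b') = emb x \<oplus> (-1) \<odot> emb y"
    by (simp only: xy emb_hom)
  also have "\<dots> = \<zero>" unfolding eq by (rule P.add_neg_smult[OF emb_closed])
  finally show "x = y" unfolding emb_eq_zero xy by simp
qed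

lemma emb_homog_iff: "homog P 0 \<inter> range emb = {emb (a, 0) |a. True}" "homog P 1 \<inter> range emb = {emb (0, b) |b. True}"
proof -
  have 0: "b = 0" if "emb (a, b) \<in> homog P 0" for a b
  proof -
    have "emb (0, b) = emb (a, b) \<oplus> (-1) \<odot> emb (a, 0)" by (simp add: emb_hom(1,2))
    then have "emb (0, b) \<in> homog P 0" using that emb_homog by (simp add: P.homog_ops)
    then show ?thesis using P.homog_disjoint[of "emb (0, b)" 0] emb_homog(2)[of b] emb_eq_zero by simp
  qed
  have 1: "a = 0" if "emb (a, b) \<in> homog P 1" for a b
  proof -
    have "emb (a, 0) = emb (a, b) \<oplus> (-1) \<odot> emb (0, b)" by (simp add: emb_hom(1,2))
    then have "emb (a, 0) \<in> homog P 1" using that emb_homog by (simp add: P.homog_ops)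
    then show ?thesis using P.homog_disjoint[of "emb (a, 0)" 0] emb_homog(1)[of a] emb_eq_zero by simp
  qed
  show "homog P 0 \<inter> range emb = {emb (a, 0) |a. True}" using 0 emb_homog(1) by auto
  show "homog P 1 \<inter> range emb = {emb (0, b) |b. True}" using 1 emb_homog(2) by auto
qed

lemma range_embE:
  assumes "x \<in> range emb" obtains a b where "x = emb (a, b)"
  using assms by (elim rangeE) (metis surj_pair)

lemma unital_tripotent: "unital_algebra tripotent_algebra"
proof -
  have cl: "x \<oplus> y \<in> range emb" "x \<otimes> y \<in> range emb" "k \<odot> x \<in> range emb"
    if "x \<in> range emb" "y \<in> range emb" for x y k
    using that by (auto simp: emb_hom)
  have cl': "k \<odot> x \<in> range emb" if "x \<in> range emb" for x k using cl(3)[OF that that] .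
  have car: "x \<in> carrier P" if "x \<in> range emb" for x using that emb_closed by auto
  have ze: "\<zero> \<in> range emb" "e \<in> range emb" using emb_hom(4,5) by (metis rangeI)+
  have un: "e \<otimes> x = x" "x \<otimes> e = x" if xr: "x \<in> range emb" for x
  proof -
    obtain a b where x: "x = emb (a, b)" using xr by (rule range_embE)
    have "emb (1, 0) \<otimes> emb (a, b) = emb (a, b)" "emb (a, b) \<otimes> emb (1, 0) = emb (a, b)"
      by (simp_all add: emb_hom(3))
    then show "e \<otimes> x = x" "x \<otimes> e = x" unfolding emb_hom(5) x by simp_all
  qed
  show ?thesis
    by (rule unital_algebraI; unfold tripotent_simps)
      (simp_all add: ze un cl cl' car P.M.a_ac P.m_assoc P.l_distr P.r_distr P.smult_add_left
        P.smult_add_right P.smult_mult_left P.smult_mult_right)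
qed

lemma graded_tripotent: "z2_graded_algebra tripotent_algebra"
proof (intro z2_graded_algebra.intro z2_graded_algebra_axioms.intro unital_tripotent)
  have cl: "x \<oplus> y \<in> range emb" "x \<otimes> y \<in> range emb" if "x \<in> range emb" "y \<in> range emb" for x y
    using that by (auto simp: emb_hom)
  have cl': "k \<odot> x \<in> range emb" if "x \<in> range emb" for x k using that by (auto simp: emb_hom)
  have ze: "\<zero> \<in> range emb" using emb_hom(4) by (metis rangeI)
  show "submodule (homog tripotent_algebra g) ring_of_type_algebra tripotent_algebra" for g
    unfolding unital_algebra.submodule_iff[OF unital_tripotent] tripotent_simps
    using cl cl' ze P.homog_ops by simp
  show "homog tripotent_algebra 0 \<inter> homog tripotent_algebra 1 = {\<zero>\<^bsub>tripotent_algebra\<^esub>}"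
    unfolding tripotent_simps using P.homog_direct ze by blast
  show "x \<otimes>\<^bsub>tripotent_algebra\<^esub> y \<in> homog tripotent_algebra (g + h)"
    if "x \<in> homog tripotent_algebra g" "y \<in> homog tripotent_algebra h" for x y g h
    using that cl P.homog_mult unfolding tripotent_simps by blast
  show "homog tripotent_algebra 0 <+>\<^bsub>tripotent_algebra\<^esub> homog tripotent_algebra 1 = carrier tripotent_algebra"
    unfolding set_add_def' tripotent_simps emb_homog_iff
  proof
    show "range emb \<subseteq> (\<Union>h\<in>{emb (a, 0) |a. True}. \<Union>k\<in>{emb (0, b) |b. True}. {h \<oplus> k})"
    proof
      fix x assume "x \<in> range emb"
      then obtain a b where "x = emb (a, b)" by (rule range_embE)
      then have "x = emb (a, 0) \<oplus> emb (0, b)" by (simp add: emb_hom(1))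
      then show "x \<in> (\<Union>h\<in>{emb (a, 0) |a. True}. \<Union>k\<in>{emb (0, b) |b. True}. {h \<oplus> k})" by blast
    qed
  qed (auto simp: emb_hom(1))
qed

lemma graded_subalgebra_tripotent: "graded_subalgebra tripotent_algebra P"
  unfolding graded_subalgebra_def tripotent_simps using graded_tripotent emb_closed by auto

text \<open>Every nonzero homogeneous element is a e or b c with nonzero coefficient and is
  invertible: a multiple of \<open>e\<close>, respectively of \<open>c\<close>, carries it to
  \<open>e\<close>. So a nonzero homogeneous ideal contains the identity.\<close>

lemma graded_simple_tripotent: "graded_simple tripotent_algebra"
  unfolding graded_simple_def tripotent_simps
proof (intro conjI allI impI)
  have er: "e \<in> range emb" using emb_hom(5) by (metis rangeI)
  show "\<exists>x\<in>range emb. \<exists>y\<in>range emb. x \<otimes> y \<noteq> \<zero>"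
    using er ce(6,7) by (intro bexI[of _ e]) simp_all
  fix I assume I: "homogeneous_ideal I tripotent_algebra"
  then have id: "ideal I tripotent_algebra" by (simp add: homogeneous_ideal_def)
  have dec: "I = {x \<oplus> y |x y. x \<in> I \<inter> homog P 0 \<inter> range emb \<and> y \<in> I \<inter> homog P 1 \<inter> range emb}"
    using I unfolding homogeneous_ideal_def set_add_def' tripotent_simps by blast
  have l: "y \<otimes> x \<in> I" if "x \<in> I" "y \<in> range emb" for x y
    using ideal.I_l_closed[OF id that(1), of y] that(2) unfolding tripotent_simps by blast
  have full: "I = range emb" if "e \<in> I"
  proof
    show "I \<subseteq> range emb"
      using additive_subgroup.a_subset[OF ideal.axioms(1)[OF id]] unfolding tripotent_simps .
    show "range emb \<subseteq> I"
    proof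
      fix x assume x: "x \<in> range emb"
      then obtain a b where ab: "x = emb (a, b)" by (rule range_embE)
      have "emb (a, b) \<otimes> emb (1, 0) = x" by (simp add: emb_hom(3) ab)
      then show "x \<in> I" using l[OF that x] unfolding emb_hom(5) ab by simp
    qed
  qed
  show "I = {\<zero>} \<or> I = range emb"
  proof (rule ccontr)
    assume n: "\<not> (I = {\<zero>} \<or> I = range emb)"
    have "a = 0" if "emb (a, 0) \<in> I" for a
    proof (rule ccontr)
      assume "a \<noteq> 0"
      then have "emb (1 / a, 0) \<otimes> emb (a, 0) = e" by (simp add: emb_hom(3)) (simp add: emb_hom(5))
      then have "e \<in> I" using l[OF that, of "emb (1 / a, 0)"] by simp
      with full n show False by blast
    qed
    moreover have "b = 0" if "emb (0, b) \<in> I" for b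
    proof (rule ccontr)
      assume "b \<noteq> 0"
      then have "emb (0, 1 / b) \<otimes> emb (0, b) = e" by (simp add: emb_hom(3)) (simp add: emb_hom(5))
      then have "e \<in> I" using l[OF that, of "emb (0, 1 / b)"] by simp
      with full n show False by blast
    qed
    ultimately have "I \<inter> homog P 0 \<inter> range emb \<subseteq> {\<zero>}" "I \<inter> homog P 1 \<inter> range emb \<subseteq> {\<zero>}"
      unfolding Int_assoc emb_homog_iff using emb_hom(4) by auto
    note zero = this
    have "I \<subseteq> {\<zero>}"
    proof
      fix x assume "x \<in> I"
      then obtain y z where "x = y \<oplus> z" "y \<in> I \<inter> homog P 0 \<inter> range emb" "z \<in> I \<inter> homog P 1 \<inter> range emb"
        by (subst (asm) dec) blast
      moreover from this zero have "y = \<zero>" "z = \<zero>" by blast+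
      ultimately show "x \<in> {\<zero>}" by simp
    qed
    moreover have "\<zero> \<in> I"
      using additive_subgroup.zero_closed[OF ideal.axioms(1)[OF id]] unfolding tripotent_simps .
    ultimately show False using n by blast
  qed
qed

lemma tripotent_isomorphic: "graded_isomorphic tripotent_algebra (K_plus_cK :: ('k, _) graded_algebra)"
proof -
  define r where "r = inv_into UNIV emb"
  have inv [simp]: "r (emb x) = x" for x unfolding r_def by (rule inv_f_f[OF inj_emb])
  have one: "r e = (1, 0)" unfolding emb_hom(5)[symmetric] by simp
  have "r \<in> ring_hom tripotent_algebra K_plus_cK"
    by (rule ring_hom_memI) (auto simp: tripotent_simps emb_hom one)
  moreover have "bij_betw r (range emb) UNIV"
    using bij_betw_inv_into[of emb UNIV "range emb"] inj_emb by (simp add: bij_betw_def r_def)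
  ultimately have "r \<in> ring_iso tripotent_algebra K_plus_cK"
    by (simp add: ring_iso_def tripotent_simps)
  moreover have "r (k \<odot>\<^bsub>tripotent_algebra\<^esub> x) = k \<odot>\<^bsub>K_plus_cK\<^esub> r x"
    if "x \<in> carrier tripotent_algebra" for k x
    using that by (auto simp: tripotent_simps emb_hom)
  moreover have "r ` homog tripotent_algebra g = homog K_plus_cK g" for g
  proof -
    have "{emb (a, 0) |a. True} = emb ` {(a, 0) |a. True}" "{emb (0, b) |b. True} = emb ` {(0, b) |b. True}"
      by auto
    then show ?thesis by (cases g) (simp_all add: tripotent_simps emb_homog_iff image_image)
  qed
  ultimately show ?thesis unfolding graded_isomorphic_def by blast
qed

end

text \<open>Any degree pattern is realized by the identity \<open>u\<close> of the subalgebra in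
  even places and by the image \<open>c\<close> of the odd generator in odd places; such products do
  not vanish.\<close>

lemma regular_of_K_plus_cK_subalgebra:
  fixes P :: "('k::field, 'p) graded_algebra"
  assumes P: "z2_graded_algebra P" and cring: "cring P"
    and B: "graded_subalgebra B P" "graded_isomorphic B (K_plus_cK :: ('k, _) graded_algebra)"
  shows "regular P"
proof -
  interpret P: z2_graded_algebra P by (rule P)
  have gB: "z2_graded_algebra B" using B(1) by (simp add: graded_subalgebra_def)
  interpret B: z2_graded_algebra B by (rule gB)
  have sub: "carrier B \<subseteq> carrier P" "\<And>g. homog B g = homog P g \<inter> carrier B"
    "\<And>x y. x \<in> carrier B \<Longrightarrow> y \<in> carrier B \<Longrightarrow> x \<otimes>\<^bsub>B\<^esub> y = x \<otimes>\<^bsub>P\<^esub> y"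
    using B(1) by (auto simp: graded_subalgebra_def)
  obtain h where h: "h \<in> ring_iso B K_plus_cK" "\<And>g. h ` homog B g = homog (K_plus_cK :: ('k, _) graded_algebra) g"
    using B(2) unfolding graded_isomorphic_def by blast
  have hom: "\<And>x y. x \<in> carrier B \<Longrightarrow> y \<in> carrier B \<Longrightarrow> h (x \<otimes>\<^bsub>B\<^esub> y) = h x \<otimes>\<^bsub>K_plus_cK\<^esub> h y"
    "h \<one>\<^bsub>B\<^esub> = (1, 0)" "inj_on h (carrier B)"
    using ring_iso_memE[OF h(1)] by (auto simp: bij_betw_def)
  let ?u = "\<one>\<^bsub>B\<^esub>"
  have "(0, 1) \<in> h ` homog B 1" unfolding h(2) by simp
  then obtain c where c: "c \<in> homog B 1" "h c = (0, 1)" by force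
  have cc: "c \<in> carrier B" using c(1) by (rule B.homog_in_carrier)
  have ncu: "c \<noteq> ?u" using c(2) hom(2) by auto
  have "h (c \<otimes>\<^bsub>B\<^esub> c) = h ?u" by (simp add: hom cc c(2))
  then have ccB: "c \<otimes>\<^bsub>B\<^esub> c = ?u" using inj_onD[OF hom(3)] cc by blast
  have mult: "?u \<otimes>\<^bsub>P\<^esub> ?u = ?u" "?u \<otimes>\<^bsub>P\<^esub> c = c" "c \<otimes>\<^bsub>P\<^esub> ?u = c" "c \<otimes>\<^bsub>P\<^esub> c = ?u"
    using sub(3)[of ?u ?u] sub(3)[of ?u c] sub(3)[of c ?u] sub(3)[of c c] cc ccB by simp_all
  have uP: "?u \<in> carrier P" "c \<in> carrier P" using sub(1) cc by auto
  \<comment> \<open>If \<open>u\<close> were zero, then c = u c = 0 = u, although the isomorphism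
    separates \<open>c\<close> from \<open>u\<close>.\<close>
  have "?u \<noteq> \<zero>\<^bsub>P\<^esub>"
  proof
    assume "?u = \<zero>\<^bsub>P\<^esub>"
    then have "c = \<zero>\<^bsub>P\<^esub>" using mult(2) uP by (metis P.l_null)
    with \<open>?u = \<zero>\<^bsub>P\<^esub>\<close> ncu show False by simp
  qed
  moreover from this have "c \<noteq> \<zero>\<^bsub>P\<^esub>" using mult(4) uP by (metis P.l_null)
  ultimately have nz: "x \<noteq> \<zero>\<^bsub>P\<^esub>" if "x \<in> {?u, c}" for x using that by auto
  have "\<exists>as. list_all2 (\<lambda>a g. a \<in> homog P g) as gs \<and> list_product P as \<noteq> \<zero>\<^bsub>P\<^esub>" for gs
  proof -
    define as where "as = map (\<lambda>g. if g = 1 then c else ?u) gs"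
    have "(if g = 1 then c else ?u) \<in> homog P g" for g
      using c(1) B.one_homog_zero sub(2) by (cases g) auto
    then have "list_all2 (\<lambda>a g. a \<in> homog P g) as gs"
      by (simp add: as_def list_all2_conv_all_nth)
    moreover have asP: "list_product P as \<in> carrier P"
      using uP by (intro P.list_product_closed) (auto simp: as_def)
    \<comment> \<open>The empty product is the identity of \<open>P\<close> rather than
      \<open>u\<close>. Multiplying by \<open>u\<close> on the right brings every product back into
      the subalgebra, where it is \<open>u\<close> or \<open>c\<close>.\<close>
    moreover have "list_product P as \<otimes>\<^bsub>P\<^esub> ?u \<in> {?u, c}"
      unfolding as_def
    proof (induction gs)
      case (Cons g gs)
      let ?L = "list_product P (map (\<lambda>g. if g = 1 then c else ?u) gs)"
      have "?L \<in> carrier P" using uP by (intro P.list_product_closed) auto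
      then have "list_product P (map (\<lambda>g. if g = 1 then c else ?u) (g # gs)) \<otimes>\<^bsub>P\<^esub> ?u =
          (if g = 1 then c else ?u) \<otimes>\<^bsub>P\<^esub> (?L \<otimes>\<^bsub>P\<^esub> ?u)"
        using uP by (simp add: P.m_assoc)
      with Cons.IH mult show ?case by auto
    qed (use uP in simp)
    then have "list_product P as \<noteq> \<zero>\<^bsub>P\<^esub>" using nz uP by (metis P.l_null)
    ultimately show ?thesis by blast
  qed
  note nonvanishing = this
  have "regular_wrt (\<lambda>g h. 1) P"
    unfolding regular_wrt_def
  proof (intro conjI allI ballI nonvanishing)
    fix g h a b assume "a \<in> homog P g" "b \<in> homog P h"
    then show "a \<otimes>\<^bsub>P\<^esub> b = 1 \<odot>\<^bsub>P\<^esub> (b \<otimes>\<^bsub>P\<^esub> a)"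
      using comm_monoid.m_comm[of P a b] cring P.homog_in_carrier by (simp add: cring_def)
  qed simp
  then show ?thesis unfolding regular_def by blast
qed

theorem theorem26:
  fixes A :: "('k::{alg_closed_field, field_char_0}, 'a) graded_algebra"
    and P :: "('k, 'p) graded_algebra"
  assumes "z2_graded_algebra A"
    and "z2_graded_algebra P" and "finite_dimensional P"
    and "graded_identities A = graded_identities (grassmann_envelope P)"
  shows "let
      a = generates_graded_variety A (grassmann :: ('k, _) graded_algebra);
      b = (regular P \<and> cring P);
      c = (cring P \<and>
        (\<exists>B. graded_subalgebra B P \<and> graded_simple B \<and>
          graded_isomorphic B (K_plus_cK :: ('k, _) graded_algebra)))
    in (a \<longleftrightarrow> b) \<and> (b \<longleftrightarrow> c) \<and>
      (a \<or> b \<or> c \<longrightarrow> \<not> finite_dimensional A \<and> regular A \<and> minimal_regular A)"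
proof -
  define E where "E = (grassmann :: ('k, _) graded_algebra)"
  define a where "a = generates_graded_variety A E"
  define b where "b = (regular P \<and> cring P)"
  define c where "c = (cring P \<and> (\<exists>B. graded_subalgebra B P \<and> graded_simple B \<and>
    graded_isomorphic B (K_plus_cK :: ('k, _) graded_algebra)))"
  let ?\<beta> = "grassmann_commutation :: bit \<Rightarrow> bit \<Rightarrow> 'k"
  have A: "unit_graded A" by (rule z2_graded_algebra.unit_graded[OF assms(1)])
  have E: "unit_graded E" "regular_wrt ?\<beta> E"
    unfolding E_def by (rule gr.unit_graded_axioms, rule regular_grassmann)
  have EP: "unit_graded (grassmann_envelope P)" by (rule unit_graded_envelope[OF assms(2)])
  have "a \<longleftrightarrow> graded_identities A = graded_identities E"
    using assms(1) by (auto simp: a_def generates_graded_variety_def graded_variety_def)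
  \<comment> \<open>Equal identities transfer regularity from \<open>E\<close> to \<open>A\<close>;
    conversely, regularity with this commutation factor forces both sets of identities to be the
    polynomials with zero normal form.\<close>
  also have "\<dots> \<longleftrightarrow> regular_wrt ?\<beta> A"
    using regular_wrt_of_identities[OF E(1) A _ E(2)] graded_identities_regular[OF E]
      graded_identities_regular[OF A] by auto
  finally have a: "a \<longleftrightarrow> regular_wrt ?\<beta> A" .
  also have "\<dots> \<longleftrightarrow> regular_wrt ?\<beta> (grassmann_envelope P)"
    using regular_wrt_of_identities[OF A EP assms(4)] regular_wrt_of_identities[OF EP A assms(4)[symmetric]]
    by blast
  also have "\<dots> \<longleftrightarrow> b"
    using regular_envelope_imp[OF assms(2)] regular_envelope[OF assms(2)] by (auto simp: b_def)
  finally have ab: "a \<longleftrightarrow> b" .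
  have bc: "b \<longleftrightarrow> c"
  proof
    assume b
    then have P: "cring P" "regular P" by (simp_all add: b_def)
    then have "\<exists>as. list_all2 (\<lambda>a g. a \<in> homog P g) as (replicate n 1) \<and> list_product P as \<noteq> \<zero>\<^bsub>P\<^esub>" for n
      unfolding regular_def regular_wrt_def by blast
    from exists_nonnilpotent_odd[OF assms(2) P(1) assms(3) this] obtain q where
      "q \<in> homog P 1" "\<And>n. list_product P (replicate n q) \<noteq> \<zero>\<^bsub>P\<^esub>" by blast
    from exists_odd_tripotent[OF assms(2,3) this] obtain d where
      d: "d \<in> homog P 1" "d \<noteq> \<zero>\<^bsub>P\<^esub>" "d \<otimes>\<^bsub>P\<^esub> d \<otimes>\<^bsub>P\<^esub> d = d" by blast
    note d = assms(2) d
    show c unfolding c_def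
      using P(1) graded_subalgebra_tripotent[OF d] graded_simple_tripotent[OF d] tripotent_isomorphic[OF d] by blast
  next
    assume c
    then show b unfolding b_def c_def using regular_of_K_plus_cK_subalgebra[OF assms(2)] by blast
  qed
  have fin: "\<not> finite_dimensional A \<and> regular A \<and> minimal_regular A" if a
  proof -
    have reg: "regular_wrt ?\<beta> A" using that a by simp
    have "\<not> (\<exists>h k. h \<noteq> k \<and> (\<forall>g. ?\<beta> g h = ?\<beta> g k))"
    proof
      assume "\<exists>h k. h \<noteq> k \<and> (\<forall>g. ?\<beta> g h = ?\<beta> g k)"
      \<comment> \<open>Degree 1 separates the two columns: the factors of (1, 0) and (1, 1) are 1
        and -1, which differ in characteristic 0.\<close>
      then obtain h k where hk: "h \<noteq> k" "?\<beta> 1 h = ?\<beta> 1 k" by blast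
      then show False by (cases h; cases k) (simp_all add: grassmann_commutation_def)
    qed
    with reg show ?thesis
      using infinite_dimensional_supercommutative[OF assms(1) reg]
      unfolding regular_def minimal_regular_def by blast
  qed
  show ?thesis
    unfolding Let_def E_def[symmetric] a_def[symmetric] b_def[symmetric] c_def[symmetric]
    using ab bc fin by blast
qed

end
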